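(* Assume either $\kappa=\omega_1$, or $\kappa=\lambda^+>\omega_1$ and $\square_\lambda$ holds. Then the partial order $\langle\mathcal P(\kappa),\subset_{\mathrm{NS}}\rangle$ can be embedded into $\langle\mathcal E^B_\kappa,\le_B\rangle$.
   Context: Throughout, $\kappa$ is an uncountable regular cardinal with $\kappa^{<\kappa}=\kappa$ (i.e. $|\kappa^\alpha|=\kappa$ for all $0<\alpha<\kappa$); regular cardinals are infinite. The space $2^\kappa$ of all functions $\kappa\to\{0,1\}$ carries the topology generated by the sets $N_p=\{\eta\in 2^\kappa\mid \eta\restriction\alpha=p\}$ for $\alpha<\kappa$, $p\in 2^\alpha$. Borel sets are obtained by closing the topology under unions and intersections of length $\le\kappa$ and complements (likewise for $(2^\kappa)^2$ with the product topology). A function is Borel if inverse images of open sets are Borel. For equivalence relations $E,E'$ on $2^\kappa$, $E\le_B E'$ means that there is a Borel function $f\colon 2^\kappa\to2^\kappa$ with $(\eta,\xi)\in E\iff(f(\eta),f(\xi))\in E'$ for all $\eta,\xi$. $\mathcal E^B_\kappa$ is the set of equivalence relations on $2^\kappa$ that are Borel subsets of $(2^\kappa)^2$. $X\subset_{\mathrm{NS}}Y$ means that $X\setminus Y$ is non-stationary in $\kappa$. Both $\subset_{\mathrm{NS}}$ and $\le_B$ are quasiorders, regarded as partial orders modulo the induced equivalence relations; that $\langle\mathcal P(\kappa),\subset_{\mathrm{NS}}\rangle$ can be embedded into $\langle\mathcal E^B_\kappa,\le_B\rangle$ means that there is a map $F\colon\mathcal P(\kappa)\to\mathcal E^B_\kappa$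 with $X\subset_{\mathrm{NS}}Y\iff F(X)\le_B F(Y)$ for all $X,Y\subset\kappa$. For $\kappa=\lambda^+$ with $\lambda$ a regular uncountable cardinal, $\square_\lambda$ is the statement that there is a sequence $\langle C_\alpha\mid\alpha<\kappa\text{ a nonzero limit ordinal}\rangle$ such that: (1) $C_\alpha\subset\alpha$ is closed and unbounded in $\alpha$; (2) if $\beta\in\lim C_\alpha$ (i.e. $\beta<\alpha$ is a limit point of $C_\alpha$), then $C_\beta=\beta\cap C_\alpha$; (3) if $\mathrm{cf}(\alpha)<\lambda$, then $|C_\alpha|<\lambda$. *)

theory Defs
  imports "HOL-Analysis.Analysis"
begin

unbundle cardinal_syntax

text \<open>
  The cardinal \<open>\<kappa>\<close> is represented by a type \<open>'k\<close> of class \<^class>\<open>wellorder\<close> whose order is a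
  cardinal order. The elements of \<open>'k\<close> are the ordinals below \<open>\<kappa>\<close>; an ordinal \<open>\<alpha> < \<kappa>\<close>, as a set,
  is \<open>{..<\<alpha>}\<close>, and \<open>\<kappa>\<close> itself is \<open>UNIV\<close>. Thus \<open>ord_rel {..<\<alpha>}\<close> and \<open>kappa\<close> are the ordinals \<open>\<alpha>\<close>
  and \<open>\<kappa>\<close> as reflexive well-order relations, the format of the cardinal library.
\<close>

definition ord_rel :: "'k::wellorder set \<Rightarrow> 'k rel" where
  "ord_rel S = {(\<alpha>, \<beta>). \<alpha> \<in> S \<and> \<beta> \<in> S \<and> \<alpha> \<le> \<beta>}"

definition kappa :: "'k::wellorder rel" where
  "kappa = ord_rel UNIV"


definition limit_ord :: "'k::wellorder \<Rightarrow> bool" where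
  "limit_ord \<alpha> \<longleftrightarrow> {..<\<alpha>} \<noteq> {} \<and> (\<forall>\<beta><\<alpha>. \<exists>\<gamma><\<alpha>. \<beta> < \<gamma>)"

text \<open>
  \<^const>\<open>cofinal\<close> is strict: \<open>cofinal C (ord_rel {..<\<alpha>})\<close> says that for each \<open>\<beta> < \<alpha>\<close> there is
  \<open>\<gamma> \<in> C\<close> with \<open>\<beta> < \<gamma> < \<alpha>\<close>, that is, \<open>C \<inter> \<alpha>\<close> is unbounded in \<open>\<alpha>\<close> and \<open>\<alpha>\<close> is not a successor.
\<close>

definition limit_point :: "'k::wellorder set \<Rightarrow> 'k \<Rightarrow> bool" where
  "limit_point C \<beta> \<longleftrightarrow> {..<\<beta>} \<noteq> {} \<and> cofinal C (ord_rel {..<\<beta>})"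

definition club_in :: "'k::wellorder set \<Rightarrow> 'k set \<Rightarrow> bool" where
  "club_in S C \<longleftrightarrow>
     C \<subseteq> S \<and> (\<forall>\<beta>\<in>S. limit_point C \<beta> \<longrightarrow> \<beta> \<in> C) \<and> cofinal C (ord_rel S)"

definition stationary :: "'k::wellorder set \<Rightarrow> bool" where
  "stationary X \<longleftrightarrow> (\<forall>C. club_in UNIV C \<longrightarrow> X \<inter> C \<noteq> {})"

definition subset_NS :: "'k::wellorder set \<Rightarrow> 'k set \<Rightarrow> bool" where
  "subset_NS X Y \<longleftrightarrow> \<not> stationary (X - Y)"

text \<open>Only meaningful, and only used, at limit ordinals.\<close>

definition cofinality :: "'k::wellorder \<Rightarrow> 'k" where
  "cofinality \<alpha> = (LEAST \<beta>. \<exists>f. f ` {..<\<beta>} \<subseteq> {..<\<alpha>} \<and> cofinal (f ` {..<\<beta>}) (ord_rel {..<\<alpha>}))"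

text \<open>
  If \<open>\<kappa> = \<lambda>\<^sup>+\<close>, then \<open>\<lambda> < \<kappa>\<close> is the initial ordinal \<open>l\<close> of the next definition.
\<close>

definition kappa_succ_of :: "'k::wellorder \<Rightarrow> bool" where
  "kappa_succ_of l \<longleftrightarrow>
     card_order_on {..<l} (ord_rel {..<l}) \<and> (kappa :: 'k rel) =o cardSuc (ord_rel {..<l})"

definition square :: "'k::wellorder \<Rightarrow> bool" where
  "square l \<longleftrightarrow> (\<exists>C :: 'k \<Rightarrow> 'k set. \<forall>\<alpha>. limit_ord \<alpha> \<longrightarrow>
     club_in {..<\<alpha>} (C \<alpha>) \<and>
     (\<forall>\<beta><\<alpha>. limit_point (C \<alpha>) \<beta> \<longrightarrow> C \<beta> = {..<\<beta>} \<inter> C \<alpha>) \<and>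
     (cofinality \<alpha> < l \<longrightarrow> |C \<alpha>| <o ord_rel {..<l}))"


text \<open>
  An element \<open>p \<in> 2\<^sup>\<alpha>\<close> is given by any \<open>p \<in> 2\<^sup>\<kappa>\<close> extending it; only \<open>p\<close> below \<open>\<alpha>\<close> matters.
\<close>

definition basic_nbhd :: "'k::wellorder \<Rightarrow> ('k \<Rightarrow> bool) \<Rightarrow> ('k \<Rightarrow> bool) set" where
  "basic_nbhd \<alpha> p = {\<eta>. \<forall>\<beta><\<alpha>. \<eta> \<beta> = p \<beta>}"

definition cantor_top :: "('k::wellorder \<Rightarrow> bool) topology" where
  "cantor_top = topology_generated_by {basic_nbhd \<alpha> p | \<alpha> p. True}"

inductive_set borel_sets :: "'k rel \<Rightarrow> 'x topology \<Rightarrow> 'x set set"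
  for r :: "'k rel" and T :: "'x topology" where
  borel_open: "openin T U \<Longrightarrow> U \<in> borel_sets r T"
| borel_compl: "A \<in> borel_sets r T \<Longrightarrow> topspace T - A \<in> borel_sets r T"
| borel_Union: "(\<And>A. A \<in> \<A> \<Longrightarrow> A \<in> borel_sets r T) \<Longrightarrow> |\<A>| \<le>o r \<Longrightarrow>
    \<Union>\<A> \<in> borel_sets r T"
| borel_Inter: "(\<And>A. A \<in> \<A> \<Longrightarrow> A \<in> borel_sets r T) \<Longrightarrow> |\<A>| \<le>o r \<Longrightarrow> \<A> \<noteq> {} \<Longrightarrow>
    \<Inter>\<A> \<in> borel_sets r T"

definition borel_fun :: "(('k::wellorder \<Rightarrow> bool) \<Rightarrow> ('k \<Rightarrow> bool)) \<Rightarrow> bool" where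
  "borel_fun f \<longleftrightarrow>
     (\<forall>U. openin cantor_top U \<longrightarrow> f -` U \<in> borel_sets (kappa :: 'k rel) cantor_top)"

definition borel_reducible ::
    "('k::wellorder \<Rightarrow> bool) rel \<Rightarrow> ('k \<Rightarrow> bool) rel \<Rightarrow> bool" where
  "borel_reducible E E' \<longleftrightarrow>
     (\<exists>f. borel_fun f \<and> (\<forall>\<eta> \<xi>. (\<eta>, \<xi>) \<in> E \<longleftrightarrow> (f \<eta>, f \<xi>) \<in> E'))"

definition borel_equivs :: "('k::wellorder \<Rightarrow> bool) rel set" where
  "borel_equivs =
     {E. equiv UNIV E \<and> E \<in> borel_sets (kappa :: 'k rel) (prod_topology cantor_top cantor_top)}"

end

theory Submission
  imports Defs
begin

text \<open>
  For a set \<open>S\<close> of limit ordinals call \<open>\<eta>\<close> and \<open>\<xi>\<close> equivalent if they agree on a final segment of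
  \<open>\<kappa>\<close> and, below each \<open>\<alpha> \<in> S\<close>, agree on a final segment or disagree on a final segment. If \<open>S\<close> is
  stationary, the local conditions at \<open>S\<close> decide equivalence up to a flip of a final segment of \<open>\<kappa>\<close>,
  so the relation of \<open>S\<close> reduces to that of \<open>T\<close> if \<open>T\<close> is contained in \<open>S\<close> up to a nonstationary set.

  Suppose conversely that a Borel function reduces the relation of \<open>S\<close> to that of \<open>T\<close> and that
  \<open>T - S\<close> is stationary. It is continuous on a class of generic points. One builds two such points in
  steps along a club \<open>C \<alpha>\<close> of some \<open>\<alpha> \<in> T - S\<close>, where each step adds a place of agreement and a
  place of disagreement of the images. Then the images are not equivalent at \<open>\<alpha>\<close>. The two points are
  equivalent, provided that no limit of the construction falls into \<open>S\<close>. If all \<open>C \<gamma>\<close> with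
  \<open>\<gamma> \<in> S\<close> have the same order type, then by coherence at most one limit point of \<open>C \<alpha>\<close> is in \<open>S\<close>,
  and one starts above it; coherence also keeps the construction below \<open>\<alpha>\<close>. Hence the complement
  of \<open>X\<close> is split by this order type, and \<open>X\<close> is mapped to a product of the relations of the parts.
  For \<open>\<kappa> = \<omega>\<^sub>1\<close> clubs of type \<open>\<omega>\<close> do.
\<close>

text \<open>So a reduction that is continuous at generic points cannot treat equivalent points alike
  from some place on, and this supplies the disagreements of the images. If the target is a product,
  the factor in which they occur cannot be chosen. Hence every factor of the target must have
  stationarily many points outside \<open>S\<close>. This is one purpose of the stationary sets that
  are added to the pieces of the complement of X.

  The hypothesis on powers enters only as the count of bounded subsets of \<kappa> in
  \<open>bounded_preds\<close>. It leaves \<kappa> many modifications of a generic point, \<kappa>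
  many states of the construction, which can then be coded by ordinals and kept below
  \<open>\<alpha>\<close>, and \<kappa> many local classes to be tested by the bits of the
  reduction.\<close>

locale regular_wellorder =
  fixes kk :: "'k::wellorder itself"
  assumes bounded_if_small: "|B :: 'k set| <o |UNIV :: 'k set| \<Longrightarrow> \<exists>u. \<forall>x\<in>B. x < u"
    and initial_small: "|{..<\<alpha> :: 'k}| <o |UNIV :: 'k set|"
    and uncountable: "natLeq <o |UNIV :: 'k set|"
    and kappa_card: "(kappa :: 'k rel) =o |UNIV :: 'k set|"
    and bounded_preds: "|{p :: 'k \<Rightarrow> bool. \<exists>u. \<forall>x\<ge>u. \<not> p x}| \<le>o |UNIV :: 'k set|"
begin

lemma infinite_UNIV_k: "infinite (UNIV :: 'k set)"
  using uncountable ordLess_imp_ordLeq infinite_iff_natLeq_ordLeq by blast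

lemma bounded_image:
  fixes f :: "'a \<Rightarrow> 'k"
  assumes "|A| <o |UNIV :: 'k set|"
  shows "\<exists>u. \<forall>a\<in>A. f a < u"
proof -
  have "|f ` A| <o |UNIV :: 'k set|"
    using assms card_of_image ordLeq_ordLess_trans by blast
  from bounded_if_small[OF this] show ?thesis by blast
qed

lemma bounded_initial:
  fixes f :: "'k \<Rightarrow> 'k"
  shows "\<exists>u. \<forall>x<b. f x < u"
  using bounded_image[OF initial_small, of b f] by auto

lemma small_subset_initial:
  fixes A :: "'k set"
  shows "|A \<inter> {..<b}| <o |UNIV :: 'k set|"
  by (meson Int_lower2 card_of_mono1 initial_small ordLeq_ordLess_trans)

lemma no_max: "\<exists>y::'k. x < y"
proof -
  have "|{x}| <o |UNIV :: 'k set|"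
    by (meson finite.emptyI finite_insert finite_iff_ordLess_natLeq ordLess_transitive uncountable)
  from bounded_if_small[OF this] show ?thesis by auto
qed

lemma bounded_nat_range:
  fixes f :: "nat \<Rightarrow> 'k"
  shows "\<exists>u. \<forall>n. f n < u"
proof -
  have "|UNIV :: nat set| <o |UNIV :: 'k set|"
    using card_of_nat ordIso_ordLess_trans uncountable by blast
  from bounded_image[OF this, of f] show ?thesis by auto
qed

end

section \<open>Clubs and stationary sets\<close>

lemma Field_ord_rel [simp]: "Field (ord_rel S) = S"
  by (auto simp: ord_rel_def Field_def)

lemma club_in_UNIV_iff:
  "club_in UNIV C \<longleftrightarrow> (\<forall>\<beta>. limit_point C \<beta> \<longrightarrow> \<beta> \<in> C) \<and> (\<forall>\<alpha>. \<exists>\<beta>\<in>C. \<alpha> < \<beta>)"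
  unfolding club_in_def cofinal_def Field_ord_rel by (auto simp: ord_rel_def less_le)

lemma cofinal_initial_iff:
  "cofinal C (ord_rel {..<\<alpha>}) \<longleftrightarrow> (\<forall>\<beta><\<alpha>. \<exists>\<gamma>\<in>C. \<beta> < \<gamma> \<and> \<gamma> < \<alpha>)"
  unfolding cofinal_def Field_ord_rel by (auto simp: ord_rel_def less_le)

lemma limit_point_iff:
  "limit_point C \<beta> \<longleftrightarrow> (\<exists>\<alpha>. \<alpha> < \<beta>) \<and> (\<forall>\<alpha><\<beta>. \<exists>\<gamma>\<in>C. \<alpha> < \<gamma> \<and> \<gamma> < \<beta>)"
  unfolding limit_point_def cofinal_initial_iff by auto

lemma club_in_initial_iff:
  "club_in {..<\<alpha>} C \<longleftrightarrow> C \<subseteq> {..<\<alpha>} \<and> (\<forall>\<beta><\<alpha>. limit_point C \<beta> \<longrightarrow> \<beta> \<in> C) \<and>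
     (\<forall>\<beta><\<alpha>. \<exists>\<gamma>\<in>C. \<beta> < \<gamma>)"
  unfolding club_in_def cofinal_initial_iff by (auto; blast)

lemma limit_point_mono: "limit_point C \<beta> \<Longrightarrow> C \<inter> {..<\<beta>} \<subseteq> D \<Longrightarrow> limit_point D \<beta>"
  unfolding limit_point_iff by blast

lemma limit_point_imp_limit_ord: "limit_point C \<beta> \<Longrightarrow> limit_ord \<beta>"
  unfolding limit_point_iff limit_ord_def by auto

lemma stationary_mono: "stationary X \<Longrightarrow> X \<subseteq> Y \<Longrightarrow> stationary Y"
  unfolding stationary_def by blast

context regular_wellorder
begin

lemma stationary_UNIV: "stationary (UNIV :: 'k set)"
  unfolding stationary_def club_in_UNIV_iff by auto

text \<open>
  Every intersection of fewer than \<open>\<kappa>\<close> clubs and every diagonal intersection contain, up to a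
  bounded set, a club of this form, so this lemma replaces both closure properties.
\<close>

lemma closure_points_club:
  fixes H :: "'k \<Rightarrow> 'k \<Rightarrow> 'k"
  shows "club_in UNIV {\<alpha>. limit_ord \<alpha> \<and> (\<forall>x<\<alpha>. \<forall>y<\<alpha>. H x y < \<alpha>)}" (is "club_in UNIV ?K")
  unfolding club_in_UNIV_iff
proof (intro conjI allI impI)
  fix \<beta> assume \<beta>: "limit_point ?K \<beta>"
  have "H x y < \<beta>" if xy: "x < \<beta>" "y < \<beta>" for x y
  proof -
    have "max x y < \<beta>" using xy by simp
    then obtain \<gamma> where "\<gamma> \<in> ?K" "max x y < \<gamma>" "\<gamma> < \<beta>"
      using \<beta> unfolding limit_point_iff by blast
    then show ?thesis by (auto intro: less_trans)
  qed
  then show "\<beta> \<in> ?K" using limit_point_imp_limit_ord[OF \<beta>] by simp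
next
  fix a :: 'k
  have "\<exists>u. \<forall>x\<le>b. \<forall>y\<le>b. H x y < u \<and> b < u" for b
  proof -
    obtain b' where b': "b < b'" using no_max by blast
    have "\<forall>x. \<exists>u. \<forall>y<b'. H x y < u" using bounded_initial by blast
    then obtain v where v: "\<And>x y. y < b' \<Longrightarrow> H x y < v x" by metis
    obtain u where u: "\<And>x. x < b' \<Longrightarrow> v x < u" using bounded_initial by blast
    have "H x y < max u b'" if "x \<le> b" "y \<le> b" for x y
      using v[of y x] u[of x] that b' by (meson le_less_trans less_max_iff_disj less_trans)
    then show ?thesis using b' by (meson less_max_iff_disj)
  qed
  then obtain nx where nx: "\<And>b x y. x \<le> b \<Longrightarrow> y \<le> b \<Longrightarrow> H x y < nx b" "\<And>b. b < nx b"
    by (metis order_refl)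
  \<comment> \<open>The supremum of the \<omega> iterates of \<open>nx\<close> is a closure point;
    it exists below \<kappa> because \<kappa> is regular and uncountable.\<close>
  define s where "s n = (nx ^^ n) a" for n
  have s_Suc: "s (Suc n) = nx (s n)" for n by (simp add: s_def)
  have s_mono: "strict_mono s" by (rule strict_monoI_Suc) (simp add: s_Suc nx)
  obtain u where u: "\<And>n. s n < u" using bounded_nat_range by blast
  define \<beta> where "\<beta> = (LEAST u. \<forall>n. s n < u)"
  have \<beta>: "s n < \<beta>" for n unfolding \<beta>_def by (rule LeastI2[of _ u]) (use u in auto)
  have below: "\<exists>n. x \<le> s n" if "x < \<beta>" for x
    using not_less_Least[OF that[unfolded \<beta>_def]] by (auto simp: not_less)
  have "limit_ord \<beta>"
    unfolding limit_ord_def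
  proof (intro conjI allI impI)
    show "{..<\<beta>} \<noteq> {}" using \<beta> by auto
    fix x assume "x < \<beta>"
    then obtain n where "x \<le> s n" using below by blast
    then have "x < s (Suc n)" using nx(2)[of "s n"] s_Suc by simp
    then show "\<exists>\<gamma><\<beta>. x < \<gamma>" using \<beta> by blast
  qed
  moreover have "H x y < \<beta>" if xy: "x < \<beta>" "y < \<beta>" for x y
  proof -
    obtain m n where "x \<le> s m" "y \<le> s n" using below xy by blast
    moreover have "s m \<le> s (max m n)" "s n \<le> s (max m n)"
      using s_mono by (auto simp: strict_mono_less_eq)
    ultimately have "x \<le> s (max m n)" "y \<le> s (max m n)" by (meson order_trans)+
    then have "H x y < s (Suc (max m n))" unfolding s_Suc by (rule nx(1))
    then show ?thesis using \<beta> by (rule less_trans)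
  qed
  ultimately have "\<beta> \<in> ?K" by simp
  moreover have "a < \<beta>" using \<beta>[of 0] by (simp add: s_def)
  ultimately show "\<exists>\<beta>\<in>?K. a < \<beta>" by blast
qed

lemma stationary_closure_point:
  fixes H :: "'k \<Rightarrow> 'k \<Rightarrow> 'k"
  assumes "stationary X"
  obtains \<alpha> where "\<alpha> \<in> X" "limit_ord \<alpha>" "\<And>x y. x < \<alpha> \<Longrightarrow> y < \<alpha> \<Longrightarrow> H x y < \<alpha>"
  using assms closure_points_club[of H] unfolding stationary_def by blast

lemma closed_point_limit_point:
  assumes "limit_ord \<alpha>" "\<And>x. x < \<alpha> \<Longrightarrow> h x < \<alpha> \<and> x < h x \<and> h x \<in> C"
  shows "limit_point C \<alpha>"
  unfolding limit_point_iff using assms by (auto simp: limit_ord_def)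

text \<open>Serves two purposes: with clubs \<open>C\<close> and \<open>D\<close> it intersects them
  inside \<open>X\<close>; with sets that are merely unbounded it finds a point of \<open>X\<close>
  below which two properties both recur.\<close>

lemma stationary_limit_point:
  fixes C D :: "'k set"
  assumes "stationary X" "\<And>a. \<exists>b\<in>C. a < b" "\<And>a. \<exists>b\<in>D. a < b"
  obtains \<alpha> where "\<alpha> \<in> X" "limit_ord \<alpha>" "limit_point C \<alpha>" "limit_point D \<alpha>"
proof -
  obtain c d where c: "\<And>a. c a \<in> C \<and> a < c a" and d: "\<And>a. d a \<in> D \<and> a < d a"
    using assms(2,3) by metis
  obtain \<alpha> where \<alpha>: "\<alpha> \<in> X" "limit_ord \<alpha>" "\<And>x y. x < \<alpha> \<Longrightarrow> y < \<alpha> \<Longrightarrow> max (c x) (d x) < \<alpha>"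
    using stationary_closure_point[OF assms(1), of "\<lambda>x y. max (c x) (d x)"] by blast
  have "limit_point C \<alpha>" "limit_point D \<alpha>"
    by (rule closed_point_limit_point[OF \<alpha>(2), of c], use c \<alpha>(3) in auto)
       (rule closed_point_limit_point[OF \<alpha>(2), of d], use d \<alpha>(3) in auto)
  with \<alpha> that show ?thesis by blast
qed

lemma stationary_Int_club:
  fixes X :: "'k set"
  assumes "stationary X" "club_in UNIV C"
  shows "stationary (X \<inter> C)"
  unfolding stationary_def
proof (intro allI impI)
  fix D :: "'k set" assume D: "club_in UNIV D"
  from stationary_limit_point[OF assms(1), of C D] obtain \<alpha>
    where "\<alpha> \<in> X" "limit_point C \<alpha>" "limit_point D \<alpha>"
    using assms(2) D unfolding club_in_UNIV_iff by metis
  then show "X \<inter> C \<inter> D \<noteq> {}" using assms(2) D unfolding club_in_UNIV_iff by blast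
qed

lemma club_greaterThan: "club_in UNIV {\<beta>. (a :: 'k) < \<beta>}"
  unfolding club_in_UNIV_iff
proof (intro conjI allI impI)
  fix \<beta> assume "limit_point {\<beta>. a < \<beta>} \<beta>"
  then show "\<beta> \<in> {\<beta>. a < \<beta>}" unfolding limit_point_iff by (auto intro: less_trans)
next
  fix \<alpha> show "\<exists>\<beta>\<in>{\<beta>. a < \<beta>}. \<alpha> < \<beta>" using no_max[of "max \<alpha> a"] by auto
qed

lemma stationary_limits:
  fixes X :: "'k set"
  assumes "stationary X"
  shows "stationary (X \<inter> Collect limit_ord)"
  using stationary_Int_club[OF assms closure_points_club[of "\<lambda>x y. x"]]
  by (rule stationary_mono) auto

text \<open>Completeness of the nonstationary ideal: a point closed under functions that lead into
  each of the clubs \<open>C i\<close> belongs to all of them.\<close>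

lemma stationary_UN_initial:
  fixes X :: "'k \<Rightarrow> 'k set"
  assumes "stationary (\<Union>i<b. X i)"
  shows "\<exists>i<b. stationary (X i)"
proof (rule ccontr)
  assume "\<not> (\<exists>i<b. stationary (X i))"
  then have "\<forall>i. \<exists>C. i < b \<longrightarrow> club_in UNIV C \<and> X i \<inter> C = {}"
    unfolding stationary_def by blast
  then obtain C where C: "\<And>i. i < b \<Longrightarrow> club_in UNIV (C i)" "\<And>i. i < b \<Longrightarrow> X i \<inter> C i = {}"
    by metis
  have "\<forall>x i. \<exists>y. i < b \<longrightarrow> y \<in> C i \<and> x < y" using C(1) unfolding club_in_UNIV_iff by blast
  then obtain h where h: "\<And>x i. i < b \<Longrightarrow> h x i \<in> C i \<and> x < h x i" by metis
  \<comment> \<open>The term \<open>max b\<close> forces \<open>b < \<alpha>\<close>, so that every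
    index \<open>i < b\<close> may serve as second argument of the closure function.\<close>
  obtain \<alpha> where \<alpha>: "\<alpha> \<in> (\<Union>i<b. X i)" "limit_ord \<alpha>"
    "\<And>x y. x < \<alpha> \<Longrightarrow> y < \<alpha> \<Longrightarrow> max b (if y < b then h x y else b) < \<alpha>"
    using stationary_closure_point[OF assms, of "\<lambda>x y. max b (if y < b then h x y else b)"]
    by blast
  obtain i where i: "i < b" "\<alpha> \<in> X i" using \<alpha>(1) by blast
  obtain z where z: "z < \<alpha>" using \<alpha>(2) by (auto simp: limit_ord_def)
  have "b < \<alpha>" using \<alpha>(3)[OF z z] by simp
  then have "limit_point (C i) \<alpha>"
    using i(1) \<alpha>(3)[of _ i] h by (intro closed_point_limit_point[OF \<alpha>(2), of "\<lambda>x. h x i"]) auto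
  then have "\<alpha> \<in> C i" using C(1)[OF i(1)] unfolding club_in_UNIV_iff by blast
  with C(2) i show False by blast
qed

lemma stationary_Un:
  fixes X Y :: "'k set"
  assumes "stationary (X \<union> Y)"
  shows "stationary X \<or> stationary Y"
proof -
  obtain a b c :: 'k where "a < b" "b < c" using no_max by metis
  then have "X \<union> Y \<subseteq> (\<Union>i<c. if i = a then X else Y)" by force
  from stationary_UN_initial[OF stationary_mono[OF assms this]] show ?thesis
    by (metis (full_types))
qed

text \<open>Ulam matrix: \<open>\<kappa>\<close> many rows and fewer than \<open>\<kappa>\<close> columns.\<close>

lemma stationary_split:
  fixes X :: "'k set" and j :: "'k \<Rightarrow> 'k \<Rightarrow> 'k"
  assumes X: "stationary X"
    and j: "\<And>\<beta>. inj_on (j \<beta>) {..<\<beta>}" "\<And>\<beta> \<gamma>. \<gamma> < \<beta> \<Longrightarrow> j \<beta> \<gamma> < b"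
  obtains Z where "Z \<subseteq> X" "stationary Z" "stationary (X - Z)"
proof -
  define A where "A \<gamma> i = {\<beta> \<in> X. \<gamma> < \<beta> \<and> j \<beta> \<gamma> = i}" for \<gamma> i
  have "\<exists>i<b. stationary (A \<gamma> i)" for \<gamma>
  proof (rule stationary_UN_initial)
    from stationary_Int_club[OF X club_greaterThan[of \<gamma>]] show "stationary (\<Union>i<b. A \<gamma> i)"
      by (rule stationary_mono) (auto simp: A_def j(2))
  qed
  then obtain i where i: "\<And>\<gamma>. i \<gamma> < b" "\<And>\<gamma>. stationary (A \<gamma> (i \<gamma>))" by metis
  \<comment> \<open>Each of the \<kappa> many rows picks one of fewer than \<kappa> columns, so two
    rows share a column. Injectivity of \<open>j \<beta>\<close> makes their entries
    disjoint.\<close>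
  have "\<not> inj i"
  proof
    assume "inj i"
    then have "|UNIV :: 'k set| \<le>o |{..<b}|" using i(1) card_of_ordLeq by blast
    then show False using initial_small not_ordLess_ordLeq by blast
  qed
  then obtain \<gamma> \<gamma>' where ne: "\<gamma> \<noteq> \<gamma>'" "i \<gamma> = i \<gamma>'" by (auto simp: inj_def)
  have "A \<gamma> (i \<gamma>) \<inter> A \<gamma>' (i \<gamma>') = {}"
    using ne j(1) unfolding A_def inj_on_def by fastforce
  then have "A \<gamma>' (i \<gamma>') \<subseteq> X - A \<gamma> (i \<gamma>)" by (auto simp: A_def)
  then have "stationary (X - A \<gamma> (i \<gamma>))" by (rule stationary_mono[OF i(2)])
  with i(2) show ?thesis by (intro that[of "A \<gamma> (i \<gamma>)"]) (auto simp: A_def)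
qed

end

section \<open>Towers of partial functions\<close>

definition agree :: "'k::wellorder \<Rightarrow> ('k \<Rightarrow> 'a) \<Rightarrow> ('k \<Rightarrow> 'a) \<Rightarrow> bool" where
  "agree \<gamma> h h' \<longleftrightarrow> (\<forall>x<\<gamma>. h x = h' x)"

lemma agree_refl [simp]: "agree \<gamma> h h"
  by (simp add: agree_def)

lemma agree_sym: "agree \<gamma> h h' \<Longrightarrow> agree \<gamma> h' h"
  by (simp add: agree_def)

lemma agree_trans: "agree \<gamma> h h' \<Longrightarrow> agree \<gamma> h' h'' \<Longrightarrow> agree \<gamma> h h''"
  by (simp add: agree_def)

lemma agree_mono: "agree \<gamma> h h' \<Longrightarrow> \<gamma>' \<le> \<gamma> \<Longrightarrow> agree \<gamma>' h h'"
  by (auto simp: agree_def)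

lemma agreeD: "agree \<gamma> h h' \<Longrightarrow> x < \<gamma> \<Longrightarrow> h x = h' x"
  by (simp add: agree_def)

text \<open>A pair \<open>(h, \<gamma>)\<close> stands for the partial function \<open>h\<close> restricted to \<open>\<gamma>\<close>.\<close>

definition ext :: "('k::wellorder \<Rightarrow> 'a) \<times> 'k \<Rightarrow> ('k \<Rightarrow> 'a) \<times> 'k \<Rightarrow> bool" where
  "ext x y \<longleftrightarrow> snd x \<le> snd y \<and> agree (snd x) (fst x) (fst y)"

lemma ext_refl [simp]: "ext x x"
  by (simp add: ext_def)

lemma ext_trans: "ext x y \<Longrightarrow> ext y z \<Longrightarrow> ext x z"
  unfolding ext_def by (meson agree_mono agree_trans order_trans)

text \<open>Partial functions are represented by total ones, so a union needs values beyond all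
  lengths; taking them from \<open>i\<close> makes the limit depend on \<open>i\<close> and the set
  \<open>Y\<close> alone. Inserting \<open>i\<close> provides the length for empty \<open>Y\<close>.
  The length is meaningful only if the lengths in \<open>Y\<close> are bounded.\<close>

definition chain_lim ::
    "('k::wellorder \<Rightarrow> 'a) \<times> 'k \<Rightarrow> (('k \<Rightarrow> 'a) \<times> 'k) set \<Rightarrow> ('k \<Rightarrow> 'a) \<times> 'k" where
  "chain_lim i Y =
     (\<lambda>x. if \<exists>y\<in>Y. x < snd y then fst (SOME y. y \<in> Y \<and> x < snd y) x else fst i x,
      LEAST u. \<forall>y\<in>insert i Y. snd y \<le> u)"

lemma fst_chain_lim:
  assumes "\<And>y y'. y \<in> Y \<Longrightarrow> y' \<in> Y \<Longrightarrow> ext y y' \<or> ext y' y" and "y \<in> Y" "x < snd y"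
  shows "fst (chain_lim i Y) x = fst y x"
proof -
  have "(SOME y. y \<in> Y \<and> x < snd y) \<in> Y \<and> x < snd (SOME y. y \<in> Y \<and> x < snd y)" (is "?z \<in> Y \<and> _")
    by (rule someI[of _ y]) (use assms in simp)
  then have "fst ?z x = fst y x"
    using assms(1)[of ?z y] assms(2,3) unfolding ext_def agree_def by auto
  then show ?thesis unfolding chain_lim_def using assms(2,3) by auto
qed

lemma fst_chain_lim_above:
  assumes "\<And>y. y \<in> Y \<Longrightarrow> snd y \<le> x"
  shows "fst (chain_lim i Y) x = fst i x"
  using assms unfolding chain_lim_def by (auto simp: not_less[symmetric])

lemma snd_chain_lim_le: "(\<And>y. y \<in> insert i Y \<Longrightarrow> snd y \<le> u) \<Longrightarrow> snd (chain_lim i Y) \<le> u"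
  unfolding chain_lim_def snd_conv by (rule Least_le) blast

lemma snd_chain_lim_ge:
  assumes "\<And>y. y \<in> insert i Y \<Longrightarrow> snd y \<le> u" and "y \<in> insert i Y"
  shows "snd y \<le> snd (chain_lim i Y)"
proof -
  have "\<forall>y\<in>insert i Y. snd y \<le> (LEAST u. \<forall>y\<in>insert i Y. snd y \<le> u)"
    by (rule LeastI[of _ u]) (use assms(1) in blast)
  with assms(2) show ?thesis unfolding chain_lim_def snd_conv by blast
qed

lemma ext_chain_lim:
  assumes "\<And>y y'. y \<in> Y \<Longrightarrow> y' \<in> Y \<Longrightarrow> ext y y' \<or> ext y' y" and "\<And>y. y \<in> Y \<Longrightarrow> ext i y"
    and "\<And>y. y \<in> insert i Y \<Longrightarrow> snd y \<le> u" and y: "y \<in> insert i Y"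
  shows "ext y (chain_lim i Y)"
  unfolding ext_def agree_def
proof (intro conjI allI impI)
  show "snd y \<le> snd (chain_lim i Y)" by (rule snd_chain_lim_ge[OF assms(3) y])
  fix x assume x: "x < snd y"
  show "fst y x = fst (chain_lim i Y) x"
  proof (cases "y \<in> Y")
    case True
    then show ?thesis using fst_chain_lim[OF assms(1)] x by metis
  next
    case False
    then have yi: "y = i" using y by simp
    show ?thesis
    proof (cases "Y = {}")
      case True
      then show ?thesis using yi fst_chain_lim_above[of "{}" x i] by simp
    next
      case False
      then obtain z where z: "z \<in> Y" by blast
      then have "x < snd z" "fst i x = fst z x"
        using assms(2)[OF z] x yi unfolding ext_def agree_def by auto
      then show ?thesis using fst_chain_lim[OF assms(1) z, of x i] yi by simp
    qed
  qed
qed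

text \<open>If the chain has a last state, the limit must return this state literally and not only
  up to agreement, since states are going to be coded as pairs. The hypothesis \<open>norm\<close>
  gives equality beyond the length.\<close>

lemma chain_lim_max:
  assumes y: "y \<in> insert i Y" and max: "\<And>z. z \<in> insert i Y \<Longrightarrow> ext z y"
    and norm: "\<And>x. snd y \<le> x \<Longrightarrow> fst y x = fst i x"
  shows "chain_lim i Y = y"
proof (rule prod_eqI)
  have le: "\<And>z. z \<in> insert i Y \<Longrightarrow> snd z \<le> snd y" using max by (simp add: ext_def)
  show "snd (chain_lim i Y) = snd y"
    using snd_chain_lim_le[of i Y, OF le] snd_chain_lim_ge[OF le y] by (rule antisym)
  have comp: "fst z x = fst y x" if "z \<in> insert i Y" "x < snd z" for z x
    using max[OF that(1)] that(2) by (simp add: ext_def agree_def)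
  show "fst (chain_lim i Y) = fst y"
  proof
    fix x
    show "fst (chain_lim i Y) x = fst y x"
    proof (cases "\<exists>z\<in>Y. x < snd z")
      case True
      then have "\<exists>z. z \<in> Y \<and> x < snd z" by blast
      from someI_ex[OF this] show ?thesis using True comp by (simp add: chain_lim_def)
    next
      case False
      then have "fst (chain_lim i Y) x = fst i x" by (simp add: chain_lim_def)
      moreover have "fst i x = fst y x"
      proof (cases "x < snd y")
        case True
        then have "y = i" using False y by auto
        then show ?thesis by simp
      qed (use norm in auto)
      ultimately show ?thesis by simp
    qed
  qed
qed

text \<open>One clause covers successors and limits. The recursion runs along the elements of
  \<open>A\<close> itself, so the state at \<open>\<beta>\<close> depends only on the part of
  \<open>A\<close> below \<open>\<beta>\<close>; this makes coherence of clubs applicable to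
  it.\<close>

function tower :: "('k::wellorder \<Rightarrow> ('k \<Rightarrow> 'a) \<times> 'k \<Rightarrow> ('k \<Rightarrow> 'a) \<times> 'k) \<Rightarrow> ('k \<Rightarrow> 'a) \<times> 'k \<Rightarrow>
    'k set \<Rightarrow> 'k \<Rightarrow> ('k \<Rightarrow> 'a) \<times> 'k" where
  "tower act i A \<beta> = act \<beta> (chain_lim i (tower act i A ` (A \<inter> {..<\<beta>})))"
  by auto
termination
  by (relation "inv_image {(x, y). x < y} (\<lambda>(_, _, _, \<beta>). \<beta>)") (auto simp: wf)

declare tower.simps [simp del]

lemma tower_cong:
  "A \<inter> {..<\<beta>} = A' \<inter> {..<\<beta>} \<Longrightarrow> tower act i A \<beta> = tower act i A' \<beta>"
proof (induction \<beta> rule: less_induct)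
  case (less \<beta>)
  have "tower act i A ` (A \<inter> {..<\<beta>}) = tower act i A' ` (A' \<inter> {..<\<beta>})"
  proof (rule image_cong[OF less.prems])
    fix x assume "x \<in> A' \<inter> {..<\<beta>}"
    then show "tower act i A x = tower act i A' x"
      using less.prems by (intro less.IH) (auto intro: less_trans)
  qed
  then show ?case by (simp add: tower.simps[of _ _ _ \<beta>])
qed

context regular_wellorder
begin

lemma Un_le_k: "|A| \<le>o |UNIV :: 'k set| \<Longrightarrow> |B| \<le>o |UNIV :: 'k set| \<Longrightarrow> |A \<union> B| \<le>o |UNIV :: 'k set|"
  by (rule card_of_Un_ordLeq_infinite_Field) (simp_all add: infinite_UNIV_k Field_card_of card_of_card_order_on)

lemma Times_le_k: "|A| \<le>o |UNIV :: 'k set| \<Longrightarrow> |B| \<le>o |UNIV :: 'k set| \<Longrightarrow> |A \<times> B| \<le>o |UNIV :: 'k set|"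
  by (rule card_of_Times_ordLeq_infinite_Field) (simp_all add: infinite_UNIV_k Field_card_of card_of_card_order_on)

lemma image_le_k: "|A| \<le>o |UNIV :: 'k set| \<Longrightarrow> |f ` A| \<le>o |UNIV :: 'k set|"
  using card_of_image ordLeq_transitive by blast

lemma singleton_le_k: "|{a}| \<le>o |UNIV :: 'k set|"
  by (simp add: card_of_singl_ordLeq)

lemma tower_bounded:
  fixes f :: "'k \<Rightarrow> ('k \<Rightarrow> 'a) \<times> 'k"
  shows "\<exists>u. \<forall>y\<in>insert i (f ` (A \<inter> {..<\<beta>})). snd y \<le> u"
proof -
  obtain u where u: "\<And>x. x < \<beta> \<Longrightarrow> snd (f x) < u" using bounded_initial by blast
  have "\<forall>y\<in>insert i (f ` (A \<inter> {..<\<beta>})). snd y \<le> max (snd i) u"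
    using u by (auto intro: less_imp_le le_max_iff_disj[THEN iffD2])
  then show ?thesis by blast
qed

text \<open>Both claims need a common induction: the limit extends the earlier states only if these
  already form a chain.\<close>

lemma tower_mono:
  fixes i :: "('k \<Rightarrow> 'a) \<times> 'k"
  assumes act: "\<And>\<beta> x. ext x (act \<beta> x)"
  shows "ext i (tower act i A \<beta>) \<and> (\<forall>\<mu>\<in>A \<inter> {..<\<beta>}. ext (tower act i A \<mu>) (tower act i A \<beta>))"
proof (induction \<beta> rule: less_induct)
  case (less \<beta>)
  let ?Y = "tower act i A ` (A \<inter> {..<\<beta>})"
  obtain u where u: "\<And>y. y \<in> insert i ?Y \<Longrightarrow> snd y \<le> u" using tower_bounded by metis
  have "ext y (chain_lim i ?Y)" if "y \<in> insert i ?Y" for y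
  proof (rule ext_chain_lim[OF _ _ u that])
    fix y y' assume "y \<in> ?Y" "y' \<in> ?Y"
    then obtain \<mu> \<nu> where "y = tower act i A \<mu>" "y' = tower act i A \<nu>" "\<mu> \<in> A" "\<nu> \<in> A" "\<mu> < \<beta>" "\<nu> < \<beta>"
      by blast
    then show "ext y y' \<or> ext y' y" using less.IH[of \<mu>] less.IH[of \<nu>]
      by (cases \<mu> \<nu> rule: linorder_cases) auto
  qed (use less.IH in auto)
  then have "ext y (tower act i A \<beta>)" if "y \<in> insert i ?Y" for y
    using act that ext_trans by (metis tower.simps)
  then show ?case by blast
qed

lemma tower_ext:
  fixes i :: "('k \<Rightarrow> 'a) \<times> 'k"
  assumes "\<And>\<beta> x. ext x (act \<beta> x)" and "\<mu> \<in> A" "\<mu> \<le> \<nu>"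
  shows "ext (tower act i A \<mu>) (tower act i A \<nu>)"
  using tower_mono[OF assms(1), where i = i and A = A and \<beta> = \<nu>] assms(2,3) by (cases "\<mu> = \<nu>") auto

lemma tower_chain:
  fixes i :: "('k \<Rightarrow> 'a) \<times> 'k"
  assumes "\<And>\<beta> x. ext x (act \<beta> x)" and "y \<in> tower act i A ` A" "y' \<in> tower act i A ` A"
  shows "ext y y' \<or> ext y' y"
proof -
  obtain \<mu> \<nu> where "\<mu> \<in> A" "\<nu> \<in> A" "y = tower act i A \<mu>" "y' = tower act i A \<nu>"
    using assms(2,3) by blast
  then show ?thesis using tower_ext[OF assms(1)] by (cases "\<mu> \<le> \<nu>") auto
qed

end

section \<open>Baire category in the generalised Cantor space\<close>

lemma agree_iff_basic_nbhd: "\<zeta> \<in> basic_nbhd \<gamma> \<eta> \<longleftrightarrow> agree \<gamma> \<zeta> \<eta>"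
  by (simp add: basic_nbhd_def agree_def)

lemma basic_nbhd_mono: "\<alpha> \<le> \<beta> \<Longrightarrow> basic_nbhd \<beta> \<eta> \<subseteq> basic_nbhd \<alpha> \<eta>"
  by (auto simp: basic_nbhd_def)

lemma basic_nbhd_eq: "\<eta> \<in> basic_nbhd \<alpha> p \<Longrightarrow> basic_nbhd \<alpha> \<eta> = basic_nbhd \<alpha> p"
  by (auto simp: basic_nbhd_def)

lemma openin_cantor_iff:
  "openin cantor_top U \<longleftrightarrow> (\<forall>\<eta>\<in>U. \<exists>\<alpha>. basic_nbhd \<alpha> \<eta> \<subseteq> U)"
proof
  assume "openin cantor_top U"
  then have "generate_topology_on {basic_nbhd \<alpha> p | \<alpha> p. True} U"
    unfolding cantor_top_def by (rule openin_topology_generated_by)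
  then show "\<forall>\<eta>\<in>U. \<exists>\<alpha>. basic_nbhd \<alpha> \<eta> \<subseteq> U"
  proof induction
    case (Int a b)
    show ?case
    proof
      fix \<eta> assume "\<eta> \<in> a \<inter> b"
      then obtain \<alpha> \<beta> where "basic_nbhd \<alpha> \<eta> \<subseteq> a" "basic_nbhd \<beta> \<eta> \<subseteq> b" using Int by blast
      moreover have "basic_nbhd (max \<alpha> \<beta>) \<eta> \<subseteq> basic_nbhd \<alpha> \<eta> \<inter> basic_nbhd \<beta> \<eta>"
        by (simp add: basic_nbhd_mono)
      ultimately have "basic_nbhd (max \<alpha> \<beta>) \<eta> \<subseteq> a \<inter> b" by blast
      then show "\<exists>\<alpha>. basic_nbhd \<alpha> \<eta> \<subseteq> a \<inter> b" by blast
    qed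
  next
    case (Basis s)
    then show ?case using basic_nbhd_eq by blast
  qed blast+
next
  assume "\<forall>\<eta>\<in>U. \<exists>\<alpha>. basic_nbhd \<alpha> \<eta> \<subseteq> U"
  then obtain a where a: "\<And>\<eta>. \<eta> \<in> U \<Longrightarrow> basic_nbhd (a \<eta>) \<eta> \<subseteq> U" by metis
  have "U = (\<Union>\<eta>\<in>U. basic_nbhd (a \<eta>) \<eta>)" using a by (auto simp: basic_nbhd_def)
  moreover have "openin cantor_top (\<Union>\<eta>\<in>U. basic_nbhd (a \<eta>) \<eta>)"
    unfolding cantor_top_def by (intro openin_Union) (auto intro: topology_generated_by_Basis)
  ultimately show "openin cantor_top U" by simp
qed

lemma topspace_cantor [simp]: "topspace cantor_top = UNIV"
proof -
  have "openin cantor_top UNIV" by (simp add: openin_cantor_iff)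
  then show ?thesis using openin_subset by blast
qed

definition open_dense :: "('k::wellorder \<Rightarrow> bool) set \<Rightarrow> bool" where
  "open_dense W \<longleftrightarrow> openin cantor_top W \<and> (\<forall>\<alpha> \<eta>. W \<inter> basic_nbhd \<alpha> \<eta> \<noteq> {})"

text \<open>
  \<open>\<phi>\<close> is continuous, even with each coordinate of the value depending on an initial segment
  whose length does not depend on the argument.
\<close>

definition local_fun :: "(('k::wellorder \<Rightarrow> bool) \<Rightarrow> ('k \<Rightarrow> bool)) \<Rightarrow> bool" where
  "local_fun \<phi> \<longleftrightarrow> (\<forall>\<beta>. \<exists>\<gamma>. \<forall>\<eta> \<xi>. agree \<gamma> \<eta> \<xi> \<longrightarrow> \<phi> \<eta> \<beta> = \<phi> \<xi> \<beta>)"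

context regular_wellorder
begin

lemma open_coordinate: "openin cantor_top {\<eta>. P (\<eta> \<beta>)}" for \<beta> :: 'k
proof -
  obtain x where "\<beta> < x" using no_max by blast
  then have "basic_nbhd x \<eta> \<subseteq> {\<eta>. P (\<eta> \<beta>)}" if "P (\<eta> \<beta>)" for \<eta>
    using that by (auto simp: basic_nbhd_def)
  then show ?thesis unfolding openin_cantor_iff by blast
qed

lemma local_fun_vimage:
  fixes \<phi> :: "('k \<Rightarrow> bool) \<Rightarrow> ('k \<Rightarrow> bool)"
  assumes "local_fun \<phi>" "openin cantor_top U"
  shows "openin cantor_top (\<phi> -` U)"
  unfolding openin_cantor_iff
proof
  fix \<eta> assume "\<eta> \<in> \<phi> -` U"
  then obtain \<alpha> where \<alpha>: "basic_nbhd \<alpha> (\<phi> \<eta>) \<subseteq> U" using assms(2) unfolding openin_cantor_iff by blast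
  obtain \<gamma> where \<gamma>: "\<And>\<beta> \<eta> \<xi>. agree (\<gamma> \<beta>) \<eta> \<xi> \<Longrightarrow> \<phi> \<eta> \<beta> = \<phi> \<xi> \<beta>"
    using assms(1) unfolding local_fun_def by metis
  obtain u where u: "\<And>\<beta>. \<beta> < \<alpha> \<Longrightarrow> \<gamma> \<beta> < u" using bounded_initial by blast
  have "basic_nbhd u \<eta> \<subseteq> \<phi> -` U"
  proof
    fix \<zeta> assume "\<zeta> \<in> basic_nbhd u \<eta>"
    then have "agree u \<zeta> \<eta>" by (simp add: agree_iff_basic_nbhd)
    then have "\<phi> \<zeta> \<beta> = \<phi> \<eta> \<beta>" if "\<beta> < \<alpha>" for \<beta>
      by (rule \<gamma>[OF agree_mono[OF _ less_imp_le[OF u[OF that]]]])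
    then have "\<phi> \<zeta> \<in> basic_nbhd \<alpha> (\<phi> \<eta>)" unfolding basic_nbhd_def by blast
    then show "\<zeta> \<in> \<phi> -` U" using \<alpha> by blast
  qed
  then show "\<exists>\<alpha>. basic_nbhd \<alpha> \<eta> \<subseteq> \<phi> -` U" by blast
qed

lemma local_fun_borel:
  fixes \<phi> :: "('k \<Rightarrow> bool) \<Rightarrow> ('k \<Rightarrow> bool)"
  shows "local_fun \<phi> \<Longrightarrow> borel_fun \<phi>"
  unfolding borel_fun_def by (blast intro: borel_open local_fun_vimage)

lemma borel_vimage:
  assumes "\<And>U. openin T U \<Longrightarrow> openin T' (g -` U)" "topspace T = UNIV" "topspace T' = UNIV"
    and "A \<in> borel_sets r T"
  shows "g -` A \<in> borel_sets r T'"
  using assms(4)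
proof induction
  case (borel_compl A)
  have "g -` (topspace T - A) = topspace T' - g -` A" using assms(2,3) by auto
  then show ?case using borel_sets.borel_compl[OF borel_compl.IH] by simp
next
  case (borel_Union \<A>)
  have "g -` \<Union>\<A> = \<Union>((-`) g ` \<A>)" by blast
  moreover have "\<Union>((-`) g ` \<A>) \<in> borel_sets r T'"
    by (rule borel_sets.borel_Union)
       (use borel_Union card_of_image ordLeq_transitive in blast)+
  ultimately show ?case by simp
next
  case (borel_Inter \<A>)
  have "g -` \<Inter>\<A> = \<Inter>((-`) g ` \<A>)" by blast
  moreover have "\<Inter>((-`) g ` \<A>) \<in> borel_sets r T'"
    by (rule borel_sets.borel_Inter)
       (use borel_Inter card_of_image ordLeq_transitive in blast)+
  ultimately show ?case by simp
qed (use assms(1) borel_open in blast)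

lemma borel_comp_local:
  fixes h \<phi> :: "('k \<Rightarrow> bool) \<Rightarrow> ('k \<Rightarrow> bool)"
  assumes "borel_fun h" "local_fun \<phi>"
  shows "borel_fun (h \<circ> \<phi>)"
  unfolding borel_fun_def
proof (intro allI impI)
  fix U :: "('k \<Rightarrow> bool) set" assume "openin cantor_top U"
  then have "h -` U \<in> borel_sets (kappa :: 'k rel) cantor_top"
    using assms(1) by (simp add: borel_fun_def)
  then have "\<phi> -` (h -` U) \<in> borel_sets (kappa :: 'k rel) cantor_top"
    by (intro borel_vimage[OF local_fun_vimage[OF assms(2)]]) simp_all
  then show "(h \<circ> \<phi>) -` U \<in> borel_sets (kappa :: 'k rel) cantor_top"
    by (simp only: vimage_comp)
qed

text \<open>A tower of basic neighbourhoods of length \<kappa> enters the \<open>\<beta>\<close>-th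
  dense open set at stage \<open>\<beta>\<close>. Regularity keeps the lengths below \<kappa> at the
  limits in between.\<close>

lemma baire:
  fixes \<O> :: "('k \<Rightarrow> bool) set set"
  assumes "|\<O>| \<le>o |UNIV :: 'k set|" and od: "\<And>W. W \<in> \<O> \<Longrightarrow> open_dense W"
  shows "\<Inter>\<O> \<noteq> {}"
proof (cases "\<O> = {}")
  case False
  then obtain D :: "'k \<Rightarrow> _" where D: "D ` UNIV = \<O>" using assms(1) card_of_ordLeq2 by metis
  have "\<exists>y. ext x y \<and> basic_nbhd (snd y) (fst y) \<subseteq> D \<beta>" for \<beta> x
  proof -
    have "open_dense (D \<beta>)" using od D by blast
    then obtain \<eta> \<gamma> where \<eta>: "\<eta> \<in> D \<beta>" "\<eta> \<in> basic_nbhd (snd x) (fst x)" "basic_nbhd \<gamma> \<eta> \<subseteq> D \<beta>"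
      unfolding open_dense_def openin_cantor_iff by blast
    have "ext x (\<eta>, max (snd x) \<gamma>)" using \<eta>(2) by (simp add: ext_def agree_def basic_nbhd_def)
    moreover have "basic_nbhd (max (snd x) \<gamma>) \<eta> \<subseteq> D \<beta>"
      using \<eta>(3) basic_nbhd_mono[of \<gamma> "max (snd x) \<gamma>" \<eta>] by simp
    ultimately show ?thesis by (intro exI[of _ "(\<eta>, max (snd x) \<gamma>)"]) simp
  qed
  then have "\<forall>\<beta>. \<exists>f. \<forall>x. ext x (f x) \<and> basic_nbhd (snd (f x)) (fst (f x)) \<subseteq> D \<beta>"
    by (intro allI choice)
  from choice[OF this] obtain act where act: "\<And>\<beta> x. ext x (act \<beta> x)"
    "\<And>\<beta> x. basic_nbhd (snd (act \<beta> x)) (fst (act \<beta> x)) \<subseteq> D \<beta>" by blast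
  define t where "t = tower act (\<lambda>_. False, LEAST x. True) UNIV"
  \<comment> \<open>Only the function part of this limit is used; the lengths of all stages together
    need not be bounded.\<close>
  define \<eta> where "\<eta> = fst (chain_lim (\<lambda>_. False, LEAST x. True) (t ` UNIV))"
  have "\<eta> \<in> D \<beta>" for \<beta>
  proof -
    have "agree (snd (t \<beta>)) \<eta> (fst (t \<beta>))"
      unfolding agree_def \<eta>_def t_def
      by (intro allI impI fst_chain_lim tower_chain[OF act(1)]) auto
    then have "\<eta> \<in> basic_nbhd (snd (t \<beta>)) (fst (t \<beta>))" by (simp add: agree_iff_basic_nbhd)
    also have "\<dots> \<subseteq> D \<beta>" unfolding t_def tower.simps[of _ _ _ \<beta>] by (rule act(2))
    finally show ?thesis .
  qed
  then have "\<eta> \<in> \<Inter>\<O>" using D by blast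
  then show ?thesis by blast
qed simp

text \<open>The Baire property of Borel sets, with the comeagre set given as an intersection of
  \<kappa> many dense open sets.\<close>

lemma borel_almost_open:
  fixes B :: "('k \<Rightarrow> bool) set"
  assumes "B \<in> borel_sets (kappa :: 'k rel) cantor_top"
  shows "\<exists>\<D> U. |\<D>| \<le>o |UNIV :: 'k set| \<and> (\<forall>W\<in>\<D>. open_dense W) \<and> openin cantor_top U \<and>
    (\<forall>\<eta>\<in>\<Inter>\<D>. \<eta> \<in> B \<longleftrightarrow> \<eta> \<in> U)"
proof -
  define good where "good B \<longleftrightarrow> (\<exists>\<D> U. |\<D>| \<le>o |UNIV :: 'k set| \<and> (\<forall>W\<in>\<D>. open_dense W) \<and>
    openin cantor_top U \<and> (\<forall>\<eta>\<in>\<Inter>\<D>. \<eta> \<in> B \<longleftrightarrow> \<eta> \<in> U))" for B :: "('k \<Rightarrow> bool) set"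
  have compl: "good (- A)" if A: "good A" for A
  proof -
    obtain \<D> U where \<D>: "|\<D>| \<le>o |UNIV :: 'k set|" "\<forall>W\<in>\<D>. open_dense W" "openin cantor_top U"
      "\<forall>\<eta>\<in>\<Inter>\<D>. \<eta> \<in> A \<longleftrightarrow> \<eta> \<in> U" using A unfolding good_def by blast
    \<comment> \<open>The exterior of \<open>U\<close>. Once the dense open set
      \<open>U \<union> V\<close> joins the family, being outside \<open>U\<close> amounts to being
      in \<open>V\<close>.\<close>
    define V where "V = {\<eta>. \<exists>\<gamma>. basic_nbhd \<gamma> \<eta> \<inter> U = {}}"
    have V: "openin cantor_top V"
      unfolding openin_cantor_iff
    proof
      fix \<eta> assume "\<eta> \<in> V"
      then obtain \<gamma> where \<gamma>: "basic_nbhd \<gamma> \<eta> \<inter> U = {}" unfolding V_def by blast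
      have "basic_nbhd \<gamma> \<eta> \<subseteq> V" using \<gamma> basic_nbhd_eq unfolding V_def by blast
      then show "\<exists>\<gamma>. basic_nbhd \<gamma> \<eta> \<subseteq> V" by blast
    qed
    have disj: "U \<inter> V = {}" unfolding V_def by (auto simp: basic_nbhd_def)
    have "open_dense (U \<union> V)"
      unfolding open_dense_def
    proof (intro conjI allI)
      show "openin cantor_top (U \<union> V)" using \<D>(3) V by (rule openin_Un)
      fix \<alpha> \<eta>
      show "(U \<union> V) \<inter> basic_nbhd \<alpha> \<eta> \<noteq> {}"
      proof (cases "U \<inter> basic_nbhd \<alpha> \<eta> = {}")
        case True
        then have "\<eta> \<in> V" "\<eta> \<in> basic_nbhd \<alpha> \<eta>" unfolding V_def by (auto simp: basic_nbhd_def)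
        then show ?thesis by blast
      qed blast
    qed
    moreover have "|insert (U \<union> V) \<D>| \<le>o |UNIV :: 'k set|"
      using Un_le_k[OF singleton_le_k \<D>(1)] by simp
    moreover have "\<forall>\<eta>\<in>\<Inter>(insert (U \<union> V) \<D>). \<eta> \<in> - A \<longleftrightarrow> \<eta> \<in> V"
      using \<D>(4) disj by auto
    ultimately show ?thesis unfolding good_def using \<D>(2) V by blast
  qed
  have union: "good (\<Union>\<A>)" if "\<And>A. A \<in> \<A> \<Longrightarrow> good A" "|\<A>| \<le>o (kappa :: 'k rel)" for \<A>
  proof -
    have "|\<A>| \<le>o |UNIV :: 'k set|" using that(2) kappa_card ordLeq_ordIso_trans by blast
    have "\<forall>A\<in>\<A>. good A" using that(1) by blast
    from bchoice[OF this[unfolded good_def]]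
    obtain \<D> where "\<forall>A\<in>\<A>. \<exists>U. |\<D> A| \<le>o |UNIV :: 'k set| \<and> (\<forall>W\<in>\<D> A. open_dense W) \<and>
        openin cantor_top U \<and> (\<forall>\<eta>\<in>\<Inter>(\<D> A). \<eta> \<in> A \<longleftrightarrow> \<eta> \<in> U)"
      by blast
    from bchoice[OF this] obtain U where D: "\<forall>A\<in>\<A>. |\<D> A| \<le>o |UNIV :: 'k set| \<and>
        (\<forall>W\<in>\<D> A. open_dense W) \<and> openin cantor_top (U A) \<and>
        (\<forall>\<eta>\<in>\<Inter>(\<D> A). \<eta> \<in> A \<longleftrightarrow> \<eta> \<in> U A)"
      by blast
    have "|\<Union>(\<D> ` \<A>)| \<le>o |UNIV :: 'k set|"
      using card_of_UNION_ordLeq_infinite[OF infinite_UNIV_k \<open>|\<A>| \<le>o |UNIV :: 'k set|\<close>] D by blast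
    moreover have "openin cantor_top (\<Union>(U ` \<A>))" using D by blast
    moreover have "\<forall>\<eta>\<in>\<Inter>(\<Union>(\<D> ` \<A>)). \<eta> \<in> \<Union>\<A> \<longleftrightarrow> \<eta> \<in> \<Union>(U ` \<A>)"
    proof
      fix \<eta> assume \<eta>: "\<eta> \<in> \<Inter>(\<Union>(\<D> ` \<A>))"
      have "\<eta> \<in> A \<longleftrightarrow> \<eta> \<in> U A" if "A \<in> \<A>" for A
      proof -
        have "\<eta> \<in> \<Inter>(\<D> A)" using \<eta> that by blast
        then show ?thesis using D that by blast
      qed
      then show "\<eta> \<in> \<Union>\<A> \<longleftrightarrow> \<eta> \<in> \<Union>(U ` \<A>)" by blast
    qed
    moreover have "\<forall>W\<in>\<Union>(\<D> ` \<A>). open_dense W" using D by blast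
    ultimately show ?thesis unfolding good_def by blast
  qed
  from assms have "good B"
  proof induction
    case (borel_open U)
    have "|{} :: ('k \<Rightarrow> bool) set set| \<le>o |UNIV :: 'k set|" by (rule card_of_empty)
    then show ?case unfolding good_def using borel_open by blast
  next
    case (borel_compl A)
    then show ?case using compl by (simp add: Compl_eq_Diff_UNIV)
  next
    case (borel_Union \<A>)
    then show ?case using union by blast
  next
    case (borel_Inter \<A>)
    have "good (\<Union>(uminus ` \<A>))"
      by (rule union) (use borel_Inter compl card_of_image ordLeq_transitive in blast)+
    then have "good (- \<Union>(uminus ` \<A>))" by (rule compl)
    then show ?case by simp
  qed
  then show ?thesis unfolding good_def .
qed

end

section \<open>The equivalence relation of a set of limit ordinals\<close>

definition settled :: "'k::wellorder \<Rightarrow> ('k \<Rightarrow> bool) \<Rightarrow> ('k \<Rightarrow> bool) \<Rightarrow> bool" where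
  "settled \<alpha> \<eta> \<xi> \<longleftrightarrow> (\<exists>c. \<exists>\<beta><\<alpha>. \<forall>\<gamma>. \<beta> \<le> \<gamma> \<and> \<gamma> < \<alpha> \<longrightarrow> (\<eta> \<gamma> = \<xi> \<gamma>) = c)"

definition eqv :: "'k::wellorder set \<Rightarrow> ('k \<Rightarrow> bool) \<Rightarrow> ('k \<Rightarrow> bool) \<Rightarrow> bool" where
  "eqv S \<eta> \<xi> \<longleftrightarrow> (\<exists>\<beta>. \<forall>\<gamma>\<ge>\<beta>. \<eta> \<gamma> = \<xi> \<gamma>) \<and> (\<forall>\<alpha>\<in>S. settled \<alpha> \<eta> \<xi>)"

lemma settledI:
  assumes "\<beta> < \<alpha>" "\<And>\<gamma>. \<beta> \<le> \<gamma> \<Longrightarrow> \<gamma> < \<alpha> \<Longrightarrow> (\<eta> \<gamma> = \<xi> \<gamma>) = c"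
  shows "settled \<alpha> \<eta> \<xi>"
  using assms unfolding settled_def by blast

lemma settled_refl: "limit_ord \<alpha> \<Longrightarrow> settled \<alpha> \<eta> \<eta>"
  unfolding limit_ord_def settled_def by blast

lemma settled_sym: "settled \<alpha> \<eta> \<xi> \<Longrightarrow> settled \<alpha> \<xi> \<eta>"
  unfolding settled_def by (simp add: eq_commute)

lemma settled_trans:
  assumes "settled \<alpha> \<eta> \<xi>" "settled \<alpha> \<xi> \<zeta>"
  shows "settled \<alpha> \<eta> \<zeta>"
proof -
  obtain \<beta> c where 1: "\<beta> < \<alpha>" "\<And>\<gamma>. \<beta> \<le> \<gamma> \<Longrightarrow> \<gamma> < \<alpha> \<Longrightarrow> (\<eta> \<gamma> = \<xi> \<gamma>) = c"
    using assms(1) unfolding settled_def by blast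
  obtain \<beta>' c' where 2: "\<beta>' < \<alpha>" "\<And>\<gamma>. \<beta>' \<le> \<gamma> \<Longrightarrow> \<gamma> < \<alpha> \<Longrightarrow> (\<xi> \<gamma> = \<zeta> \<gamma>) = c'"
    using assms(2) unfolding settled_def by blast
  \<comment> \<open>Two flips cancel, hence the constant \<open>c = c'\<close>.\<close>
  show ?thesis
  proof (rule settledI[of "max \<beta> \<beta>'" _ _ _ "c = c'"])
    fix \<gamma> assume "max \<beta> \<beta>' \<le> \<gamma>" "\<gamma> < \<alpha>"
    then show "(\<eta> \<gamma> = \<zeta> \<gamma>) = (c = c')" using 1(2)[of \<gamma>] 2(2)[of \<gamma>] by auto
  qed (use 1 2 in simp)
qed

lemma settled_agree:
  assumes "agree \<alpha> \<eta> \<eta>'" "agree \<alpha> \<xi> \<xi>'" "settled \<alpha> \<eta> \<xi>"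
  shows "settled \<alpha> \<eta>' \<xi>'"
  using assms unfolding settled_def agree_def by simp

lemma eqv_settled: "eqv S \<eta> \<xi> \<Longrightarrow> \<alpha> \<in> S \<Longrightarrow> settled \<alpha> \<eta> \<xi>"
  by (simp add: eqv_def)

lemma eqv_refl: "S \<subseteq> Collect limit_ord \<Longrightarrow> eqv S \<eta> \<eta>"
  unfolding eqv_def by (auto intro: settled_refl)

lemma eqv_sym: "eqv S \<eta> \<xi> \<Longrightarrow> eqv S \<xi> \<eta>"
  unfolding eqv_def by (auto intro: settled_sym)

lemma eqv_trans:
  assumes "eqv S \<eta> \<xi>" "eqv S \<xi> \<zeta>"
  shows "eqv S \<eta> \<zeta>"
proof -
  obtain \<beta> \<beta>' where "\<And>\<gamma>. \<beta> \<le> \<gamma> \<Longrightarrow> \<eta> \<gamma> = \<xi> \<gamma>" "\<And>\<gamma>. \<beta>' \<le> \<gamma> \<Longrightarrow> \<xi> \<gamma> = \<zeta> \<gamma>"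
    using assms unfolding eqv_def by blast
  then have "\<forall>\<gamma>\<ge>max \<beta> \<beta>'. \<eta> \<gamma> = \<zeta> \<gamma>" by simp
  then show ?thesis using assms settled_trans unfolding eqv_def by blast
qed

text \<open>Points of \<open>S\<close> up to \<open>\<gamma>\<close> inherit their condition, and a
  common tail from \<open>\<gamma>\<close> on settles all later ones. Hence an equivalent pair may
  be cut anywhere and given any common tail.\<close>

lemma eqv_modify:
  assumes "eqv S \<eta> \<xi>" "agree \<gamma> \<eta> \<eta>'" "agree \<gamma> \<xi> \<xi>'" "\<And>x. \<gamma> \<le> x \<Longrightarrow> \<eta>' x = \<xi>' x"
  shows "eqv S \<eta>' \<xi>'"
  unfolding eqv_def
proof (intro conjI ballI)
  show "\<exists>\<beta>. \<forall>\<gamma>\<ge>\<beta>. \<eta>' \<gamma> = \<xi>' \<gamma>" using assms(4) by blast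
  fix \<alpha> assume \<alpha>: "\<alpha> \<in> S"
  show "settled \<alpha> \<eta>' \<xi>'"
  proof (cases "\<alpha> \<le> \<gamma>")
    case True
    then show ?thesis
      using settled_agree[OF agree_mono[OF assms(2)] agree_mono[OF assms(3)]] assms(1) \<alpha>
      unfolding eqv_def by blast
  next
    case False
    then show ?thesis using assms(4) by (intro settledI[of \<gamma> _ _ _ True]) auto
  qed
qed

definition glue :: "'k::wellorder \<Rightarrow> ('k \<Rightarrow> 'a) \<Rightarrow> ('k \<Rightarrow> 'a) \<Rightarrow> 'k \<Rightarrow> 'a" where
  "glue \<gamma> \<eta> \<xi> = (\<lambda>x. if x < \<gamma> then \<eta> x else \<xi> x)"

lemma agree_glue [simp]: "agree \<gamma> (glue \<gamma> \<eta> \<xi>) \<eta>" "agree \<gamma> \<eta> (glue \<gamma> \<eta> \<xi>)"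
  by (auto simp: agree_def glue_def)

lemma glue_above: "\<gamma> \<le> x \<Longrightarrow> glue \<gamma> \<eta> \<xi> x = \<xi> x"
  by (auto simp: glue_def)

lemma glue_below: "x < \<gamma> \<Longrightarrow> glue \<gamma> \<eta> \<xi> x = \<eta> x"
  by (auto simp: glue_def)

text \<open>Flipped tails are included because the argument for sensitivity compares a generic point
  with the flip of its tail, and the reduction must be continuous at both.\<close>

definition near :: "('k::wellorder \<Rightarrow> bool) \<Rightarrow> ('k \<Rightarrow> bool) \<Rightarrow> bool" where
  "near g \<eta> \<longleftrightarrow> (\<exists>c \<beta>. \<forall>\<gamma>\<ge>\<beta>. (\<eta> \<gamma> = g \<gamma>) = c)"

lemma near_tail: "near g \<eta> \<Longrightarrow> (\<And>x. \<gamma> \<le> x \<Longrightarrow> \<xi> x = \<eta> x) \<Longrightarrow> near g \<xi>"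
proof -
  assume "near g \<eta>" and tail: "\<And>x. \<gamma> \<le> x \<Longrightarrow> \<xi> x = \<eta> x"
  then obtain c \<beta> where "\<And>x. \<beta> \<le> x \<Longrightarrow> (\<eta> x = g x) = c" unfolding near_def by blast
  then have "\<forall>x\<ge>max \<beta> \<gamma>. (\<xi> x = g x) = c" using tail by simp
  then show "near g \<xi>" unfolding near_def by blast
qed

lemma near_refl: "near g g"
  unfolding near_def by blast

lemma near_flip: "near g \<eta> \<Longrightarrow> (\<And>x. \<gamma> \<le> x \<Longrightarrow> \<xi> x \<noteq> \<eta> x) \<Longrightarrow> near g \<xi>"
proof -
  assume "near g \<eta>" and tail: "\<And>x. \<gamma> \<le> x \<Longrightarrow> \<xi> x \<noteq> \<eta> x"
  then obtain c \<beta> where c: "\<And>x. \<beta> \<le> x \<Longrightarrow> (\<eta> x = g x) = c" unfolding near_def by blast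
  have "\<forall>x\<ge>max \<beta> \<gamma>. (\<xi> x = g x) = (\<not> c)" using tail c by (metis max.bounded_iff)
  then show "near g \<xi>" unfolding near_def by blast
qed

context regular_wellorder
begin

text \<open>
  All shifts of the relevant dense open sets by the \<open>\<kappa>\<close> many eventually constant functions are met,
  so that \<open>g\<close> is generic together with its modifications.
\<close>

lemma generic_point:
  fixes h :: "('k \<Rightarrow> bool) \<Rightarrow> ('k \<Rightarrow> bool)"
  assumes "borel_fun h"
  obtains g where "\<And>\<eta> \<delta>. near g \<eta> \<Longrightarrow> \<exists>\<gamma>. \<forall>\<zeta>. near g \<zeta> \<longrightarrow> agree \<gamma> \<zeta> \<eta> \<longrightarrow> agree \<delta> (h \<zeta>) (h \<eta>)"
proof -
  have "\<exists>\<D>. |\<D>| \<le>o |UNIV :: 'k set| \<and> (\<forall>W\<in>\<D>. open_dense W) \<and>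
      (\<exists>U. openin cantor_top U \<and> (\<forall>\<eta>\<in>\<Inter>\<D>. h \<eta> \<beta> = b \<longleftrightarrow> \<eta> \<in> U))" for \<beta> b
  proof -
    have "openin cantor_top {\<eta>. \<eta> \<beta> = b}" by (rule open_coordinate)
    then have "h -` {\<eta>. \<eta> \<beta> = b} \<in> borel_sets (kappa :: 'k rel) cantor_top"
      using assms unfolding borel_fun_def by blast
    from borel_almost_open[OF this] show ?thesis by simp
  qed
  then have "\<forall>\<beta>. \<exists>f. \<forall>b. |f b| \<le>o |UNIV :: 'k set| \<and> (\<forall>W\<in>f b. open_dense W) \<and>
      (\<exists>U. openin cantor_top U \<and> (\<forall>\<eta>\<in>\<Inter>(f b). h \<eta> \<beta> = b \<longleftrightarrow> \<eta> \<in> U))"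
    by (intro allI choice)
  from choice[OF this] obtain \<D> where \<D>: "\<And>\<beta> b. |\<D> \<beta> b| \<le>o |UNIV :: 'k set|"
      "\<And>\<beta> b W. W \<in> \<D> \<beta> b \<Longrightarrow> open_dense W"
      "\<And>\<beta> b. \<exists>U. openin cantor_top U \<and> (\<forall>\<eta>\<in>\<Inter>(\<D> \<beta> b). h \<eta> \<beta> = b \<longleftrightarrow> \<eta> \<in> U)"
    by blast
  define DD where "DD = (\<Union>\<beta>\<in>UNIV. \<D> \<beta> True \<union> \<D> \<beta> False)"
  have "|DD| \<le>o |UNIV :: 'k set|"
    unfolding DD_def
    by (rule card_of_UNION_ordLeq_infinite[OF infinite_UNIV_k]) (auto intro: Un_le_k \<D>(1) card_of_mono1)
  define P where "P = {p :: 'k \<Rightarrow> bool. \<exists>u. \<forall>x\<ge>u. \<not> p x}"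
  \<comment> \<open>The complements of bounded sets are the shifts that lead to flipped
    tails.\<close>
  define AA where "AA = P \<union> (\<lambda>p x. \<not> p x) ` P"
  have "|AA| \<le>o |UNIV :: 'k set|"
    unfolding AA_def P_def by (intro Un_le_k image_le_k bounded_preds)
  \<comment> \<open>Addition modulo 2, an involution that preserves dense open sets under
    preimages.\<close>
  define shift where "shift a \<eta> = (\<lambda>x. \<eta> x \<noteq> a x)" for a \<eta> :: "'k \<Rightarrow> bool"
  have shift2: "shift a (shift a \<eta>) = \<eta>" for a \<eta> by (auto simp: shift_def)
  have "open_dense (shift a -` W)" if W: "open_dense W" for a W
    unfolding open_dense_def
  proof (intro conjI allI)
    have "local_fun (shift a)"
      unfolding local_fun_def
    proof
      fix \<beta> :: 'k
      obtain \<gamma> where "\<beta> < \<gamma>" using no_max by blast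
      then show "\<exists>\<gamma>. \<forall>\<eta> \<xi>. agree \<gamma> \<eta> \<xi> \<longrightarrow> shift a \<eta> \<beta> = shift a \<xi> \<beta>"
        unfolding shift_def agree_def by metis
    qed
    then show "openin cantor_top (shift a -` W)"
      using that local_fun_vimage unfolding open_dense_def by blast
    fix \<alpha> \<eta>
    obtain \<zeta> where \<zeta>: "\<zeta> \<in> W" "\<zeta> \<in> basic_nbhd \<alpha> (shift a \<eta>)"
      using W unfolding open_dense_def by blast
    then have "shift a \<zeta> \<in> shift a -` W \<inter> basic_nbhd \<alpha> \<eta>"
      by (auto simp: shift2 basic_nbhd_def) (auto simp: shift_def)
    then show "shift a -` W \<inter> basic_nbhd \<alpha> \<eta> \<noteq> {}" by blast
  qed
  then have "open_dense X" if "X \<in> (\<lambda>(a, W). shift a -` W) ` (AA \<times> DD)" for X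
    using that \<D>(2) by (auto simp: DD_def)
  then have "\<Inter>((\<lambda>(a, W). shift a -` W) ` (AA \<times> DD)) \<noteq> {}"
    by (intro baire image_le_k Times_le_k)
       (use \<open>|AA| \<le>o |UNIV :: 'k set|\<close> \<open>|DD| \<le>o |UNIV :: 'k set|\<close> in auto)
  then obtain g where g: "\<And>a W. a \<in> AA \<Longrightarrow> W \<in> DD \<Longrightarrow> shift a g \<in> W" by fastforce
  have near_in: "\<zeta> \<in> W" if nr: "near g \<zeta>" and W: "W \<in> DD" for \<zeta> W
  proof -
    define a where "a = (\<lambda>x. \<zeta> x \<noteq> g x)"
    obtain c \<beta> where c: "\<And>x. \<beta> \<le> x \<Longrightarrow> (\<zeta> x = g x) = c" using nr unfolding near_def by blast
    have "a \<in> AA"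
    proof (cases c)
      case True
      then show ?thesis using c unfolding AA_def P_def a_def by auto
    next
      case False
      then have "(\<lambda>x. \<zeta> x = g x) \<in> P" using c unfolding P_def by auto
      then show ?thesis unfolding AA_def a_def by (intro UnI2 image_eqI) auto
    qed
    moreover have "shift a g = \<zeta>" by (auto simp: shift_def a_def)
    ultimately show ?thesis using g[OF _ W] by metis
  qed
  show thesis
  proof (rule that)
    fix \<eta> \<delta> assume \<eta>: "near g \<eta>"
    have "\<exists>\<gamma>. \<forall>\<zeta>. near g \<zeta> \<longrightarrow> agree \<gamma> \<zeta> \<eta> \<longrightarrow> h \<zeta> \<beta> = h \<eta> \<beta>" for \<beta>
    proof -
      \<comment> \<open>Points near \<open>g\<close> lie in all the dense open sets, so for them an
        open set \<open>U\<close> decides the value of \<open>h\<close> at coordinate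
        \<open>\<beta>\<close>.\<close>
      have sub: "\<zeta> \<in> \<Inter>(\<D> \<beta> (h \<eta> \<beta>))" if "near g \<zeta>" for \<zeta>
        using near_in[OF that] unfolding DD_def by (cases "h \<eta> \<beta>") auto
      obtain U where U: "openin cantor_top U" "\<And>\<zeta>. near g \<zeta> \<Longrightarrow> h \<zeta> \<beta> = h \<eta> \<beta> \<longleftrightarrow> \<zeta> \<in> U"
        using \<D>(3)[of \<beta> "h \<eta> \<beta>"] sub by metis
      have "\<eta> \<in> U" using U(2) \<eta> by blast
      then obtain \<gamma> where "basic_nbhd \<gamma> \<eta> \<subseteq> U" using U(1) unfolding openin_cantor_iff by blast
      then show ?thesis using U(2) unfolding agree_iff_basic_nbhd[symmetric] by blast
    qed
    then obtain \<gamma> where \<gamma>: "\<And>\<beta> \<zeta>. near g \<zeta> \<Longrightarrow> agree (\<gamma> \<beta>) \<zeta> \<eta> \<Longrightarrow> h \<zeta> \<beta> = h \<eta> \<beta>" by metis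
    obtain u where u: "\<And>\<beta>. \<beta> < \<delta> \<Longrightarrow> \<gamma> \<beta> < u" using bounded_initial by blast
    have "agree \<delta> (h \<zeta>) (h \<eta>)" if "near g \<zeta>" "agree u \<zeta> \<eta>" for \<zeta>
      unfolding agree_def using \<gamma>[OF that(1)] agree_mono[OF that(2) less_imp_le[OF u]] by blast
    then show "\<exists>\<gamma>. \<forall>\<zeta>. near g \<zeta> \<longrightarrow> agree \<gamma> \<zeta> \<eta> \<longrightarrow> agree \<delta> (h \<zeta>) (h \<eta>)" by blast
  qed
qed

end

section \<open>Non-reducibility\<close>

text \<open>The value of the reduction is kept as a family of channels \<open>f c\<close>, one for
  each factor of the target. Of its being Borel only continuity on the class of \<open>g\<close> is
  retained.\<close>

locale generic_reduction = regular_wellorder kk for kk :: "'k::wellorder itself" +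
  fixes S :: "'k set" and I :: "'c set" and T :: "'c \<Rightarrow> 'k set"
    and f :: "'c \<Rightarrow> ('k \<Rightarrow> bool) \<Rightarrow> ('k \<Rightarrow> bool)" and g :: "'k \<Rightarrow> bool"
  assumes S_limit: "S \<subseteq> Collect limit_ord"
    and I_small: "|I| <o |UNIV :: 'k set|"
    and reduces: "eqv S \<eta> \<xi> \<longleftrightarrow> (\<forall>c\<in>I. eqv (T c) (f c \<eta>) (f c \<xi>))"
    and continuous: "c \<in> I \<Longrightarrow> near g \<eta> \<Longrightarrow>
      \<exists>\<gamma>. \<forall>\<zeta>. near g \<zeta> \<longrightarrow> agree \<gamma> \<zeta> \<eta> \<longrightarrow> agree \<delta> (f c \<zeta>) (f c \<eta>)"
begin

text \<open>
  Otherwise densely many conditions force each channel to be invariant from some point on. Below a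
  condition that does so for all channels, flipping a whole final segment of \<open>\<eta>\<close> is a limit of
  \<open>eqv S\<close>-equivalent flips, so it does not change the class of \<open>\<eta>\<close> either, a contradiction.
\<close>

lemma sensitive_channel:
  obtains c \<gamma>\<^sub>0 p where "c \<in> I" "near g p"
    "\<And>\<gamma> q \<beta>. \<gamma>\<^sub>0 \<le> \<gamma> \<Longrightarrow> agree \<gamma>\<^sub>0 q p \<Longrightarrow> \<exists>\<eta> \<xi> \<beta>'. near g \<eta> \<and> near g \<xi> \<and> agree \<gamma> \<eta> q \<and>
       agree \<gamma> \<xi> q \<and> eqv S \<eta> \<xi> \<and> \<beta> \<le> \<beta>' \<and> f c \<eta> \<beta>' \<noteq> f c \<xi> \<beta>'"
proof (rule ccontr)
  note choose = that
  assume no: "\<not> thesis"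
  define bad where "bad c \<gamma> q \<longleftrightarrow> (\<exists>\<beta>. \<forall>\<eta> \<xi> \<beta>'. near g \<eta> \<and> near g \<xi> \<and> agree \<gamma> \<eta> q \<and>
       agree \<gamma> \<xi> q \<and> eqv S \<eta> \<xi> \<and> \<beta> \<le> \<beta>' \<longrightarrow> f c \<eta> \<beta>' = f c \<xi> \<beta>')" for c \<gamma> q
  have ex_bad: "\<exists>\<gamma> q. \<gamma>\<^sub>0 \<le> \<gamma> \<and> agree \<gamma>\<^sub>0 q p \<and> bad c \<gamma> q" if "c \<in> I" for c \<gamma>\<^sub>0 p
  proof -
    have "near g (glue \<gamma>\<^sub>0 p g)" by (rule near_tail[OF near_refl]) (rule glue_above)
    then have "\<exists>\<gamma> q. \<gamma>\<^sub>0 \<le> \<gamma> \<and> agree \<gamma>\<^sub>0 q (glue \<gamma>\<^sub>0 p g) \<and> bad c \<gamma> q"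
      using choose[OF that, of "glue \<gamma>\<^sub>0 p g" \<gamma>\<^sub>0] no unfolding bad_def by blast
    then show ?thesis using agree_trans[OF _ agree_glue(1)] by blast
  qed
  define W where "W c = {\<eta>. \<exists>\<gamma>. bad c \<gamma> \<eta>}" for c
  have "open_dense (W c)" if c: "c \<in> I" for c
    unfolding open_dense_def openin_cantor_iff
  proof (intro conjI ballI allI)
    fix \<eta> assume "\<eta> \<in> W c"
    then obtain \<gamma> where \<gamma>: "bad c \<gamma> \<eta>" unfolding W_def by blast
    have "bad c \<gamma> \<zeta>" if "agree \<gamma> \<zeta> \<eta>" for \<zeta>
      using \<gamma> that agree_trans unfolding bad_def by blast
    then have "basic_nbhd \<gamma> \<eta> \<subseteq> W c"
      unfolding W_def by (auto simp: agree_iff_basic_nbhd intro: exI[of _ \<gamma>])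
    then show "\<exists>\<gamma>. basic_nbhd \<gamma> \<eta> \<subseteq> W c" by blast
  next
    fix \<alpha> \<eta>
    obtain \<gamma> q where "agree \<alpha> q \<eta>" "bad c \<gamma> q" using ex_bad[OF c] by blast
    then have "q \<in> W c \<inter> basic_nbhd \<alpha> \<eta>" unfolding W_def by (auto simp: agree_iff_basic_nbhd)
    then show "W c \<inter> basic_nbhd \<alpha> \<eta> \<noteq> {}" by blast
  qed
  then have "\<Inter>(W ` I) \<noteq> {}"
    by (intro baire image_le_k ordLess_imp_ordLeq[OF I_small]) auto
  then obtain r where "\<forall>c\<in>I. \<exists>\<gamma>. bad c \<gamma> r" unfolding W_def by blast
  then obtain \<gamma> where \<gamma>: "\<And>c. c \<in> I \<Longrightarrow> bad c (\<gamma> c) r" by metis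
  \<comment> \<open>There are fewer than \<kappa> channels, so one length \<open>u\<close> serves
    all of them.\<close>
  obtain u where u: "\<And>c. c \<in> I \<Longrightarrow> \<gamma> c < u" using bounded_image[OF I_small] by blast
  define \<eta> where "\<eta> = glue u r g"
  define \<xi> where "\<xi> = glue u r (\<lambda>x. \<not> g x)"
  have \<eta>: "near g \<eta>" "agree u \<eta> r"
    unfolding \<eta>_def by (rule near_tail[OF near_refl], erule glue_above) simp
  have \<xi>: "near g \<xi>"
    unfolding \<xi>_def by (rule near_flip[OF near_refl, of u]) (simp add: glue_above)
  have flip: "\<xi> x \<noteq> \<eta> x" if "u \<le> x" for x
    using that by (simp add: \<eta>_def \<xi>_def glue_above)
  have below: "agree u \<xi> \<eta>" by (simp add: \<eta>_def \<xi>_def agree_def glue_below)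
  have approx: "\<exists>\<zeta>. near g \<zeta> \<and> agree u \<zeta> r \<and> eqv S \<eta> \<zeta> \<and> agree \<delta> (f c \<zeta>) (f c \<xi>)"
    if c: "c \<in> I" for c \<delta>
  proof -
    obtain \<gamma> where \<gamma>: "\<And>\<zeta>. near g \<zeta> \<Longrightarrow> agree \<gamma> \<zeta> \<xi> \<Longrightarrow> agree \<delta> (f c \<zeta>) (f c \<xi>)"
      using continuous[OF c \<xi>] by blast
    define \<epsilon> where "\<epsilon> = max \<gamma> u"
    define \<zeta> where "\<zeta> = glue \<epsilon> \<xi> \<eta>"
    have ag: "agree \<epsilon> \<zeta> \<xi>" by (simp add: \<zeta>_def)
    have nr: "near g \<zeta>"
      unfolding \<zeta>_def by (rule near_tail[OF \<eta>(1)]) (rule glue_above)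
    have "agree u \<zeta> \<xi>" using ag by (rule agree_mono) (simp add: \<epsilon>_def)
    then have ag_u: "agree u \<zeta> \<eta>" using below by (rule agree_trans)
    have "eqv S \<eta> \<zeta>"
      unfolding eqv_def
    proof (intro conjI ballI)
      show "\<exists>\<beta>. \<forall>\<gamma>\<ge>\<beta>. \<eta> \<gamma> = \<zeta> \<gamma>" by (intro exI[of _ \<epsilon>]) (simp add: \<zeta>_def glue_above)
      fix \<alpha> assume "\<alpha> \<in> S"
      then have \<alpha>: "limit_ord \<alpha>" using S_limit by blast
      \<comment> \<open>As \<open>\<zeta>\<close> flips \<open>\<eta>\<close> exactly between
        \<open>u\<close> and \<open>\<epsilon>\<close>, a point \<open>\<alpha>\<close> sees no
        change, finally a constant flip, or finally equality.\<close>
      consider "\<alpha> \<le> u" | "u < \<alpha>" "\<alpha> \<le> \<epsilon>" | "\<epsilon> < \<alpha>" by fastforce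
      then show "settled \<alpha> \<eta> \<zeta>"
      proof cases
        case 1
        have "agree \<alpha> \<eta> \<zeta>" using agree_mono[OF agree_sym[OF ag_u] 1] .
        then show ?thesis by (rule settled_agree[OF agree_refl _ settled_refl[OF \<alpha>]])
      next
        case 2
        show ?thesis
        proof (rule settledI[of u _ _ _ False])
          fix x assume "u \<le> x" "x < \<alpha>"
          then show "(\<eta> x = \<zeta> x) = False"
            using flip[of x] 2 by (simp add: \<zeta>_def glue_below)
        qed (rule 2)
      next
        case 3
        then show ?thesis
          by (rule settledI[of \<epsilon> _ _ _ True]) (simp add: \<zeta>_def glue_above)
      qed
    qed
    moreover have "agree u \<zeta> r" using ag_u \<eta>(2) by (rule agree_trans)
    moreover have "agree \<delta> (f c \<zeta>) (f c \<xi>)"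
      using \<gamma>[OF nr agree_mono[OF ag]] by (simp add: \<epsilon>_def)
    ultimately show ?thesis using nr by blast
  qed
  \<comment> \<open>The approximations may vary with the place: equality at \<open>x\<close> passes
    through a \<open>\<zeta>\<close> whose image is right beyond \<open>x\<close>, the condition at
    \<open>\<tau>\<close> through one whose image is right below \<open>\<tau>\<close>. The bound
    \<open>\<beta>\<close> comes from badness and is the same for all \<open>x\<close>.\<close>
  have "eqv (T c) (f c \<eta>) (f c \<xi>)" if c: "c \<in> I" for c
    unfolding eqv_def
  proof (intro conjI ballI)
    obtain \<beta> where \<beta>: "\<And>\<eta> \<xi> \<beta>'. near g \<eta> \<Longrightarrow> near g \<xi> \<Longrightarrow> agree (\<gamma> c) \<eta> r \<Longrightarrow> agree (\<gamma> c) \<xi> r \<Longrightarrow>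
       eqv S \<eta> \<xi> \<Longrightarrow> \<beta> \<le> \<beta>' \<Longrightarrow> f c \<eta> \<beta>' = f c \<xi> \<beta>'"
      using \<gamma>[OF c] unfolding bad_def by blast
    have "f c \<eta> x = f c \<xi> x" if x: "\<beta> \<le> x" for x
    proof -
      obtain \<delta> where "x < \<delta>" using no_max by blast
      obtain \<zeta> where \<zeta>: "near g \<zeta>" "agree u \<zeta> r" "eqv S \<eta> \<zeta>" "agree \<delta> (f c \<zeta>) (f c \<xi>)"
        using approx[OF c] by blast
      have le: "\<gamma> c \<le> u" using u[OF c] by simp
      have "f c \<eta> x = f c \<zeta> x"
        by (rule \<beta>[OF \<eta>(1) \<zeta>(1) agree_mono[OF \<eta>(2) le] agree_mono[OF \<zeta>(2) le] \<zeta>(3) x])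
      also have "\<dots> = f c \<xi> x" by (rule agreeD[OF \<zeta>(4) \<open>x < \<delta>\<close>])
      finally show ?thesis .
    qed
    then show "\<exists>\<beta>. \<forall>x\<ge>\<beta>. f c \<eta> x = f c \<xi> x" by blast
    fix \<tau> assume \<tau>: "\<tau> \<in> T c"
    obtain \<zeta> where \<zeta>: "eqv S \<eta> \<zeta>" "agree \<tau> (f c \<zeta>) (f c \<xi>)" using approx[OF c] by blast
    then have "settled \<tau> (f c \<eta>) (f c \<zeta>)" using eqv_settled[OF _ \<tau>] reduces c by blast
    then show "settled \<tau> (f c \<eta>) (f c \<xi>)" using settled_agree \<zeta>(2) agree_refl by blast
  qed
  then have "eqv S \<eta> \<xi>" using reduces by blast
  then obtain \<beta> where "\<forall>x\<ge>\<beta>. \<eta> x = \<xi> x" unfolding eqv_def by blast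
  then show False using flip[of "max \<beta> u"] by simp
qed

end

locale sensitive_reduction = generic_reduction kk S I T f g
  for kk :: "'k::wellorder itself" and S and I :: "'c set" and T f g +
  fixes c :: 'c and \<gamma>\<^sub>0 :: 'k and p :: "'k \<Rightarrow> bool"
  assumes c: "c \<in> I" and near_p: "near g p"
    and sensitive: "\<gamma>\<^sub>0 \<le> \<gamma> \<Longrightarrow> agree \<gamma>\<^sub>0 q p \<Longrightarrow> \<exists>\<eta> \<xi> \<beta>'. near g \<eta> \<and> near g \<xi> \<and> agree \<gamma> \<eta> q \<and>
       agree \<gamma> \<xi> q \<and> eqv S \<eta> \<xi> \<and> \<beta> \<le> \<beta>' \<and> f c \<eta> \<beta>' \<noteq> f c \<xi> \<beta>'"
begin

text \<open>A state holds a pair of points in one function. The fixed tail \<open>p\<close> keeps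
  both near \<open>g\<close> and leaves only \<kappa> many states.\<close>

definition valid :: "('k \<Rightarrow> bool \<times> bool) \<times> 'k \<Rightarrow> bool" where
  "valid x \<longleftrightarrow> \<gamma>\<^sub>0 \<le> snd x \<and> (\<forall>y\<ge>snd x. fst x y = (p y, p y)) \<and>
     agree \<gamma>\<^sub>0 (fst \<circ> fst x) p \<and> eqv S (fst \<circ> fst x) (snd \<circ> fst x)"

text \<open>Quantifying over all near points that extend \<open>y\<close> makes the two places
  permanent: no later stage of the construction can undo them.\<close>

definition progress :: "('k \<Rightarrow> bool \<times> bool) \<times> 'k \<Rightarrow> ('k \<Rightarrow> bool \<times> bool) \<times> 'k \<Rightarrow> bool" where
  "progress x y \<longleftrightarrow> (\<exists>\<beta>\<^sub>1 \<beta>\<^sub>2. snd x \<le> \<beta>\<^sub>1 \<and> \<beta>\<^sub>1 < snd y \<and> snd x \<le> \<beta>\<^sub>2 \<and> \<beta>\<^sub>2 < snd y \<and>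
     (\<forall>\<eta> \<xi>. near g \<eta> \<longrightarrow> near g \<xi> \<longrightarrow> agree (snd y) \<eta> (fst \<circ> fst y) \<longrightarrow>
        agree (snd y) \<xi> (snd \<circ> fst y) \<longrightarrow> f c \<eta> \<beta>\<^sub>1 = f c \<xi> \<beta>\<^sub>1 \<and> f c \<eta> \<beta>\<^sub>2 \<noteq> f c \<xi> \<beta>\<^sub>2))"

lemma valid_near:
  assumes "valid x"
  shows "near g (fst \<circ> fst x)" "near g (snd \<circ> fst x)"
  using assms by (auto simp: valid_def intro!: near_tail[OF near_p, of "snd x"])

text \<open>Sensitivity gives equivalent \<open>\<eta>\<^sub>1\<close> and
  \<open>\<eta>\<^sub>2\<close> over the first component whose images differ at
  \<open>\<beta>\<^sub>2\<close>. The second component, continued by the tail of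
  \<open>\<eta>\<^sub>1\<close>, is equivalent to both, and its image differs at
  \<open>\<beta>\<^sub>2\<close> from one of theirs; that one becomes the new first component. A
  place of agreement exists because images of equivalent points have a common tail.\<close>

lemma next_state:
  assumes x: "valid x"
  shows "\<exists>y. valid y \<and> ext x y \<and> snd x < snd y \<and> progress x y"
proof -
  define \<gamma> where "\<gamma> = snd x"
  define \<eta> where "\<eta> = fst \<circ> fst x"
  define \<xi> where "\<xi> = snd \<circ> fst x"
  have x': "\<gamma>\<^sub>0 \<le> \<gamma>" "agree \<gamma>\<^sub>0 \<eta> p" "eqv S \<eta> \<xi>"
    using x unfolding valid_def \<gamma>_def \<eta>_def \<xi>_def by auto
  obtain \<eta>\<^sub>1 \<eta>\<^sub>2 \<beta>\<^sub>2 where \<eta>12: "near g \<eta>\<^sub>1" "near g \<eta>\<^sub>2" "agree \<gamma> \<eta>\<^sub>1 \<eta>" "agree \<gamma> \<eta>\<^sub>2 \<eta>" "eqv S \<eta>\<^sub>1 \<eta>\<^sub>2"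
    "\<gamma> \<le> \<beta>\<^sub>2" "f c \<eta>\<^sub>1 \<beta>\<^sub>2 \<noteq> f c \<eta>\<^sub>2 \<beta>\<^sub>2"
    using sensitive[OF x'(1,2)] by metis
  define \<xi>' where "\<xi>' = glue \<gamma> \<xi> \<eta>\<^sub>1"
  have \<xi>': "near g \<xi>'" unfolding \<xi>'_def by (rule near_tail[OF \<eta>12(1)]) (rule glue_above)
  have E1: "eqv S \<eta>\<^sub>1 \<xi>'"
    by (rule eqv_modify[OF x'(3) agree_sym[OF \<eta>12(3)]]) (simp_all add: \<xi>'_def glue_above)
  have E2: "eqv S \<eta>\<^sub>2 \<xi>'" by (rule eqv_trans[OF eqv_sym[OF \<eta>12(5)] E1])
  obtain \<eta>' where \<eta>': "near g \<eta>'" "agree \<gamma> \<eta>' \<eta>" "eqv S \<eta>' \<xi>'" "f c \<eta>' \<beta>\<^sub>2 \<noteq> f c \<xi>' \<beta>\<^sub>2"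
    using \<eta>12 E1 E2 by metis
  obtain b where b: "\<And>z. b \<le> z \<Longrightarrow> \<eta>' z = \<xi>' z" using \<eta>'(3) unfolding eqv_def by blast
  obtain b' where b': "\<And>z. b' \<le> z \<Longrightarrow> f c \<eta>' z = f c \<xi>' z"
  proof -
    have "eqv (T c) (f c \<eta>') (f c \<xi>')" using \<eta>'(3) reduces c by blast
    then show thesis using that unfolding eqv_def by blast
  qed
  define \<beta>\<^sub>1 where "\<beta>\<^sub>1 = max \<gamma> b'"
  obtain \<delta> where \<delta>: "max \<beta>\<^sub>1 \<beta>\<^sub>2 < \<delta>" using no_max by blast
  obtain d where d: "\<And>\<zeta>. near g \<zeta> \<Longrightarrow> agree d \<zeta> \<eta>' \<Longrightarrow> agree \<delta> (f c \<zeta>) (f c \<eta>')"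
    using continuous[OF c \<eta>'(1)] by blast
  obtain d' where d': "\<And>\<zeta>. near g \<zeta> \<Longrightarrow> agree d' \<zeta> \<xi>' \<Longrightarrow> agree \<delta> (f c \<zeta>) (f c \<xi>')"
    using continuous[OF c \<xi>'] by blast
  obtain \<gamma>' where "max (max (max d d') \<delta>) (max b \<gamma>) < \<gamma>'" using no_max by blast
  then have \<gamma>': "d \<le> \<gamma>'" "d' \<le> \<gamma>'" "\<delta> \<le> \<gamma>'" "b \<le> \<gamma>'" "\<gamma> < \<gamma>'" by auto
  \<comment> \<open>The cut at \<open>\<gamma>'\<close> lies beyond the continuity moduli
    \<open>d\<close> and \<open>d'\<close>, so the images below \<open>\<delta>\<close> are fixed
    before the tail \<open>p\<close> is attached.\<close>
  define y where "y = (glue \<gamma>' (\<lambda>z. (\<eta>' z, \<xi>' z)) (\<lambda>z. (p z, p z)), \<gamma>')"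
  have y: "snd y = \<gamma>'" "agree \<gamma>' \<eta>' (fst \<circ> fst y)" "agree \<gamma>' \<xi>' (snd \<circ> fst y)"
    by (auto simp: y_def agree_def glue_def)
  have tail: "fst y z = (p z, p z)" if "\<gamma>' \<le> z" for z
    using that by (simp add: y_def glue_above)
  have "eqv S (fst \<circ> fst y) (snd \<circ> fst y)"
    by (rule eqv_modify[OF \<eta>'(3) y(2,3)]) (simp add: tail)
  moreover have "agree \<gamma>\<^sub>0 (fst \<circ> fst y) p"
  proof -
    have "agree \<gamma>\<^sub>0 (fst \<circ> fst y) \<eta>'"
      using agree_mono[OF agree_sym[OF y(2)], of \<gamma>\<^sub>0] \<gamma>'(5) x'(1) by simp
    moreover have "agree \<gamma>\<^sub>0 \<eta>' \<eta>" using agree_mono[OF \<eta>'(2) x'(1)] .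
    ultimately show ?thesis using x'(2) agree_trans by blast
  qed
  ultimately have "valid y" unfolding valid_def y(1) using tail \<gamma>'(5) x'(1) by auto
  moreover have "ext x y"
    unfolding ext_def agree_def
  proof (intro conjI allI impI)
    fix z assume "z < snd x"
    then have z: "z < \<gamma>" "z < \<gamma>'" using \<gamma>'(5) unfolding \<gamma>_def by auto
    have "fst y z = (\<eta>' z, \<xi>' z)" using z(2) by (simp add: y_def glue_below)
    also have "\<dots> = (\<eta> z, \<xi> z)"
      using z(1) \<eta>'(2) by (simp add: \<xi>'_def glue_below agree_def)
    finally show "fst x z = fst y z" by (simp add: \<eta>_def \<xi>_def)
  qed (use \<gamma>'(5) in \<open>simp add: y(1) \<gamma>_def\<close>)
  moreover have "progress x y"
    unfolding progress_def y(1) \<gamma>_def[symmetric]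
  proof (intro exI conjI allI impI)
    show "\<gamma> \<le> \<beta>\<^sub>1" "\<gamma> \<le> \<beta>\<^sub>2" using \<eta>12(6) by (auto simp: \<beta>\<^sub>1_def)
    show "\<beta>\<^sub>1 < \<gamma>'" "\<beta>\<^sub>2 < \<gamma>'" using \<delta> \<gamma>'(3) by auto
    fix \<zeta> \<zeta>' assume \<zeta>: "near g \<zeta>" "near g \<zeta>'" "agree \<gamma>' \<zeta> (fst \<circ> fst y)" "agree \<gamma>' \<zeta>' (snd \<circ> fst y)"
    have "agree \<delta> (f c \<zeta>) (f c \<eta>')"
      using d[OF \<zeta>(1) agree_mono[OF agree_trans[OF \<zeta>(3) agree_sym[OF y(2)]] \<gamma>'(1)]] .
    moreover have "agree \<delta> (f c \<zeta>') (f c \<xi>')"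
      using d'[OF \<zeta>(2) agree_mono[OF agree_trans[OF \<zeta>(4) agree_sym[OF y(3)]] \<gamma>'(2)]] .
    moreover have "f c \<eta>' \<beta>\<^sub>1 = f c \<xi>' \<beta>\<^sub>1" using b' by (simp add: \<beta>\<^sub>1_def)
    ultimately show "f c \<zeta> \<beta>\<^sub>1 = f c \<zeta>' \<beta>\<^sub>1" "f c \<zeta> \<beta>\<^sub>2 \<noteq> f c \<zeta>' \<beta>\<^sub>2"
      using \<delta> \<eta>'(4) by (auto simp: agree_def)
  qed
  ultimately show ?thesis using \<gamma>'(5) y(1) \<gamma>_def by blast
qed

end

section \<open>Towers along a coherent sequence of clubs\<close>

context regular_wellorder
begin

text \<open>
  The tower along \<open>C \<alpha>\<close> replaces its current state \<open>x\<close> by \<open>nx x\<close> at the first point of \<open>C \<alpha>\<close> above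
  the length of \<open>nx x\<close>. By coherence its value at a limit point \<open>\<gamma>\<close> of \<open>C \<alpha>\<close> depends on \<open>\<gamma>\<close> only, so
  the codes of all its values stay below \<open>\<alpha>\<close> if \<open>\<alpha>\<close> is closed under a suitable function.
\<close>

lemma tower_reaches:
  fixes valid :: "('k \<Rightarrow> 'a) \<times> 'k \<Rightarrow> bool" and C :: "'k \<Rightarrow> 'k set"
  assumes init: "valid i"
    and nx_valid: "\<And>x. valid x \<Longrightarrow> valid (nx x)"
    and nx_ext: "\<And>x. valid x \<Longrightarrow> ext x (nx x)"
    and longer: "\<And>h \<gamma> \<beta>. valid (h, \<gamma>) \<Longrightarrow> \<gamma> \<le> \<beta> \<Longrightarrow> valid (h, \<beta>)"
    and limit: "\<And>\<sigma> h. limit_ord \<sigma> \<Longrightarrow> \<sigma> \<notin> S \<Longrightarrow>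
      (\<And>\<beta>. \<beta> < \<sigma> \<Longrightarrow> \<exists>y. valid y \<and> \<beta> < snd y \<and> snd y < \<sigma> \<and> agree (snd y) h (fst y)) \<Longrightarrow>
      (\<And>x. \<sigma> \<le> x \<Longrightarrow> h x = fst i x) \<Longrightarrow> valid (h, \<sigma>)"
    and norm: "\<And>x y. valid x \<Longrightarrow> snd x \<le> y \<Longrightarrow> fst x y = fst i y"
    and size: "|{x. valid x}| \<le>o |UNIV :: 'k set|"
    and club: "\<And>\<alpha>. limit_ord \<alpha> \<Longrightarrow> club_in {..<\<alpha>} (C \<alpha>)"
    and coherent: "\<And>\<alpha> \<beta>. limit_ord \<alpha> \<Longrightarrow> \<beta> < \<alpha> \<Longrightarrow> limit_point (C \<alpha>) \<beta> \<Longrightarrow> C \<beta> = {..<\<beta>} \<inter> C \<alpha>"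
    and avoid: "\<And>\<alpha> \<beta>. limit_ord \<alpha> \<Longrightarrow> \<beta> < \<alpha> \<Longrightarrow> limit_point (C \<alpha>) \<beta> \<Longrightarrow> \<beta> \<notin> S"
    and W: "stationary W" "W \<inter> S = {}"
  shows "\<exists>\<alpha>\<in>W. \<exists>h. valid (h, \<alpha>) \<and> (\<forall>\<beta><\<alpha>. \<exists>x. valid x \<and> \<beta> \<le> snd x \<and> snd (nx x) \<le> \<alpha> \<and>
    agree (snd (nx x)) h (fst (nx x)))"
proof -
  obtain code :: "_ \<Rightarrow> 'k" where code: "inj_on code {x. valid x}"
    using size card_of_ordLeq[of "{x. valid x}" "UNIV :: 'k set"] by auto
  define dec where "dec = inv_into {x. valid x} code"
  have dec: "dec (code x) = x" if "valid x" for x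
    using code that unfolding dec_def by simp
  \<comment> \<open>The tower waits until \<open>\<beta>\<close> reaches the length of
    \<open>nx x\<close> and then lengthens the new state to exactly \<open>\<beta>\<close>. So all
    lengths but the initial one lie in the club, and limits of lengths are limit points of
    it.\<close>
  define act where "act \<beta> x = (if valid x \<and> snd (nx x) \<le> \<beta> then (fst (nx x), \<beta>) else x)" for \<beta> x
  have act_ext: "ext x (act \<beta> x)" for \<beta> x
    using nx_ext[of x] unfolding act_def ext_def by auto
  have act_valid: "valid (act \<beta> x)" if "valid x" for \<beta> x
    using that longer[of "fst (nx x)" "snd (nx x)" \<beta>] nx_valid[OF that] unfolding act_def by auto
  \<comment> \<open>Everything that must stay below \<open>\<alpha>\<close>: codes of single steps,
    lengths of successors, codes of the tower along \<open>C x\<close> at \<open>x\<close>, and the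
    initial data.\<close>
  define H where "H x y = max (max (code (act y (dec x))) (snd (nx (dec x))))
    (max (code (tower act i (C x) x)) (max (code i) (snd i)))" for x y
  obtain \<alpha> where \<alpha>: "\<alpha> \<in> W" "limit_ord \<alpha>" "\<And>x y. x < \<alpha> \<Longrightarrow> y < \<alpha> \<Longrightarrow> H x y < \<alpha>"
    using stationary_closure_point[OF W(1), of H] by blast
  have act_code: "code (act \<beta> x) < \<alpha>" if "valid x" "code x < \<alpha>" "\<beta> < \<alpha>" for x \<beta>
    using \<alpha>(3)[OF that(2,3)] by (simp add: H_def dec that(1))
  have nx_len: "snd (nx x) < \<alpha>" if "valid x" "code x < \<alpha>" for x
    using \<alpha>(3)[OF that(2,2)] by (simp add: H_def dec that(1))
  have coded_limit: "code (tower act i (C \<gamma>) \<gamma>) < \<alpha>" if "\<gamma> < \<alpha>" for \<gamma>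
    using \<alpha>(3)[OF that that] by (simp add: H_def)
  have i_small: "code i < \<alpha>" "snd i < \<alpha>"
  proof -
    obtain z where z: "z < \<alpha>" using \<alpha>(2) by (auto simp: limit_ord_def)
    show "code i < \<alpha>" "snd i < \<alpha>" using \<alpha>(3)[OF z z] by (simp_all add: H_def)
  qed
  define A where "A = C \<alpha>"
  have A: "A \<subseteq> {..<\<alpha>}" "\<And>\<beta>. \<beta> < \<alpha> \<Longrightarrow> limit_point A \<beta> \<Longrightarrow> \<beta> \<in> A" "\<And>\<beta>. \<beta> < \<alpha> \<Longrightarrow> \<exists>\<gamma>\<in>A. \<beta> < \<gamma>"
    using club[OF \<alpha>(2)] unfolding A_def club_in_initial_iff by blast+
  define t where "t = tower act i A"
  define Y where "Y \<beta> = t ` (A \<inter> {..<\<beta>})" for \<beta>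
  define l where "l \<beta> = chain_lim i (Y \<beta>)" for \<beta>
  have t_eq: "t \<beta> = act \<beta> (l \<beta>)" for \<beta>
    unfolding t_def l_def Y_def by (rule tower.simps)
  have i_ext: "ext i (t \<beta>)" for \<beta>
    unfolding t_def using tower_mono[where act = act, OF act_ext] by blast
  have i_ext_Y: "ext i y" if "y \<in> Y \<beta>" for y \<beta> using that i_ext unfolding Y_def by blast
  have t_ext: "ext (t \<mu>) (t \<nu>)" if "\<mu> \<in> A" "\<mu> \<le> \<nu>" for \<mu> \<nu>
    unfolding t_def using that by (rule tower_ext[where act = act, OF act_ext])
  have chain: "ext y y' \<or> ext y' y" if "y \<in> Y \<beta>" "y' \<in> Y \<beta>" for y y' \<beta>
    using that unfolding Y_def t_def by (intro tower_chain[where act = act, OF act_ext]) auto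
  have chain_i: "ext y y' \<or> ext y' y" if "y \<in> insert i (Y \<beta>)" "y' \<in> insert i (Y \<beta>)" for y y' \<beta>
    using that chain[of y \<beta> y'] i_ext_Y[of y \<beta>] i_ext_Y[of y' \<beta>] ext_refl[of i] by blast
  have len_le: "snd y \<le> snd (l \<beta>)" if "y \<in> insert i (Y \<beta>)" for y \<beta>
  proof -
    obtain u where "\<forall>y\<in>insert i (Y \<beta>). snd y \<le> u" unfolding Y_def using tower_bounded by blast
    then show ?thesis unfolding l_def using that by (intro snd_chain_lim_ge[of _ _ u]) auto
  qed
  define inv where "inv \<beta> \<longleftrightarrow> valid (t \<beta>) \<and> code (t \<beta>) < \<alpha> \<and>
    (snd (t \<beta>) = snd i \<or> snd (t \<beta>) \<in> A \<and> snd (t \<beta>) \<le> \<beta>)" for \<beta>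
  have l_max: "l \<beta> = y" if "y \<in> insert i (Y \<beta>)" "valid y" "\<And>z. z \<in> Y \<beta> \<Longrightarrow> ext z y" for y \<beta>
    unfolding l_def
  proof (rule chain_lim_max[OF that(1)])
    fix z assume "z \<in> insert i (Y \<beta>)"
    then show "ext z y" using that(1,3) i_ext_Y[of y \<beta>] ext_refl[of i] by blast
  qed (use norm[OF that(2)] in simp)
  have l_valid: "valid (l \<beta>) \<and> (snd (l \<beta>) = snd i \<or> snd (l \<beta>) \<le> \<beta> \<and> (snd (l \<beta>) = \<beta> \<or> snd (l \<beta>) \<in> A))"
    if \<beta>: "\<beta> \<le> \<alpha>" and IH: "\<And>\<mu>. \<mu> \<in> A \<Longrightarrow> \<mu> < \<beta> \<Longrightarrow> inv \<mu>" for \<beta>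
  proof (cases "\<exists>y\<in>insert i (Y \<beta>). \<forall>z\<in>insert i (Y \<beta>). ext z y")
    case True
    then obtain y where y: "y \<in> insert i (Y \<beta>)" "\<And>z. z \<in> insert i (Y \<beta>) \<Longrightarrow> ext z y" by blast
    have vy: "valid y" using y(1) init IH unfolding Y_def inv_def by auto
    have "l \<beta> = y" using y vy by (intro l_max) auto
    then show ?thesis using y(1) vy IH unfolding Y_def inv_def by fastforce
  next
    case False
    \<comment> \<open>No state is maximal, so the lengths climb strictly to \<open>\<sigma>\<close>,
      a limit point of \<open>A\<close>. It is outside \<open>S\<close>, by \<open>avoid\<close> if
      \<open>\<sigma> < \<alpha>\<close> and because \<open>\<alpha> \<in> W\<close>
      otherwise.\<close>
    define \<sigma> where "\<sigma> = snd (l \<beta>)"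
    have lt: "snd y < \<sigma>" if y: "y \<in> insert i (Y \<beta>)" for y
    proof (rule ccontr)
      assume "\<not> snd y < \<sigma>"
      then have "snd y = \<sigma>" using len_le[OF y] \<sigma>_def by simp
      then have "ext z y" if "z \<in> insert i (Y \<beta>)" for z
        using chain_i[OF y that] len_le[OF that] unfolding \<sigma>_def ext_def
        by (auto intro: agree_sym)
      then show False using False y by blast
    qed
    have cof: "\<exists>y\<in>Y \<beta>. b < snd y \<and> snd y < \<sigma> \<and> snd y \<in> A \<and> snd y < \<beta> \<and> snd i < snd y \<and> valid y"
      if "b < \<sigma>" for b
    proof -
      have "\<not> (\<forall>y\<in>insert i (Y \<beta>). snd y \<le> max b (snd i))"
      proof
        assume "\<forall>y\<in>insert i (Y \<beta>). snd y \<le> max b (snd i)"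
        then have "\<sigma> \<le> max b (snd i)" unfolding \<sigma>_def l_def by (intro snd_chain_lim_le) blast
        then show False using that lt[of i] by (auto simp: le_max_iff_disj)
      qed
      then obtain y where "y \<in> insert i (Y \<beta>)" "max b (snd i) < snd y" unfolding not_le[symmetric] by blast
      then have y: "y \<in> Y \<beta>" "b < snd y" "snd i < snd y" by auto
      then obtain \<mu> where "\<mu> \<in> A" "\<mu> < \<beta>" "y = t \<mu>" unfolding Y_def by blast
      then have "snd y \<in> A" "snd y < \<beta>" "valid y" using IH[of \<mu>] y(3) unfolding inv_def by auto
      then show ?thesis using y lt[of y] by blast
    qed
    have lp: "limit_point A \<sigma>" unfolding limit_point_iff using cof lt[of i] by blast
    have "\<sigma> \<le> \<beta>" unfolding \<sigma>_def l_def
    proof (rule snd_chain_lim_le)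
      fix y assume "y \<in> insert i (Y \<beta>)"
      then show "snd y \<le> \<beta>" using cof[OF lt] by (meson less_imp_le less_trans)
    qed
    moreover have "\<sigma> = \<beta> \<or> \<sigma> \<in> A" using \<open>\<sigma> \<le> \<beta>\<close> A(2)[OF _ lp] \<beta> by (cases "\<sigma> = \<beta>") auto
    moreover have "\<sigma> \<notin> S"
      using avoid[OF \<alpha>(2), of \<sigma>] lp \<open>\<sigma> \<le> \<beta>\<close> \<beta> W(2) \<alpha>(1) unfolding A_def[symmetric]
      by (cases "\<sigma> = \<alpha>") auto
    moreover have "valid (fst (l \<beta>), \<sigma>)"
    proof (rule limit[OF limit_point_imp_limit_ord[OF lp] \<open>\<sigma> \<notin> S\<close>])
      fix b assume "b < \<sigma>"
      then obtain y where y: "y \<in> Y \<beta>" "b < snd y" "snd y < \<sigma>" "valid y" using cof by blast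
      have "agree (snd y) (fst (l \<beta>)) (fst y)"
        unfolding agree_def l_def using fst_chain_lim[OF chain[where \<beta> = \<beta>] y(1)] by blast
      then show "\<exists>y. valid y \<and> b < snd y \<and> snd y < \<sigma> \<and> agree (snd y) (fst (l \<beta>)) (fst y)"
        using y by blast
    next
      fix x assume "\<sigma> \<le> x"
      then show "fst (l \<beta>) x = fst i x"
        unfolding l_def using lt by (intro fst_chain_lim_above) (meson insertI2 less_imp_le order_trans)
    qed
    ultimately show ?thesis unfolding \<sigma>_def by auto
  qed
  have inv: "\<beta> \<in> A \<Longrightarrow> inv \<beta>" for \<beta>
  proof (induction \<beta> rule: less_induct)
    case (less \<beta>)
    have \<beta>: "\<beta> < \<alpha>" using less.prems A(1) by blast
    have lv: "valid (l \<beta>)" "snd (l \<beta>) = snd i \<or> snd (l \<beta>) \<le> \<beta> \<and> snd (l \<beta>) \<in> A"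
      using l_valid[OF less_imp_le[OF \<beta>]] less by auto
    have "valid (t \<beta>)" unfolding t_eq by (rule act_valid[OF lv(1)])
    moreover have "snd (t \<beta>) = snd i \<or> snd (t \<beta>) \<in> A \<and> snd (t \<beta>) \<le> \<beta>"
      using lv(2) less.prems unfolding t_eq act_def by auto
    moreover have "code (t \<beta>) < \<alpha>"
    \<comment> \<open>At a limit point the code is bounded through \<open>H\<close>, as coherence
      replaces \<open>A\<close> by \<open>C \<beta>\<close>. Elsewhere the previous stage has a code
      below \<open>\<alpha>\<close>, and \<open>act\<close> preserves this.\<close>
    proof (cases "limit_point A \<beta>")
      case True
      then have "A \<inter> {..<\<beta>} = C \<beta> \<inter> {..<\<beta>}"
        using coherent[OF \<alpha>(2) \<beta>] unfolding A_def by auto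
      then have "t \<beta> = tower act i (C \<beta>) \<beta>" unfolding t_def by (rule tower_cong)
      then show ?thesis using coded_limit[OF \<beta>] by simp
    next
      case False
      have "\<exists>y\<in>insert i (Y \<beta>). valid y \<and> code y < \<alpha> \<and> (\<forall>z\<in>Y \<beta>. ext z y)"
      proof (cases "A \<inter> {..<\<beta>} = {}")
        case True
        then show ?thesis using init i_small(1) by (simp add: Y_def)
      next
        case nonempty: False
        then have "\<exists>x. x < \<beta>" by auto
        then obtain a where a: "a < \<beta>" "\<not> (\<exists>\<nu>\<in>A. a < \<nu> \<and> \<nu> < \<beta>)"
          using False unfolding limit_point_iff by blast
        then have "\<forall>\<nu>\<in>A \<inter> {..<\<beta>}. \<nu> \<le> a" by (auto simp: not_less)
        \<comment> \<open>The greatest element of \<open>A\<close> below \<open>\<beta>\<close>: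
          \<open>A\<close> is bounded there, and its least upper bound is in \<open>A\<close> by
          closedness.\<close>
        define \<mu> where "\<mu> = (LEAST u. \<forall>\<nu>\<in>A \<inter> {..<\<beta>}. \<nu> \<le> u)"
        have ub: "\<forall>\<nu>\<in>A \<inter> {..<\<beta>}. \<nu> \<le> \<mu>"
          unfolding \<mu>_def by (rule LeastI) fact
        have "\<mu> \<le> a" unfolding \<mu>_def by (rule Least_le) fact
        then have "\<mu> < \<beta>" using a(1) by simp
        have "\<mu> \<in> A"
        proof (rule ccontr)
          assume n: "\<mu> \<notin> A"
          have "limit_point A \<mu>"
            unfolding limit_point_iff
          proof (intro conjI allI impI)
            obtain \<nu> where "\<nu> \<in> A \<inter> {..<\<beta>}" using nonempty by blast
            then have "\<nu> < \<mu>" using ub n by (metis IntD1 order.order_iff_strict)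
            then show "\<exists>x. x < \<mu>" by blast
            fix b assume "b < \<mu>"
            then have "\<not> (\<forall>\<nu>\<in>A \<inter> {..<\<beta>}. \<nu> \<le> b)" unfolding \<mu>_def by (rule not_less_Least)
            then obtain \<nu> where "\<nu> \<in> A \<inter> {..<\<beta>}" "b < \<nu>" by (auto simp: not_le)
            then show "\<exists>\<gamma>\<in>A. b < \<gamma> \<and> \<gamma> < \<mu>" using ub n by (metis IntD1 order.order_iff_strict)
          qed
          then show False using A(2) n \<open>\<mu> < \<beta>\<close> \<beta> by simp
        qed
        then have "t \<mu> \<in> Y \<beta>" using \<open>\<mu> < \<beta>\<close> by (simp add: Y_def)
        moreover have "\<forall>z\<in>Y \<beta>. ext z (t \<mu>)" using t_ext ub by (auto simp: Y_def)
        ultimately show ?thesis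
          using less.IH[OF \<open>\<mu> < \<beta>\<close> \<open>\<mu> \<in> A\<close>] unfolding inv_def by blast
      qed
      then obtain y where y: "y \<in> insert i (Y \<beta>)" "valid y" "code y < \<alpha>" "\<forall>z\<in>Y \<beta>. ext z y" by blast
      have "l \<beta> = y" by (rule l_max) (use y in auto)
      then show ?thesis unfolding t_eq using act_code[OF y(2,3) \<beta>] by simp
    qed
    ultimately show ?case unfolding inv_def by blast
  qed
  have unbounded: "\<exists>\<mu>\<in>A. s < snd (t \<mu>)" if s: "s < \<alpha>" for s
  proof (rule ccontr)
    assume "\<not> (\<exists>\<mu>\<in>A. s < snd (t \<mu>))"
    then have le: "\<And>\<mu>. \<mu> \<in> A \<Longrightarrow> snd (t \<mu>) \<le> s" by (auto simp: not_less)
    obtain \<mu> where \<mu>: "\<mu> \<in> A" "s < \<mu>" using A(3)[OF s] by blast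
    \<comment> \<open>Acting at \<open>\<nu>\<close> would give length \<open>\<nu> > s\<close>, so
      past \<open>s\<close> the tower could only repeat its state. But the successor of this state
      is shorter than \<open>\<alpha>\<close>, which forces an action at some later
      \<open>\<nu>\<close>.\<close>
    have stuck: "\<nu> \<in> A \<Longrightarrow> \<mu> < \<nu> \<Longrightarrow> l \<nu> = t \<mu> \<and> t \<nu> = t \<mu>" for \<nu>
    proof (induction \<nu> rule: less_induct)
      case (less \<nu>)
      have "l \<nu> = t \<mu>"
      proof (rule l_max)
        show "t \<mu> \<in> insert i (Y \<nu>)" using \<mu> less.prems by (simp add: Y_def)
        show "valid (t \<mu>)" using inv[OF \<mu>(1)] by (simp add: inv_def)
        fix z assume "z \<in> Y \<nu>"
        then obtain \<nu>' where \<nu>': "\<nu>' \<in> A" "\<nu>' < \<nu>" "z = t \<nu>'" by (auto simp: Y_def)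
        then show "ext z (t \<mu>)" using t_ext[of \<nu>' \<mu>] less.IH[of \<nu>'] by (cases "\<nu>' \<le> \<mu>") auto
      qed
      moreover have "t \<nu> = t \<mu>"
        using t_eq[of \<nu>] le[OF less.prems(1)] \<mu>(2) less.prems(2) unfolding \<open>l \<nu> = t \<mu>\<close> act_def
        by (auto split: if_splits)
      ultimately show ?case by blast
    qed
    have v: "valid (t \<mu>)" "code (t \<mu>) < \<alpha>" using inv[OF \<mu>(1)] by (auto simp: inv_def)
    have "max (snd (nx (t \<mu>))) \<mu> < \<alpha>" using nx_len[OF v] \<mu>(1) A(1) by auto
    then obtain \<nu> where \<nu>: "\<nu> \<in> A" "max (snd (nx (t \<mu>))) \<mu> < \<nu>" using A(3) by blast
    then have "l \<nu> = t \<mu>" using stuck by simp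
    moreover have "snd (nx (t \<mu>)) \<le> \<nu>" using \<nu>(2) by auto
    ultimately have "snd (t \<nu>) = \<nu>" using t_eq[of \<nu>] v(1) by (simp add: act_def)
    then show False using le[OF \<nu>(1)] \<nu>(2) \<mu>(2) by auto
  qed
  have lim: "valid (l \<alpha>)" "snd (l \<alpha>) = snd i \<or> snd (l \<alpha>) \<le> \<alpha>"
    using l_valid[of \<alpha>] inv by auto
  have Y_\<alpha>: "Y \<alpha> = t ` A" using A(1) by (auto simp: Y_def)
  have "snd (l \<alpha>) = \<alpha>"
  proof (rule ccontr)
    assume "snd (l \<alpha>) \<noteq> \<alpha>"
    then have "snd (l \<alpha>) < \<alpha>" using lim(2) i_small(2) by auto
    then obtain \<mu> where "\<mu> \<in> A" "snd (l \<alpha>) < snd (t \<mu>)" using unbounded by blast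
    then show False using len_le[of "t \<mu>" \<alpha>] Y_\<alpha> by auto
  qed
  then have "valid (fst (l \<alpha>), \<alpha>)" using lim(1) by (metis prod.collapse)
  moreover have "\<exists>x. valid x \<and> \<beta> \<le> snd x \<and> snd (nx x) \<le> \<alpha> \<and> agree (snd (nx x)) (fst (l \<alpha>)) (fst (nx x))"
    if \<beta>: "\<beta> < \<alpha>" for \<beta>
  proof -
    obtain \<mu> where \<mu>: "\<mu> \<in> A" "\<beta> < snd (t \<mu>)" using unbounded[OF \<beta>] by blast
    define e where "e = snd (t \<mu>)"
    have "e < \<alpha>" using inv[OF \<mu>(1)] i_small(2) A(1) by (auto simp: e_def inv_def)
    then have ex: "\<exists>\<nu>. \<nu> \<in> A \<and> e < snd (t \<nu>)" using unbounded by blast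
    \<comment> \<open>The first stage longer than \<open>e\<close> must be an action, and it acts on
      a state of length exactly \<open>e\<close>.\<close>
    define \<nu> where "\<nu> = (LEAST \<nu>. \<nu> \<in> A \<and> e < snd (t \<nu>))"
    have \<nu>: "\<nu> \<in> A" "e < snd (t \<nu>)" using LeastI_ex[OF ex] unfolding \<nu>_def by auto
    have before: "snd (t \<nu>') \<le> e" if "\<nu>' \<in> A" "\<nu>' < \<nu>" for \<nu>'
      using not_less_Least[OF that(2)[unfolded \<nu>_def]] that(1) by auto
    have "\<mu> < \<nu>"
    proof (rule ccontr)
      assume "\<not> \<mu> < \<nu>"
      then have "ext (t \<nu>) (t \<mu>)" using t_ext \<nu>(1) by simp
      then show False using \<nu>(2) by (auto simp: e_def ext_def)
    qed
    have "e \<le> snd (l \<nu>)" using len_le[of "t \<mu>" \<nu>] \<mu>(1) \<open>\<mu> < \<nu>\<close> by (simp add: e_def Y_def)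
    have "snd (l \<nu>) \<le> e"
      unfolding l_def
    proof (rule snd_chain_lim_le)
      fix y assume "y \<in> insert i (Y \<nu>)"
      then show "snd y \<le> e" using before i_ext[of \<mu>] by (auto simp: Y_def e_def ext_def)
    qed
    have "\<nu> < \<alpha>" using \<nu>(1) A(1) by blast
    have v: "valid (l \<nu>)" using l_valid[of \<nu>] inv \<open>\<nu> < \<alpha>\<close> by simp
    have acted: "snd (nx (l \<nu>)) \<le> \<nu>" "t \<nu> = (fst (nx (l \<nu>)), \<nu>)"
      using \<nu>(2) \<open>snd (l \<nu>) \<le> e\<close> unfolding t_eq act_def by (auto split: if_splits)
    have "agree (snd (nx (l \<nu>))) (fst (l \<alpha>)) (fst (nx (l \<nu>)))"
      unfolding agree_def
    proof (intro allI impI)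
      fix z assume "z < snd (nx (l \<nu>))"
      then have "z < snd (t \<nu>)" using acted by simp
      moreover have "t \<nu> \<in> Y \<alpha>" using \<nu>(1) Y_\<alpha> by blast
      ultimately have "fst (l \<alpha>) z = fst (t \<nu>) z"
        unfolding l_def by (intro fst_chain_lim[OF chain[where \<beta> = \<alpha>]])
      then show "fst (l \<alpha>) z = fst (nx (l \<nu>)) z" using acted(2) by simp
    qed
    then show ?thesis
      using v \<open>e \<le> snd (l \<nu>)\<close> \<mu>(2) acted(1) \<open>\<nu> < \<alpha>\<close> unfolding e_def
      by (intro exI[of _ "l \<nu>"]) auto
  qed
  ultimately show ?thesis using \<alpha>(1) by blast
qed

end

section \<open>The contradiction at a point of \<open>T c - S\<close>\<close>

context sensitive_reduction
begin

text \<open>Both components differ from \<open>p\<close> by a bounded set, so two bounded sets and a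
  length describe a state.\<close>

lemma valid_size: "|{x. valid x}| \<le>o |UNIV :: 'k set|"
proof -
  define P where "P = {q :: 'k \<Rightarrow> bool. \<exists>u. \<forall>x\<ge>u. \<not> q x}"
  define F where "F = (\<lambda>(a, b, \<gamma> :: 'k). ((\<lambda>x. (p x \<noteq> a x, p x \<noteq> b x)), \<gamma>))"
  have "x \<in> F ` (P \<times> P \<times> UNIV)" if "valid x" for x
  proof (rule image_eqI)
    show "x = F (\<lambda>z. p z \<noteq> fst (fst x z), \<lambda>z. p z \<noteq> snd (fst x z), snd x)"
      unfolding F_def by (cases x) (auto simp: fun_eq_iff prod_eq_iff)
    have "\<forall>z\<ge>snd x. fst x z = (p z, p z)" using that by (simp add: valid_def)
    then show "(\<lambda>z. p z \<noteq> fst (fst x z), \<lambda>z. p z \<noteq> snd (fst x z), snd x) \<in> P \<times> P \<times> UNIV"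
      unfolding P_def by (auto intro!: exI[of _ "snd x"])
  qed
  then have "|{x. valid x}| \<le>o |F ` (P \<times> P \<times> UNIV)|" by (intro card_of_mono1) blast
  also have "|F ` (P \<times> P \<times> UNIV)| \<le>o |UNIV :: 'k set|"
    unfolding P_def by (intro image_le_k Times_le_k bounded_preds card_of_mono1 subset_refl)
  finally show ?thesis .
qed

text \<open>The pair built up to \<open>\<alpha>\<close> is equivalent, so its images must be
  settled at \<open>\<alpha> \<in> T c\<close>; but the progress made cofinally below
  \<open>\<alpha>\<close> puts both an agreement and a disagreement above every bound.\<close>

lemma impossible:
  fixes C :: "'k \<Rightarrow> 'k set"
  assumes club: "\<And>\<alpha>. limit_ord \<alpha> \<Longrightarrow> club_in {..<\<alpha>} (C \<alpha>)"
    and coherent: "\<And>\<alpha> \<beta>. limit_ord \<alpha> \<Longrightarrow> \<beta> < \<alpha> \<Longrightarrow> limit_point (C \<alpha>) \<beta> \<Longrightarrow> C \<beta> = {..<\<beta>} \<inter> C \<alpha>"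
    and avoid: "\<And>\<alpha> \<beta>. limit_ord \<alpha> \<Longrightarrow> \<beta> < \<alpha> \<Longrightarrow> limit_point (C \<alpha>) \<beta> \<Longrightarrow> \<beta> \<notin> S"
    and st: "stationary (T c - S)"
  shows False
proof -
  define i where "i = ((\<lambda>x. (p x, p x)), \<gamma>\<^sub>0)"
  obtain nx where nx: "\<And>x. valid x \<Longrightarrow> valid (nx x) \<and> ext x (nx x) \<and> snd x < snd (nx x) \<and> progress x (nx x)"
    using next_state by metis
  have "\<exists>\<alpha>\<in>T c - S. \<exists>h. valid (h, \<alpha>) \<and> (\<forall>\<beta><\<alpha>. \<exists>x. valid x \<and> \<beta> \<le> snd x \<and> snd (nx x) \<le> \<alpha> \<and>
    agree (snd (nx x)) h (fst (nx x)))"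
  proof (rule tower_reaches[where i = i, OF _ _ _ _ _ _ valid_size club coherent avoid st])
    show "valid i" using eqv_refl[OF S_limit] by (simp add: i_def valid_def comp_def)
    show "valid (h, \<beta>)" if "valid (h, \<gamma>)" "\<gamma> \<le> \<beta>" for h \<gamma> \<beta>
      using that by (auto simp: valid_def)
    show "fst x y = fst i y" if "valid x" "snd x \<le> y" for x y
      using that by (simp add: valid_def i_def)
    fix \<sigma> h
    assume \<sigma>: "limit_ord \<sigma>" "\<sigma> \<notin> S"
      and approx: "\<And>\<beta>. \<beta> < \<sigma> \<Longrightarrow> \<exists>y. valid y \<and> \<beta> < snd y \<and> snd y < \<sigma> \<and> agree (snd y) h (fst y)"
      and tail: "\<And>x. \<sigma> \<le> x \<Longrightarrow> h x = fst i x"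
    obtain y where y: "valid y" "snd y < \<sigma>" "agree (snd y) h (fst y)"
      using approx \<sigma>(1) unfolding limit_ord_def by blast
    have "\<gamma>\<^sub>0 \<le> snd y" "agree \<gamma>\<^sub>0 (fst \<circ> fst y) p" using y(1) by (auto simp: valid_def)
    then have "agree \<gamma>\<^sub>0 (fst \<circ> h) p" using agree_mono[OF y(3)] by (simp add: agree_def)
    moreover have "eqv S (fst \<circ> h) (snd \<circ> h)"
      unfolding eqv_def
    proof (intro conjI ballI)
      show "\<exists>\<beta>. \<forall>\<gamma>\<ge>\<beta>. (fst \<circ> h) \<gamma> = (snd \<circ> h) \<gamma>"
        using tail by (intro exI[of _ \<sigma>]) (simp add: i_def)
      fix \<tau> assume \<tau>: "\<tau> \<in> S"
      \<comment> \<open>Points below \<open>\<sigma>\<close> are settled by an earlier state, points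
        above it by the common tail; only \<open>\<sigma>\<close> itself could fail.\<close>
      then have "\<tau> \<noteq> \<sigma>" using \<sigma>(2) by blast
      then consider "\<tau> < \<sigma>" | "\<sigma> < \<tau>" by fastforce
      then show "settled \<tau> (fst \<circ> h) (snd \<circ> h)"
      proof cases
        case 1
        then obtain y where y: "valid y" "\<tau> < snd y" "agree (snd y) h (fst y)" using approx by blast
        then have "settled \<tau> (fst \<circ> fst y) (snd \<circ> fst y)" using \<tau> eqv_settled by (auto simp: valid_def)
        moreover have "agree \<tau> (fst \<circ> fst y) (fst \<circ> h)" "agree \<tau> (snd \<circ> fst y) (snd \<circ> h)"
          using y(2,3) by (auto simp: agree_def)
        ultimately show ?thesis using settled_agree by blast
      next
        case 2
        then show ?thesis by (rule settledI[of \<sigma> _ _ _ True]) (simp add: tail i_def)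
      qed
    qed
    ultimately show "valid (h, \<sigma>)"
      using tail \<open>\<gamma>\<^sub>0 \<le> snd y\<close> y(2) by (auto simp: valid_def i_def)
  qed (use nx in auto)
  then obtain \<alpha> h where \<alpha>: "\<alpha> \<in> T c" and h: "valid (h, \<alpha>)"
    and ev: "\<And>\<beta>. \<beta> < \<alpha> \<Longrightarrow> \<exists>x. valid x \<and> \<beta> \<le> snd x \<and> snd (nx x) \<le> \<alpha> \<and> agree (snd (nx x)) h (fst (nx x))"
    by blast
  have "eqv S (fst \<circ> h) (snd \<circ> h)" using h by (simp add: valid_def)
  then have "settled \<alpha> (f c (fst \<circ> h)) (f c (snd \<circ> h))" using reduces c \<alpha> eqv_settled by blast
  then obtain b \<beta> where \<beta>: "\<beta> < \<alpha>"
    "\<And>\<gamma>. \<beta> \<le> \<gamma> \<Longrightarrow> \<gamma> < \<alpha> \<Longrightarrow> (f c (fst \<circ> h) \<gamma> = f c (snd \<circ> h) \<gamma>) = b"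
    unfolding settled_def by blast
  obtain x where x: "valid x" "\<beta> \<le> snd x" "snd (nx x) \<le> \<alpha>" "agree (snd (nx x)) h (fst (nx x))"
    using ev[OF \<beta>(1)] by blast
  have near: "near g (fst \<circ> h)" "near g (snd \<circ> h)" using valid_near[OF h] by simp_all
  have ag: "agree (snd (nx x)) (fst \<circ> h) (fst \<circ> fst (nx x))" "agree (snd (nx x)) (snd \<circ> h) (snd \<circ> fst (nx x))"
    using x(4) by (auto simp: agree_def)
  obtain \<beta>\<^sub>1 \<beta>\<^sub>2 where "snd x \<le> \<beta>\<^sub>1" "\<beta>\<^sub>1 < snd (nx x)" "snd x \<le> \<beta>\<^sub>2" "\<beta>\<^sub>2 < snd (nx x)"
    "f c (fst \<circ> h) \<beta>\<^sub>1 = f c (snd \<circ> h) \<beta>\<^sub>1" "f c (fst \<circ> h) \<beta>\<^sub>2 \<noteq> f c (snd \<circ> h) \<beta>\<^sub>2"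
    using nx[OF x(1)] near ag unfolding progress_def by blast
  then show False using \<beta>(2)[of \<beta>\<^sub>1] \<beta>(2)[of \<beta>\<^sub>2] x(2,3) by auto
qed

end

context regular_wellorder
begin

text \<open>Channel \<open>c\<close> is read off from the image at the places
  \<open>enc c x\<close>. Those with \<open>x < \<delta>\<close> are bounded, so continuity of
  \<open>h\<close> passes to each channel.\<close>

lemma no_reduction:
  fixes S :: "'k set" and I :: "'c set" and T :: "'c \<Rightarrow> 'k set" and C :: "'k \<Rightarrow> 'k set"
    and h :: "('k \<Rightarrow> bool) \<Rightarrow> ('k \<Rightarrow> bool)" and enc :: "'c \<Rightarrow> 'k \<Rightarrow> 'k"
  assumes S: "S \<subseteq> Collect limit_ord" and I: "|I| <o |UNIV :: 'k set|"
    and h: "borel_fun h"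
    and red: "\<And>\<eta> \<xi>. eqv S \<eta> \<xi> \<longleftrightarrow> (\<forall>c\<in>I. eqv (T c) (\<lambda>x. h \<eta> (enc c x)) (\<lambda>x. h \<xi> (enc c x)))"
    and st: "\<And>c. c \<in> I \<Longrightarrow> stationary (T c - S)"
    and club: "\<And>\<alpha>. limit_ord \<alpha> \<Longrightarrow> club_in {..<\<alpha>} (C \<alpha>)"
    and coherent: "\<And>\<alpha> \<beta>. limit_ord \<alpha> \<Longrightarrow> \<beta> < \<alpha> \<Longrightarrow> limit_point (C \<alpha>) \<beta> \<Longrightarrow> C \<beta> = {..<\<beta>} \<inter> C \<alpha>"
    and avoid: "\<And>\<alpha> \<beta>. limit_ord \<alpha> \<Longrightarrow> \<beta> < \<alpha> \<Longrightarrow> limit_point (C \<alpha>) \<beta> \<Longrightarrow> \<beta> \<notin> S"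
  shows False
proof -
  obtain g where g: "\<And>\<eta> \<delta>. near g \<eta> \<Longrightarrow> \<exists>\<gamma>. \<forall>\<zeta>. near g \<zeta> \<longrightarrow> agree \<gamma> \<zeta> \<eta> \<longrightarrow> agree \<delta> (h \<zeta>) (h \<eta>)"
    using generic_point[OF h] by metis
  interpret generic_reduction kk S I T "\<lambda>c \<eta> x. h \<eta> (enc c x)" g
  proof
    fix c \<eta> and \<delta> :: 'k assume "c \<in> I" "near g \<eta>"
    obtain u where u: "\<And>x. x < \<delta> \<Longrightarrow> enc c x < u" using bounded_initial by blast
    obtain \<gamma> where \<gamma>: "\<And>\<zeta>. near g \<zeta> \<Longrightarrow> agree \<gamma> \<zeta> \<eta> \<Longrightarrow> agree u (h \<zeta>) (h \<eta>)"
      using g[OF \<open>near g \<eta>\<close>] by blast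
    have "agree \<delta> (\<lambda>x. h \<zeta> (enc c x)) (\<lambda>x. h \<eta> (enc c x))" if "near g \<zeta>" "agree \<gamma> \<zeta> \<eta>" for \<zeta>
      using \<gamma>[OF that] u by (simp add: agree_def)
    then show "\<exists>\<gamma>. \<forall>\<zeta>. near g \<zeta> \<longrightarrow> agree \<gamma> \<zeta> \<eta> \<longrightarrow>
        agree \<delta> (\<lambda>x. h \<zeta> (enc c x)) (\<lambda>x. h \<eta> (enc c x))" by blast
  qed (use S I red in auto)
  obtain c \<gamma>\<^sub>0 p where c: "c \<in> I" "near g p"
    "\<And>\<gamma> q \<beta>. \<gamma>\<^sub>0 \<le> \<gamma> \<Longrightarrow> agree \<gamma>\<^sub>0 q p \<Longrightarrow> \<exists>\<eta> \<xi> \<beta>'. near g \<eta> \<and> near g \<xi> \<and> agree \<gamma> \<eta> q \<and>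
       agree \<gamma> \<xi> q \<and> eqv S \<eta> \<xi> \<and> \<beta> \<le> \<beta>' \<and> h \<eta> (enc c \<beta>') \<noteq> h \<xi> (enc c \<beta>')"
    using sensitive_channel by metis
  interpret sensitive_reduction kk S I T "\<lambda>c \<eta> x. h \<eta> (enc c x)" g c \<gamma>\<^sub>0 p
    by unfold_locales (use c in auto)
  show False by (rule impossible[OF club coherent avoid st[OF c(1)]])
qed


lemma stationary_unbounded: "stationary X \<Longrightarrow> \<exists>x\<in>X. (a :: 'k) < x"
  using club_greaterThan[of a] unfolding stationary_def by blast

lemma club_Int:
  assumes "club_in UNIV C" "club_in UNIV (D :: 'k set)"
  shows "club_in UNIV (C \<inter> D)"
  unfolding club_in_UNIV_iff
proof (intro conjI allI impI)
  fix \<beta> assume "limit_point (C \<inter> D) \<beta>"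
  then have "limit_point C \<beta>" "limit_point D \<beta>" by (auto elim: limit_point_mono)
  then show "\<beta> \<in> C \<inter> D" using assms unfolding club_in_UNIV_iff by blast
next
  fix a :: 'k
  have "stationary (UNIV \<inter> C \<inter> D)" using assms by (intro stationary_Int_club stationary_UNIV)
  from stationary_unbounded[OF this, of a] show "\<exists>\<beta>\<in>C \<inter> D. a < \<beta>" by simp
qed

lemma club_limit_ord: "club_in UNIV (Collect limit_ord :: 'k set)"
  using closure_points_club[of "\<lambda>x y. x"] by (rule back_subst[of "club_in UNIV"]) auto

section \<open>Reducibility\<close>

text \<open>Enumerate pairs of an ordinal and an element of \<open>A\<close> along \<open>C\<close>,
  and forget the ordinal. If \<open>y\<close> did not recur beyond \<open>a\<close>, the ordinals
  paired with it would all come from an initial segment and be bounded.\<close>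

lemma cofinal_enumeration:
  fixes C :: "'k set"
  assumes "\<And>a. \<exists>x\<in>C. a < x" "|A| \<le>o |UNIV :: 'k set|" "A \<noteq> {}"
  shows "\<exists>e. \<forall>y\<in>A. \<forall>a. \<exists>x\<in>C. a < x \<and> e x = y"
proof -
  have "\<not> |C| <o |UNIV :: 'k set|" using bounded_if_small[of C] assms(1) by (meson less_asym)
  then have "|UNIV :: 'k set| \<le>o |C|" using not_ordLess_iff_ordLeq card_of_Well_order by blast
  moreover have "|(UNIV :: 'k set) \<times> A| \<le>o |UNIV :: 'k set|"
    by (intro Times_le_k assms(2) card_of_mono1 subset_refl)
  ultimately have "|(UNIV :: 'k set) \<times> A| \<le>o |C|" by (rule ordLeq_transitive[rotated])
  then obtain s where s: "s ` C = (UNIV :: 'k set) \<times> A"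
    using card_of_ordLeq2[of "(UNIV :: 'k set) \<times> A" C] assms(3) by auto
  show ?thesis
  proof (intro exI[of _ "\<lambda>x. snd (s x)"] ballI allI)
    fix y a assume y: "y \<in> A"
    show "\<exists>x\<in>C. a < x \<and> snd (s x) = y"
    proof (rule ccontr)
      assume no: "\<not> (\<exists>x\<in>C. a < x \<and> snd (s x) = y)"
      obtain b where "a < b" using no_max by blast
      obtain u where u: "\<And>x. x < b \<Longrightarrow> fst (s x) < u" using bounded_initial by blast
      have "(u, y) \<in> s ` C" using s y by simp
      then obtain x where x: "x \<in> C" "s x = (u, y)" by force
      then have "x \<le> a" using no by (auto simp: not_less)
      then have "fst (s x) < u" using u \<open>a < b\<close> by simp
      then show False using x by simp
    qed
  qed
qed

text \<open>
  \<open>\<phi> \<eta>\<close> is constant on each interval between consecutive points \<open>x\<close> of \<open>C\<close>, up to its first value: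
  it shows \<open>\<eta> x\<close>, masked by one bit about the local \<open>eqv S\<close>-class of \<open>\<eta>\<close> below some \<open>i\<close>. All these
  bits together determine whether \<open>\<eta>\<close> and \<open>\<xi>\<close> are settled at the points of \<open>S\<close>.
\<close>

lemma reduction:
  fixes S T :: "'k set"
  assumes S: "S \<subseteq> Collect limit_ord" and T: "T \<subseteq> Collect limit_ord" and st: "stationary S"
    and C: "club_in UNIV C" "C \<subseteq> Collect limit_ord" and sub: "T \<inter> C \<subseteq> S"
  shows "\<exists>\<phi>. local_fun \<phi> \<and> (\<forall>\<eta> \<xi>. eqv S \<eta> \<xi> \<longleftrightarrow> eqv T (\<phi> \<eta>) (\<phi> \<xi>))"
proof -
  have unb: "\<exists>x\<in>C. a < x" for a using C(1) unfolding club_in_UNIV_iff by blast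
  define P where "P = {p :: 'k \<Rightarrow> bool. \<exists>u. \<forall>x\<ge>u. \<not> p x}"
  have le: "|(UNIV :: 'k set) \<times> P| \<le>o |UNIV :: 'k set|"
    unfolding P_def by (intro Times_le_k bounded_preds card_of_mono1 subset_refl)
  have "(\<lambda>_. False) \<in> P" by (simp add: P_def)
  then have "(UNIV :: 'k set) \<times> P \<noteq> {}" by blast
  from cofinal_enumeration[OF unb le this] obtain e where e: "\<forall>y\<in>(UNIV :: 'k set) \<times> P. \<forall>a. \<exists>x\<in>C. a < x \<and> e x = y" ..
  \<comment> \<open>With \<open>e x = (i, p)\<close>, the bounded function \<open>p\<close>
    represents a local class below \<open>i\<close>, and the bit tests membership in it.\<close>
  define bit where "bit x \<eta> \<longleftrightarrow> (\<forall>\<alpha>\<in>S. \<alpha> \<le> fst (e x) \<longrightarrow> settled \<alpha> \<eta> (snd (e x)))" for x \<eta>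
  \<comment> \<open>The last point of \<open>C\<close> not above \<open>\<beta>\<close>, as
    \<open>C\<close> is closed; below all of \<open>C\<close> it is the least ordinal.\<close>
  define q where "q \<beta> = (LEAST u. \<forall>y\<in>C. y \<le> \<beta> \<longrightarrow> y \<le> u)" for \<beta>
  have q_le: "q \<beta> \<le> \<beta>" for \<beta> unfolding q_def by (rule Least_le) blast
  have q_ub: "y \<le> q \<beta>" if "y \<in> C" "y \<le> \<beta>" for y \<beta>
    using LeastI[of "\<lambda>u. \<forall>y\<in>C. y \<le> \<beta> \<longrightarrow> y \<le> u" \<beta>] that unfolding q_def by blast
  have q_C: "q x = x" if "x \<in> C" for x using q_ub[OF that] q_le[of x] by (simp add: antisym)
  have q_gap: "q \<gamma> = q a" if "\<And>y. y \<in> C \<Longrightarrow> y \<le> \<gamma> \<Longrightarrow> y \<le> a" "a \<le> \<gamma>" for a \<gamma>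
    unfolding q_def using that by (metis order_trans)
  \<comment> \<open>The first value of an interval is unmasked, so comparing it with the next value
    reveals the bit.\<close>
  define \<phi> where "\<phi> \<eta> \<beta> = (if q \<beta> = \<beta> then \<eta> \<beta> else \<eta> (q \<beta>) \<noteq> bit (q \<beta>) \<eta>)" for \<eta> \<beta>
  have "local_fun \<phi>"
    unfolding local_fun_def
  proof
    fix \<beta>
    obtain \<gamma> where "max \<beta> (fst (e (q \<beta>))) < \<gamma>" using no_max by blast
    then have \<gamma>: "\<beta> < \<gamma>" "q \<beta> < \<gamma>" "fst (e (q \<beta>)) < \<gamma>" using q_le[of \<beta>] by auto
    have "\<phi> \<eta> \<beta> = \<phi> \<xi> \<beta>" if ag: "agree \<gamma> \<eta> \<xi>" for \<eta> \<xi>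
    proof -
      have "settled \<alpha> \<eta> r \<longleftrightarrow> settled \<alpha> \<xi> r" if "\<alpha> \<le> fst (e (q \<beta>))" for \<alpha> r
      proof -
        have "agree \<alpha> \<eta> \<xi>" using agree_mono[OF ag] that \<gamma>(3) by simp
        then show ?thesis using settled_agree[OF _ agree_refl] agree_sym by blast
      qed
      then have "bit (q \<beta>) \<eta> \<longleftrightarrow> bit (q \<beta>) \<xi>" unfolding bit_def by blast
      then show ?thesis using agreeD[OF ag] \<gamma> by (simp add: \<phi>_def)
    qed
    then show "\<exists>\<gamma>. \<forall>\<eta> \<xi>. agree \<gamma> \<eta> \<xi> \<longrightarrow> \<phi> \<eta> \<beta> = \<phi> \<xi> \<beta>" by blast
  qed
  moreover have "eqv T (\<phi> \<eta>) (\<phi> \<xi>)" if eqv: "eqv S \<eta> \<xi>" for \<eta> \<xi>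
  proof -
    have "bit x \<eta> = bit x \<xi>" for x
      unfolding bit_def using eqv_settled[OF eqv] settled_sym settled_trans by blast
    then have eq: "(\<phi> \<eta> \<beta> = \<phi> \<xi> \<beta>) = (\<eta> (q \<beta>) = \<xi> (q \<beta>))" for \<beta> by (auto simp: \<phi>_def)
    show ?thesis
      unfolding eqv_def eq
    proof (intro conjI ballI)
      obtain b where b: "\<And>x. b \<le> x \<Longrightarrow> \<eta> x = \<xi> x" using eqv unfolding eqv_def by blast
      obtain x where x: "x \<in> C" "b < x" using unb by blast
      have "\<eta> (q \<gamma>) = \<xi> (q \<gamma>)" if "x \<le> \<gamma>" for \<gamma>
        using b[of "q \<gamma>"] q_ub[OF x(1) that] x(2) by simp
      then show "\<exists>\<beta>. \<forall>\<gamma>\<ge>\<beta>. \<eta> (q \<gamma>) = \<xi> (q \<gamma>)" by blast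
      fix \<tau> assume \<tau>: "\<tau> \<in> T"
      show "settled \<tau> (\<phi> \<eta>) (\<phi> \<xi>)"
      \<comment> \<open>A limit point of \<open>C\<close> in \<open>T\<close> belongs to
        \<open>S\<close>, and its condition transfers through \<open>q\<close>. At any other
        \<open>\<tau>\<close> the function \<open>q\<close> is finally constant.\<close>
      proof (cases "limit_point C \<tau>")
        case True
        then have "\<tau> \<in> S" using C(1) \<tau> sub unfolding club_in_UNIV_iff by blast
        then obtain c \<beta> where \<beta>: "\<beta> < \<tau>" "\<And>\<gamma>. \<beta> \<le> \<gamma> \<Longrightarrow> \<gamma> < \<tau> \<Longrightarrow> (\<eta> \<gamma> = \<xi> \<gamma>) = c"
          using eqv_settled[OF eqv \<open>\<tau> \<in> S\<close>] unfolding settled_def by blast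
        obtain x where x: "x \<in> C" "\<beta> < x" "x < \<tau>" using True \<beta>(1) unfolding limit_point_iff by blast
        show ?thesis
        proof (rule settledI[OF x(3)])
          fix \<gamma> assume "x \<le> \<gamma>" "\<gamma> < \<tau>"
          then have "\<beta> \<le> q \<gamma>" "q \<gamma> < \<tau>" using q_ub[OF x(1)] q_le[of \<gamma>] x(2) by force+
          then show "(\<phi> \<eta> \<gamma> = \<phi> \<xi> \<gamma>) = c" unfolding eq by (rule \<beta>(2))
        qed
      next
        case False
        have lim: "limit_ord \<tau>" using \<tau> T by blast
        then obtain a where a: "a < \<tau>" "\<And>y. y \<in> C \<Longrightarrow> a < y \<Longrightarrow> \<not> y < \<tau>"
          using False unfolding limit_point_iff limit_ord_def by blast
        show ?thesis
        proof (rule settledI[OF a(1)])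
          fix \<gamma> assume "a \<le> \<gamma>" "\<gamma> < \<tau>"
          then have "q \<gamma> = q a" using a(2) by (intro q_gap) (auto intro: leI le_less_trans)
          then show "(\<phi> \<eta> \<gamma> = \<phi> \<xi> \<gamma>) = (\<eta> (q a) = \<xi> (q a))" unfolding eq by simp
        qed
      qed
    qed
  qed
  moreover have "eqv S \<eta> \<xi>" if eqv': "eqv T (\<phi> \<eta>) (\<phi> \<xi>)" for \<eta> \<xi>
  proof -
    obtain b where b: "\<And>x. b \<le> x \<Longrightarrow> \<phi> \<eta> x = \<phi> \<xi> x" using eqv' unfolding eqv_def by blast
    have val: "\<eta> x = \<xi> x" if "x \<in> C" "b \<le> x" for x
      using b[OF that(2)] q_C[OF that(1)] by (simp add: \<phi>_def)
    have bits: "bit x \<eta> = bit x \<xi>" if x: "x \<in> C" "b \<le> x" for x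
    proof -
      \<comment> \<open>The successor of \<open>x\<close> is not in \<open>C\<close>, which consists
        of limit ordinals; so the value there carries the bit of \<open>x\<close>.\<close>
      define \<gamma> where "\<gamma> = (LEAST y. x < y)"
      obtain y where "x < y" using no_max by blast
      then have \<gamma>: "x < \<gamma>" unfolding \<gamma>_def by (rule LeastI)
      have least: "\<gamma> \<le> y" if "x < y" for y unfolding \<gamma>_def using that by (rule Least_le)
      have "\<not> limit_ord \<gamma>" using \<gamma> least unfolding limit_ord_def by (meson leD)
      then have "\<gamma> \<notin> C" using C(2) by blast
      have "q \<gamma> = q x"
      proof (rule q_gap)
        fix y assume "y \<in> C" "y \<le> \<gamma>"
        then show "y \<le> x" using least[of y] \<open>\<gamma> \<notin> C\<close> by (metis antisym not_le)
      qed (use \<gamma> in simp)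
      then have "q \<gamma> = x" using q_C[OF x(1)] by simp
      moreover have "\<phi> \<eta> \<gamma> = \<phi> \<xi> \<gamma>" "x \<noteq> \<gamma>" using b[of \<gamma>] \<gamma> x(2) by auto
      ultimately show ?thesis using val[OF x] by (auto simp: \<phi>_def)
    qed
    have settled: "settled \<alpha> \<eta> \<xi>" if \<alpha>: "\<alpha> \<in> S" for \<alpha>
    proof -
      \<comment> \<open>The restriction of \<open>\<eta>\<close> to \<open>\<alpha>\<close> is
        itself one of the tested functions. Its test recurs beyond \<open>b\<close>, where the bits
        of \<open>\<eta>\<close> and \<open>\<xi>\<close> agree.\<close>
      define p where "p y \<longleftrightarrow> y < \<alpha> \<and> \<eta> y" for y
      have "p \<in> P" unfolding P_def p_def by (auto simp: not_less)
      then have "\<exists>x\<in>C. b < x \<and> e x = (\<alpha>, p)" by (intro bspec[OF e, THEN spec]) simp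
      then obtain x where x: "x \<in> C" "b < x" "e x = (\<alpha>, p)" by blast
      have ag: "agree \<gamma> p \<eta>" if "\<gamma> \<le> \<alpha>" for \<gamma> using that by (auto simp: agree_def p_def)
      have "bit x \<eta>"
        unfolding bit_def x(3) fst_conv snd_conv
      proof (intro ballI impI)
        fix \<gamma> assume "\<gamma> \<in> S" "\<gamma> \<le> \<alpha>"
        then show "settled \<gamma> \<eta> p"
          using settled_agree[OF agree_refl agree_sym[OF ag] settled_refl] S by blast
      qed
      then have "bit x \<xi>" using bits x by simp
      then have "settled \<alpha> \<xi> p" using \<alpha> unfolding bit_def x(3) by simp
      then show ?thesis using settled_agree[OF agree_refl ag] settled_sym by blast
    qed
    have "\<exists>a. \<forall>x\<ge>a. \<eta> x = \<xi> x"
    \<comment> \<open>The points agree on \<open>C\<close> beyond \<open>b\<close>. If they also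
      disagreed unboundedly, some point of the stationary set \<open>S\<close> would be a limit of
      both kinds of places and not be settled.\<close>
    proof (rule ccontr)
      assume no: "\<not> (\<exists>a. \<forall>x\<ge>a. \<eta> x = \<xi> x)"
      have D: "\<exists>x\<in>{x. \<eta> x \<noteq> \<xi> x}. a < x" for a
      proof -
        obtain a' where "a < a'" using no_max by blast
        moreover obtain x where "a' \<le> x" "\<eta> x \<noteq> \<xi> x" using no by blast
        ultimately show ?thesis by (intro bexI[of _ x]) auto
      qed
      have D': "\<exists>x\<in>{x. \<eta> x = \<xi> x}. a < x" for a
      proof -
        obtain x where "x \<in> C" "max a b < x" using unb by blast
        then show ?thesis using val[of x] by (intro bexI[of _ x]) (auto simp: less_imp_le)
      qed
      obtain \<alpha> where \<alpha>: "\<alpha> \<in> S" "limit_point {x. \<eta> x \<noteq> \<xi> x} \<alpha>" "limit_point {x. \<eta> x = \<xi> x} \<alpha>"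
        using stationary_limit_point[OF st D D'] by blast
      obtain c \<beta> where \<beta>: "\<beta> < \<alpha>" "\<And>\<gamma>. \<beta> \<le> \<gamma> \<Longrightarrow> \<gamma> < \<alpha> \<Longrightarrow> (\<eta> \<gamma> = \<xi> \<gamma>) = c"
        using settled[OF \<alpha>(1)] unfolding settled_def by blast
      obtain x y where "\<eta> x \<noteq> \<xi> x" "\<beta> < x" "x < \<alpha>" "\<eta> y = \<xi> y" "\<beta> < y" "y < \<alpha>"
        using \<alpha>(2,3) \<beta>(1) unfolding limit_point_iff by blast
      then show False using \<beta>(2)[of x] \<beta>(2)[of y] by simp
    qed
    then show ?thesis using settled unfolding eqv_def by blast
  qed
  ultimately show ?thesis by blast
qed

section \<open>Products of the equivalence relations\<close>

definition pair_top :: "(('k \<Rightarrow> bool) \<times> ('k \<Rightarrow> bool)) topology" where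
  "pair_top = prod_topology cantor_top cantor_top"

abbreviation borel_pred :: "(('k \<Rightarrow> bool) \<times> ('k \<Rightarrow> bool) \<Rightarrow> bool) \<Rightarrow> bool" where
  "borel_pred P \<equiv> Collect P \<in> borel_sets (kappa :: 'k rel) pair_top"

lemma topspace_pair [simp]: "topspace pair_top = UNIV"
  by (simp add: pair_top_def)

lemma borel_pred_not: "borel_pred P \<Longrightarrow> borel_pred (\<lambda>z. \<not> P z)"
  using borel_sets.borel_compl[of "Collect P" kappa pair_top] by (simp add: Collect_neg_eq Compl_eq_Diff_UNIV)

lemma borel_pred_ex:
  assumes "|J| \<le>o |UNIV :: 'k set|" "\<And>j. j \<in> J \<Longrightarrow> borel_pred (P j)"
  shows "borel_pred (\<lambda>z. \<exists>j\<in>J. P j z)"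
proof -
  have "|(\<lambda>j. Collect (P j)) ` J| \<le>o (kappa :: 'k rel)"
    using image_le_k[OF assms(1)] kappa_card ordIso_symmetric ordLeq_ordIso_trans by blast
  then have "\<Union>((\<lambda>j. Collect (P j)) ` J) \<in> borel_sets (kappa :: 'k rel) pair_top"
    by (intro borel_sets.borel_Union) (use assms(2) in auto)
  moreover have "\<Union>((\<lambda>j. Collect (P j)) ` J) = {z. \<exists>j\<in>J. P j z}" by auto
  ultimately show ?thesis by simp
qed

lemma borel_pred_all:
  assumes "|J| \<le>o |UNIV :: 'k set|" "\<And>j. j \<in> J \<Longrightarrow> borel_pred (P j)"
  shows "borel_pred (\<lambda>z. \<forall>j\<in>J. P j z)"
  using borel_pred_not[OF borel_pred_ex[OF assms(1) borel_pred_not[OF assms(2)]]] by simp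

lemma subset_le_k: "|J :: 'k set| \<le>o |UNIV :: 'k set|"
  by (rule card_of_mono1) simp

lemma borel_pred_conj: "borel_pred P \<Longrightarrow> borel_pred Q \<Longrightarrow> borel_pred (\<lambda>z. P z \<and> Q z)"
proof -
  assume P: "borel_pred P" and Q: "borel_pred Q"
  have "|{P, Q}| \<le>o |UNIV :: 'k set|"
    using Un_le_k[OF singleton_le_k singleton_le_k, of P Q] by (simp add: insert_commute)
  from borel_pred_all[OF this, of "\<lambda>R. R"] show ?thesis using P Q by auto
qed

lemma borel_pred_eq: "borel_pred (\<lambda>z. (fst z x = snd z x) = c)" for x :: 'k
proof -
  have "openin pair_top ({\<eta>. \<eta> x = b} \<times> {\<eta>. \<eta> x = b'})" for b b'
    unfolding pair_top_def openin_prod_Times_iff by (intro disjI2 conjI open_coordinate)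
  then have "openin pair_top ({\<eta>. \<eta> x = True} \<times> {\<eta>. \<eta> x = True} \<union> {\<eta>. \<eta> x = False} \<times> {\<eta>. \<eta> x = False})"
    by (intro openin_Un)
  also have "{\<eta>. \<eta> x = True} \<times> {\<eta>. \<eta> x = True} \<union> {\<eta>. \<eta> x = False} \<times> {\<eta>. \<eta> x = False} =
      {z. fst z x = snd z x}" by auto
  finally have "borel_pred (\<lambda>z. fst z x = snd z x)" by (rule borel_open)
  with borel_pred_not[OF this] show ?thesis by (cases c) simp_all
qed

text \<open>With an injective \<open>enc\<close> each factor has its own places in \<kappa>, so that
  the product is again a relation on the same space.\<close>

definition product_rel :: "'c set \<Rightarrow> ('c \<Rightarrow> 'k \<Rightarrow> 'k) \<Rightarrow> ('c \<Rightarrow> 'k set) \<Rightarrow> ('k \<Rightarrow> bool) rel" where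
  "product_rel I enc T =
     {(\<eta>, \<xi>). \<forall>c\<in>I. eqv (T c) (\<lambda>x. \<eta> (enc c x)) (\<lambda>x. \<xi> (enc c x))}"

text \<open>Every quantifier in \<open>eqv\<close> ranges over at most \<kappa> many values, and the
  innermost condition compares the two points at one place.\<close>

lemma product_rel_borel_equiv:
  fixes T :: "'c \<Rightarrow> 'k set"
  assumes I: "|I| \<le>o |UNIV :: 'k set|" and T: "\<And>c. c \<in> I \<Longrightarrow> T c \<subseteq> Collect limit_ord"
  shows "product_rel I enc T \<in> borel_equivs"
proof -
  have "borel_pred (\<lambda>z. \<forall>c\<in>I. eqv (T c) (\<lambda>x. fst z (enc c x)) (\<lambda>x. snd z (enc c x)))"
  proof (rule borel_pred_all[OF I])
    fix c
    have "borel_pred (\<lambda>z. \<exists>\<beta>\<in>UNIV. \<forall>\<gamma>\<in>{\<beta>..}. (fst z (enc c \<gamma>) = snd z (enc c \<gamma>)) = True)"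
      by (intro borel_pred_ex borel_pred_all borel_pred_eq subset_le_k)
    moreover have "borel_pred (\<lambda>z. \<forall>\<alpha>\<in>T c. \<exists>b\<in>UNIV. \<exists>\<beta>\<in>{..<\<alpha>}. \<forall>\<gamma>\<in>{\<beta>..<\<alpha>}.
        (fst z (enc c \<gamma>) = snd z (enc c \<gamma>)) = b)"
    proof (intro borel_pred_ex borel_pred_all borel_pred_eq subset_le_k)
      show "|UNIV :: bool set| \<le>o |UNIV :: 'k set|"
        using finite_iff_ordLess_natLeq[of "UNIV :: bool set"] uncountable
        by (meson finite ordLess_imp_ordLeq ordLess_transitive)
    qed
    ultimately show "borel_pred (\<lambda>z. eqv (T c) (\<lambda>x. fst z (enc c x)) (\<lambda>x. snd z (enc c x)))"
      unfolding eqv_def settled_def using borel_pred_conj by (simp add: Ball_def Bex_def)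
  qed
  moreover have "product_rel I enc T =
      {z. \<forall>c\<in>I. eqv (T c) (\<lambda>x. fst z (enc c x)) (\<lambda>x. snd z (enc c x))}"
    by (auto simp: product_rel_def)
  moreover have "equiv UNIV (product_rel I enc T)"
  proof (rule equivI)
    show "refl (product_rel I enc T)" by (auto simp: product_rel_def refl_on_def intro: eqv_refl[OF T])
    show "sym (product_rel I enc T)" by (auto simp: product_rel_def sym_def intro: eqv_sym)
    show "trans (product_rel I enc T)" unfolding product_rel_def trans_def using eqv_trans by blast
  qed simp
  ultimately show ?thesis by (simp add: borel_equivs_def pair_top_def)
qed

lemma product_rel_reducible:
  fixes S T :: "'c \<Rightarrow> 'k set"
  assumes enc: "inj_on (case_prod enc) (I \<times> UNIV)"
    and red: "\<And>c. c \<in> I \<Longrightarrow> \<exists>\<phi>. local_fun \<phi> \<and> (\<forall>\<eta> \<xi>. eqv (S c) \<eta> \<xi> \<longleftrightarrow> eqv (T c) (\<phi> \<eta>) (\<phi> \<xi>))"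
  shows "borel_reducible (product_rel I enc S) (product_rel I enc T)"
proof -
  obtain \<phi> where \<phi>: "\<And>c. c \<in> I \<Longrightarrow> local_fun (\<phi> c)"
    "\<And>c \<eta> \<xi>. c \<in> I \<Longrightarrow> eqv (S c) \<eta> \<xi> \<longleftrightarrow> eqv (T c) (\<phi> c \<eta>) (\<phi> c \<xi>)" using red by metis
  define \<Phi> where "\<Phi> \<eta> y \<longleftrightarrow> (\<exists>c\<in>I. \<exists>x. y = enc c x \<and> \<phi> c (\<lambda>z. \<eta> (enc c z)) x)" for \<eta> y
  have \<Phi>: "\<Phi> \<eta> (enc c x) = \<phi> c (\<lambda>z. \<eta> (enc c z)) x" if "c \<in> I" for c \<eta> x
  proof
    assume "\<Phi> \<eta> (enc c x)"
    then obtain d y where "d \<in> I" "enc c x = enc d y" "\<phi> d (\<lambda>z. \<eta> (enc d z)) y"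
      unfolding \<Phi>_def by blast
    then show "\<phi> c (\<lambda>z. \<eta> (enc c z)) x" using inj_onD[OF enc, of "(c, x)" "(d, y)"] that by simp
  next
    assume "\<phi> c (\<lambda>z. \<eta> (enc c z)) x"
    then show "\<Phi> \<eta> (enc c x)" unfolding \<Phi>_def using that by blast
  qed
  have "local_fun \<Phi>"
    unfolding local_fun_def
  proof
    fix y
    show "\<exists>\<gamma>. \<forall>\<eta> \<xi>. agree \<gamma> \<eta> \<xi> \<longrightarrow> \<Phi> \<eta> y = \<Phi> \<xi> y"
    proof (cases "\<exists>c\<in>I. \<exists>x. y = enc c x")
      case True
      then obtain c x where y: "c \<in> I" "y = enc c x" by blast
      obtain \<delta> where \<delta>: "\<And>\<eta> \<xi>. agree \<delta> \<eta> \<xi> \<Longrightarrow> \<phi> c \<eta> x = \<phi> c \<xi> x"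
        using \<phi>(1)[OF y(1)] unfolding local_fun_def by blast
      obtain u where u: "\<And>z. z < \<delta> \<Longrightarrow> enc c z < u" using bounded_initial by blast
      have "\<Phi> \<eta> y = \<Phi> \<xi> y" if "agree u \<eta> \<xi>" for \<eta> \<xi>
        unfolding y(2) \<Phi>[OF y(1)] using that u by (intro \<delta>) (simp add: agree_def)
      then show ?thesis by blast
    next
      case False
      then show ?thesis unfolding \<Phi>_def by blast
    qed
  qed
  moreover have "(\<eta>, \<xi>) \<in> product_rel I enc S \<longleftrightarrow> (\<Phi> \<eta>, \<Phi> \<xi>) \<in> product_rel I enc T" for \<eta> \<xi>
    unfolding product_rel_def by (simp add: \<Phi> \<phi>(2) cong: ball_cong)
  ultimately show ?thesis unfolding borel_reducible_def using local_fun_borel by blast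
qed

text \<open>Inserting a point into factor \<open>c\<close> turns a reduction of the product into one
  of \<open>eqv (S c)\<close>. Cutting \<open>C \<alpha>\<close> above its only possible limit point
  in \<open>S c\<close> yields clubs whose limit points avoid \<open>S c\<close>, as
  \<open>no_reduction\<close> demands.\<close>

lemma product_rel_not_reducible:
  fixes S T :: "'c \<Rightarrow> 'k set" and C :: "'k \<Rightarrow> 'k set"
  assumes enc: "inj_on (case_prod enc) (I \<times> UNIV)" and I: "|I| <o |UNIV :: 'k set|"
    and S: "\<And>c. c \<in> I \<Longrightarrow> S c \<subseteq> Collect limit_ord"
    and c: "c \<in> I" and st: "\<And>d. d \<in> I \<Longrightarrow> stationary (T d - S c)"
    and club: "\<And>\<alpha>. limit_ord \<alpha> \<Longrightarrow> club_in {..<\<alpha>} (C \<alpha>)"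
    and coherent: "\<And>\<alpha> \<beta>. limit_ord \<alpha> \<Longrightarrow> \<beta> < \<alpha> \<Longrightarrow> limit_point (C \<alpha>) \<beta> \<Longrightarrow> C \<beta> = {..<\<beta>} \<inter> C \<alpha>"
    and once: "\<And>\<alpha> \<beta> \<gamma>. limit_ord \<alpha> \<Longrightarrow> \<beta> < \<gamma> \<Longrightarrow> \<gamma> < \<alpha> \<Longrightarrow> limit_point (C \<alpha>) \<beta> \<Longrightarrow>
      limit_point (C \<alpha>) \<gamma> \<Longrightarrow> \<beta> \<in> S c \<Longrightarrow> \<gamma> \<notin> S c"
  shows "\<not> borel_reducible (product_rel I enc S) (product_rel I enc T)"
proof
  assume "borel_reducible (product_rel I enc S) (product_rel I enc T)"
  then obtain h where h: "borel_fun h"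
    "\<And>\<eta> \<xi>. (\<eta>, \<xi>) \<in> product_rel I enc S \<longleftrightarrow> (h \<eta>, h \<xi>) \<in> product_rel I enc T"
    unfolding borel_reducible_def by blast
  \<comment> \<open>The other factors receive a constant point and impose no condition.\<close>
  define put where "put \<eta> y \<longleftrightarrow> (\<exists>x. y = enc c x \<and> \<eta> x)" for \<eta> y
  have put: "(\<lambda>x. put \<eta> (enc d x)) = (if d = c then \<eta> else (\<lambda>_. False))" if "d \<in> I" for d \<eta>
  proof
    fix x
    have "enc d x = enc c y \<longleftrightarrow> d = c \<and> x = y" for y
      using inj_onD[OF enc, of "(d, x)" "(c, y)"] that c by auto
    then show "put \<eta> (enc d x) = (if d = c then \<eta> else (\<lambda>_. False)) x" by (simp add: put_def)
  qed
  have "local_fun put"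
    unfolding local_fun_def
  proof
    fix y
    show "\<exists>\<gamma>. \<forall>\<eta> \<xi>. agree \<gamma> \<eta> \<xi> \<longrightarrow> put \<eta> y = put \<xi> y"
    proof (cases "\<exists>x. y = enc c x")
      case True
      then obtain x where x: "y = enc c x" by blast
      obtain \<gamma> where "x < \<gamma>" using no_max by blast
      moreover have "put \<eta> y = \<eta> x" for \<eta> using fun_cong[OF put[OF c], of \<eta> x] x by simp
      ultimately show ?thesis unfolding agree_def by metis
    next
      case False
      then show ?thesis unfolding put_def by blast
    qed
  qed
  then have borel: "borel_fun (h \<circ> put)" using h(1) by (intro borel_comp_local)
  have "eqv (S c) \<eta> \<xi> \<longleftrightarrow> (put \<eta>, put \<xi>) \<in> product_rel I enc S" for \<eta> \<xi>
    unfolding product_rel_def using put c eqv_refl[OF S] by auto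
  then have red: "eqv (S c) \<eta> \<xi> \<longleftrightarrow>
      (\<forall>d\<in>I. eqv (T d) (\<lambda>x. (h \<circ> put) \<eta> (enc d x)) (\<lambda>x. (h \<circ> put) \<xi> (enc d x)))" for \<eta> \<xi>
    using h(2) by (simp add: product_rel_def)
  define D where "D \<alpha> = {\<mu> \<in> C \<alpha>. \<forall>\<gamma><\<alpha>. limit_point (C \<alpha>) \<gamma> \<and> \<gamma> \<in> S c \<longrightarrow> \<gamma> < \<mu>}" for \<alpha>
  have D_limit: "limit_point (C \<alpha>) \<beta>" if "limit_point (D \<alpha>) \<beta>" for \<alpha> \<beta>
    using that by (rule limit_point_mono) (auto simp: D_def)
  have D_avoid: "\<beta> \<notin> S c" if lt: "\<beta> < \<alpha>" and lp: "limit_point (D \<alpha>) \<beta>" for \<alpha> \<beta>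
  proof
    assume \<beta>: "\<beta> \<in> S c"
    obtain \<mu> where "\<mu> \<in> D \<alpha>" "\<mu> < \<beta>" using lp unfolding limit_point_iff by blast
    then show False using \<beta> lt D_limit[OF lp] unfolding D_def by auto
  qed
  show False
  proof (rule no_reduction[OF S[OF c] I borel red st])
    fix \<alpha> :: 'k assume \<alpha>: "limit_ord \<alpha>"
    have cl: "C \<alpha> \<subseteq> {..<\<alpha>}" "\<And>\<beta>. \<beta> < \<alpha> \<Longrightarrow> limit_point (C \<alpha>) \<beta> \<Longrightarrow> \<beta> \<in> C \<alpha>"
      "\<And>\<beta>. \<beta> < \<alpha> \<Longrightarrow> \<exists>\<gamma>\<in>C \<alpha>. \<beta> < \<gamma>"
      using club[OF \<alpha>] unfolding club_in_initial_iff by blast+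
    show "club_in {..<\<alpha>} (D \<alpha>)"
      unfolding club_in_initial_iff
    proof (intro conjI allI impI)
      show "D \<alpha> \<subseteq> {..<\<alpha>}" using cl(1) by (auto simp: D_def)
    next
      fix \<beta> assume \<beta>: "\<beta> < \<alpha>" "limit_point (D \<alpha>) \<beta>"
      obtain \<mu> where "\<mu> \<in> D \<alpha>" "\<mu> < \<beta>" using \<beta>(2) unfolding limit_point_iff by blast
      then show "\<beta> \<in> D \<alpha>" using cl(2)[OF \<beta>(1) D_limit[OF \<beta>(2)]] unfolding D_def by (auto intro: less_trans)
    next
      fix \<beta> assume \<beta>: "\<beta> < \<alpha>"
      show "\<exists>\<gamma>\<in>D \<alpha>. \<beta> < \<gamma>"
      proof (cases "\<exists>\<delta><\<alpha>. limit_point (C \<alpha>) \<delta> \<and> \<delta> \<in> S c")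
        case True
        then obtain \<delta> where \<delta>: "\<delta> < \<alpha>" "limit_point (C \<alpha>) \<delta>" "\<delta> \<in> S c" by blast
        have uniq: "\<gamma> = \<delta>" if "\<gamma> < \<alpha>" "limit_point (C \<alpha>) \<gamma>" "\<gamma> \<in> S c" for \<gamma>
          using once[OF \<alpha>, of \<gamma> \<delta>] once[OF \<alpha>, of \<delta> \<gamma>] \<delta> that by (cases \<gamma> \<delta> rule: linorder_cases) auto
        have "max \<beta> \<delta> < \<alpha>" using \<beta> \<delta>(1) by simp
        then obtain \<gamma> where "\<gamma> \<in> C \<alpha>" "max \<beta> \<delta> < \<gamma>" using cl(3) by blast
        then show ?thesis using uniq unfolding D_def by (intro bexI[of _ \<gamma>]) auto
      next
        case False
        then show ?thesis using cl(3)[OF \<beta>] unfolding D_def by blast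
      qed
    qed
    fix \<beta> assume \<beta>: "\<beta> < \<alpha>" "limit_point (D \<alpha>) \<beta>"
    show "\<beta> \<notin> S c" by (rule D_avoid[OF \<beta>])
    have eq: "C \<beta> = {..<\<beta>} \<inter> C \<alpha>" by (rule coherent[OF \<alpha> \<beta>(1) D_limit[OF \<beta>(2)]])
    have lp: "limit_point (C \<beta>) \<gamma> \<longleftrightarrow> limit_point (C \<alpha>) \<gamma>" if "\<gamma> < \<beta>" for \<gamma>
      unfolding eq by (rule iffI; erule limit_point_mono) (use that in auto)
    obtain \<nu> where \<nu>: "\<nu> \<in> D \<alpha>" "\<nu> < \<beta>" using \<beta>(2) unfolding limit_point_iff by blast
    \<comment> \<open>Since \<open>\<beta>\<close> is a limit point of the truncated club, the cut
      is below \<open>\<beta>\<close>; so \<open>C \<alpha>\<close> and \<open>C \<beta>\<close> are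
      cut at the same place and coherence survives.\<close>
    have below: "\<gamma> < \<beta>" if "\<gamma> < \<alpha>" "limit_point (C \<alpha>) \<gamma>" "\<gamma> \<in> S c" for \<gamma>
      using \<nu> that unfolding D_def by (auto intro: less_trans)
    show "D \<beta> = {..<\<beta>} \<inter> D \<alpha>"
    proof (rule set_eqI)
      fix \<mu>
      have "(\<forall>\<gamma><\<beta>. limit_point (C \<beta>) \<gamma> \<and> \<gamma> \<in> S c \<longrightarrow> \<gamma> < \<mu>) \<longleftrightarrow>
          (\<forall>\<gamma><\<alpha>. limit_point (C \<alpha>) \<gamma> \<and> \<gamma> \<in> S c \<longrightarrow> \<gamma> < \<mu>)"
        using lp below less_trans[OF _ \<beta>(1)] by meson
      moreover have "\<mu> \<in> C \<beta> \<longleftrightarrow> \<mu> \<in> {..<\<beta>} \<and> \<mu> \<in> C \<alpha>" using eq by simp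
      ultimately show "\<mu> \<in> D \<beta> \<longleftrightarrow> \<mu> \<in> {..<\<beta>} \<inter> D \<alpha>"
        unfolding D_def mem_Collect_eq Int_iff by simp
    qed
  qed
qed

end

section \<open>Square sequences and the embedding\<close>

lemma card_of_finite_initials:
  fixes A :: "'k::wellorder set"
  assumes "\<And>x. x \<in> A \<Longrightarrow> finite {..<x}"
  shows "|A| \<le>o natLeq"
proof -
  have "inj_on (\<lambda>x. card {..<x}) A"
  proof (rule linorder_inj_onI)
    fix x y assume xy: "x < y" "x \<in> A" "y \<in> A"
    then have "{..<x} \<subset> {..<y}" by auto
    from psubset_card_mono[OF assms[OF xy(3)] this] show "card {..<x} \<noteq> card {..<y}" by simp
  qed auto
  then have "|A| \<le>o |UNIV :: nat set|" using card_of_ordLeq by blast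
  then show ?thesis using card_of_nat ordLeq_ordIso_trans by blast
qed

text \<open>\<open>rk A \<beta>\<close> is the order type of \<open>A \<inter> \<beta>\<close>.\<close>

function rk :: "'k::wellorder set \<Rightarrow> 'k \<Rightarrow> 'k" where
  "rk A \<beta> = (LEAST u. \<forall>x\<in>rk A ` (A \<inter> {..<\<beta>}). x < u)"
  by auto
termination
  by (relation "inv_image {(x, y). x < y} snd") (auto simp: wf)

declare rk.simps [simp del]

lemma rk_cong: "A \<inter> {..<\<beta>} = A' \<inter> {..<\<beta>} \<Longrightarrow> rk A \<beta> = rk A' \<beta>"
proof (induction \<beta> rule: less_induct)
  case (less \<beta>)
  have "rk A ` (A \<inter> {..<\<beta>}) = rk A' ` (A' \<inter> {..<\<beta>})"
  proof (rule image_cong[OF less.prems])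
    fix x assume "x \<in> A' \<inter> {..<\<beta>}"
    then show "rk A x = rk A' x"
      using less.prems by (intro less.IH) (auto intro: less_trans)
  qed
  then show ?case by (simp add: rk.simps[of _ \<beta>])
qed

lemma rk_surj: "\<delta> < rk A \<beta> \<Longrightarrow> \<exists>\<gamma>\<in>A. \<gamma> < \<beta> \<and> rk A \<gamma> = \<delta>"
proof (induction \<beta> rule: less_induct)
  case (less \<beta>)
  have "\<not> (\<forall>x\<in>rk A ` (A \<inter> {..<\<beta>}). x < \<delta>)"
    using not_less_Least[of \<delta>] less.prems unfolding rk.simps[of A \<beta>] by blast
  then obtain \<gamma> where \<gamma>: "\<gamma> \<in> A" "\<gamma> < \<beta>" "\<delta> \<le> rk A \<gamma>" by (auto simp: not_less)
  show ?case
  proof (cases "\<delta> = rk A \<gamma>")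
    case False
    then have "\<exists>\<gamma>'\<in>A. \<gamma>' < \<gamma> \<and> rk A \<gamma>' = \<delta>" using \<gamma> by (intro less.IH) auto
    then show ?thesis using \<gamma>(2) less_trans by blast
  qed (use \<gamma> in blast)
qed

context regular_wellorder
begin

lemma rk_strict:
  fixes A :: "'k set"
  assumes "\<gamma> \<in> A" "\<gamma> < \<beta>"
  shows "rk A \<gamma> < rk A \<beta>"
proof -
  obtain u where "\<forall>a\<in>A \<inter> {..<\<beta>}. rk A a < u" using bounded_image[OF small_subset_initial] by blast
  then have "\<forall>x\<in>rk A ` (A \<inter> {..<\<beta>}). x < u" by blast
  then have "\<forall>x\<in>rk A ` (A \<inter> {..<\<beta>}). x < rk A \<beta>"
    unfolding rk.simps[of A \<beta>] by (rule LeastI)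
  then show ?thesis using assms by blast
qed

lemma infinite_initial: "\<exists>w :: 'k. infinite {..<w}"
proof (rule ccontr)
  assume "\<not> ?thesis"
  then have "|UNIV :: 'k set| \<le>o natLeq" by (intro card_of_finite_initials) simp
  then show False using uncountable not_ordLess_ordLeq by blast
qed

lemma cofinality_le:
  assumes "r ` {..<w} \<subseteq> {..<\<alpha>}" "cofinal (r ` {..<w}) (ord_rel {..<\<alpha> :: 'k})"
  shows "cofinality \<alpha> \<le> w"
  unfolding cofinality_def by (rule Least_le) (use assms in blast)

text \<open>Otherwise some \<open>\<gamma>\<^sub>0\<close> has rank \<open>l\<close> in
  \<open>C \<alpha>\<close>. The supremum \<open>\<delta>\<close> of \<omega> further elements has
  cofinality below \<open>l\<close>, while \<open>C \<delta>\<close> contains the elements below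
  \<open>\<gamma>\<^sub>0\<close>, as many as \<open>l\<close> has.\<close>

lemma square_rk_le:
  fixes C :: "'k \<Rightarrow> 'k set"
  assumes l: "ord_rel {..<l} =o |{..<l}|" "natLeq <o |{..<l}|"
    and club: "\<And>\<alpha>. limit_ord \<alpha> \<Longrightarrow> club_in {..<\<alpha>} (C \<alpha>)"
    and coherent: "\<And>\<alpha> \<beta>. limit_ord \<alpha> \<Longrightarrow> \<beta> < \<alpha> \<Longrightarrow> limit_point (C \<alpha>) \<beta> \<Longrightarrow> C \<beta> = {..<\<beta>} \<inter> C \<alpha>"
    and narrow: "\<And>\<alpha>. limit_ord \<alpha> \<Longrightarrow> cofinality \<alpha> < l \<Longrightarrow> |C \<alpha>| <o ord_rel {..<l}"
    and \<alpha>: "limit_ord \<alpha>"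
  shows "rk (C \<alpha>) \<alpha> \<le> l"
proof (rule ccontr)
  assume "\<not> rk (C \<alpha>) \<alpha> \<le> l"
  then have "l < rk (C \<alpha>) \<alpha>" by simp
  from rk_surj[OF this] obtain \<gamma>\<^sub>0 where \<gamma>\<^sub>0: "\<gamma>\<^sub>0 \<in> C \<alpha>" "\<gamma>\<^sub>0 < \<alpha>" "rk (C \<alpha>) \<gamma>\<^sub>0 = l" by blast
  have cl: "C \<alpha> \<subseteq> {..<\<alpha>}" "\<And>\<beta>. \<beta> < \<alpha> \<Longrightarrow> \<exists>\<gamma>\<in>C \<alpha>. \<beta> < \<gamma>"
    using club[OF \<alpha>] unfolding club_in_initial_iff by blast+
  then have "\<forall>x. \<exists>y. x \<in> C \<alpha> \<longrightarrow> y \<in> C \<alpha> \<and> x < y" by blast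
  then obtain nx where nx: "\<And>x. x \<in> C \<alpha> \<Longrightarrow> nx x \<in> C \<alpha> \<and> x < nx x" by metis
  define r where "r n = (nx ^^ n) \<gamma>\<^sub>0" for n
  have r_in: "r n \<in> C \<alpha>" for n by (induction n) (simp_all add: r_def \<gamma>\<^sub>0 nx)
  have r_Suc: "r n < r (Suc n)" for n using nx[OF r_in[of n]] by (simp add: r_def)
  define \<delta> where "\<delta> = (LEAST x. \<forall>n. r n < x)"
  have r_\<alpha>: "\<forall>n. r n < \<alpha>" using r_in cl(1) by blast
  have \<delta>: "\<forall>n. r n < \<delta>" unfolding \<delta>_def using r_\<alpha> by (rule LeastI)
  have "\<delta> \<le> \<alpha>" unfolding \<delta>_def using r_\<alpha> by (rule Least_le)
  have cof: "\<exists>n. x < r n" if "x < \<delta>" for x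
  proof -
    have "\<not> (\<forall>n. r n < x)" using that unfolding \<delta>_def by (rule not_less_Least)
    then obtain n where "x \<le> r n" by (auto simp: not_less)
    then show ?thesis using r_Suc[of n] by (intro exI[of _ "Suc n"]) simp
  qed
  have lp: "limit_point (C \<alpha>) \<delta>"
    unfolding limit_point_iff using \<delta> cof r_in by blast
  then have lim: "limit_ord \<delta>" by (rule limit_point_imp_limit_ord)
  have "C \<delta> = {..<\<delta>} \<inter> C \<alpha>"
    using coherent[OF \<alpha> _ lp] \<open>\<delta> \<le> \<alpha>\<close> cl(1) by (cases "\<delta> = \<alpha>") auto
  moreover have "\<gamma>\<^sub>0 < \<delta>" using \<delta> spec[of _ 0] by (simp add: r_def) (metis funpow_0)
  ultimately have sub: "C \<alpha> \<inter> {..<\<gamma>\<^sub>0} \<subseteq> C \<delta>" by (auto intro: less_trans)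
  have "{..<l} \<subseteq> rk (C \<alpha>) ` C \<delta>"
  proof
    fix x assume "x \<in> {..<l}"
    then have "\<exists>\<gamma>\<in>C \<alpha>. \<gamma> < \<gamma>\<^sub>0 \<and> rk (C \<alpha>) \<gamma> = x" using \<gamma>\<^sub>0(3) by (intro rk_surj) simp
    then show "x \<in> rk (C \<alpha>) ` C \<delta>" using sub by blast
  qed
  then have large: "|{..<l}| \<le>o |C \<delta>|"
    using card_of_mono1 card_of_image ordLeq_transitive by metis
  \<comment> \<open>The ordinal \<omega>, a bound for the cofinality of
    \<open>\<delta>\<close>.\<close>
  define w where "w = (LEAST w :: 'k. infinite {..<w})"
  have w: "infinite {..<w}" unfolding w_def using infinite_initial by (rule LeastI_ex)
  have w_least: "finite {..<x}" if "x < w" for x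
    using not_less_Least[of x "\<lambda>w. infinite {..<w}"] that unfolding w_def by blast
  have "w < l"
  proof (rule ccontr)
    assume "\<not> w < l"
    then have "|{..<l}| \<le>o natLeq" by (intro card_of_finite_initials w_least) auto
    then show False using l(2) not_ordLess_ordLeq by blast
  qed
  have "|range r| \<le>o |UNIV :: nat set|" by (rule card_of_image)
  also have "|UNIV :: nat set| \<le>o |{..<w}|" using w infinite_iff_card_of_nat by blast
  finally have "|range r| \<le>o |{..<w}|" .
  then obtain f where f: "f ` {..<w} = range r" using card_of_ordLeq2[of "range r" "{..<w}"] by auto
  have "cofinality \<delta> \<le> w"
  proof (rule cofinality_le)
    show "f ` {..<w} \<subseteq> {..<\<delta>}" using f \<delta> by auto
    show "cofinal (f ` {..<w}) (ord_rel {..<\<delta>})"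
      unfolding cofinal_initial_iff f using cof \<delta> by blast
  qed
  then have "|C \<delta>| <o ord_rel {..<l}" using narrow[OF lim] \<open>w < l\<close> by simp
  then have "|C \<delta>| <o |{..<l}|" using l(1) ordLess_ordIso_trans by blast
  then show False using large not_ordLess_ordLeq by blast
qed

text \<open>An increasing sequence that overtakes an enumeration of \<alpha> is cofinal in it. Below
  \<alpha> it has no limit points, since no term lies between consecutive ones.\<close>

lemma countable_ladder:
  assumes \<alpha>: "limit_ord (\<alpha> :: 'k)" and "countable {..<\<alpha>}"
  shows "\<exists>A. club_in {..<\<alpha>} A \<and> (\<forall>\<beta><\<alpha>. \<not> limit_point A \<beta>)"
proof -
  have ne: "{..<\<alpha>} \<noteq> {}" using \<alpha> by (simp add: limit_ord_def)
  define e where "e = from_nat_into {..<\<alpha>}"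
  have e: "range e = {..<\<alpha>}" unfolding e_def using ne assms(2) by (rule range_from_nat_into)
  have "\<forall>x n. \<exists>y. x < \<alpha> \<longrightarrow> y < \<alpha> \<and> x < y \<and> e n < y"
  proof (intro allI)
    fix x n
    have "e n < \<alpha>" using e by auto
    then show "\<exists>y. x < \<alpha> \<longrightarrow> y < \<alpha> \<and> x < y \<and> e n < y"
      using \<alpha> unfolding limit_ord_def by (metis less_trans linorder_less_linear)
  qed
  then obtain nx where nx: "\<And>x n. x < \<alpha> \<Longrightarrow> nx x n < \<alpha> \<and> x < nx x n \<and> e n < nx x n" by metis
  define r where "r = rec_nat (e 0) (\<lambda>n x. nx x n)"
  have r_lt: "r n < \<alpha>" for n by (induction n) (use e nx in \<open>auto simp: r_def\<close>)
  have r_Suc: "r n < r (Suc n)" "e n < r (Suc n)" for n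
    using nx[OF r_lt[of n], of n] by (auto simp: r_def)
  have mono: "strict_mono r" using r_Suc(1) by (rule strict_monoI_Suc)
  have cof: "\<exists>n. x < r n" if "x < \<alpha>" for x
  proof -
    have "x \<in> range e" using e that by simp
    then show ?thesis using r_Suc(2) by blast
  qed
  have no: "\<not> limit_point (range r) \<beta>" if \<beta>: "\<beta> < \<alpha>" for \<beta>
  proof
    assume lp: "limit_point (range r) \<beta>"
    define n where "n = (LEAST n. \<beta> \<le> r n)"
    obtain m where "\<beta> < r m" using cof[OF \<beta>] by blast
    then have "\<beta> \<le> r m" by simp
    then have n: "\<beta> \<le> r n" unfolding n_def by (rule LeastI)
    have below: "r k < \<beta>" if "k < n" for k
      using not_less_Least[of k "\<lambda>n. \<beta> \<le> r n"] that unfolding n_def by auto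
    show False
    proof (cases n)
      case 0
      obtain k where "r k < \<beta>" using lp unfolding limit_point_iff by blast
      moreover have "r 0 \<le> r k" using mono by (simp add: strict_mono_less_eq)
      ultimately show False using n 0 by auto
    next
      case (Suc m)
      then obtain k where "r m < r k" "r k < \<beta>"
        using lp below[of m] unfolding limit_point_iff by blast
      then have "m < k" "k < n" using n mono by (auto simp: strict_mono_less intro: less_le_trans)
         (metis less_le_trans strict_mono_less)
      then show False using Suc by simp
    qed
  qed
  have "club_in {..<\<alpha>} (range r)"
    unfolding club_in_initial_iff using r_lt no cof by blast
  then show ?thesis using no by blast
qed

text \<open>\<open>\<theta>\<close> stands for the order type of \<open>C \<alpha>\<close>; only its
  few values and its injectivity on limit points of each club matter. The bound \<open>b'\<close>
  gives the columns of the Ulam matrices.\<close>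

lemma embedding:
  fixes C :: "'k \<Rightarrow> 'k set" and \<theta> :: "'k \<Rightarrow> 'k" and b b' :: 'k
  assumes club: "\<And>\<alpha>. limit_ord \<alpha> \<Longrightarrow> club_in {..<\<alpha>} (C \<alpha>)"
    and coherent: "\<And>\<alpha> \<beta>. limit_ord \<alpha> \<Longrightarrow> \<beta> < \<alpha> \<Longrightarrow> limit_point (C \<alpha>) \<beta> \<Longrightarrow> C \<beta> = {..<\<beta>} \<inter> C \<alpha>"
    and \<theta>: "\<And>\<alpha>. limit_ord \<alpha> \<Longrightarrow> \<theta> \<alpha> < b"
    and \<theta>_inj: "\<And>\<alpha> \<beta> \<gamma>. limit_ord \<alpha> \<Longrightarrow> \<beta> < \<gamma> \<Longrightarrow> \<gamma> < \<alpha> \<Longrightarrow> limit_point (C \<alpha>) \<beta> \<Longrightarrow>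
      limit_point (C \<alpha>) \<gamma> \<Longrightarrow> \<theta> \<beta> \<noteq> \<theta> \<gamma>"
    and le: "\<And>\<beta> :: 'k. |{..<\<beta>}| \<le>o |{..<b'}|"
  shows "\<exists>F :: 'k set \<Rightarrow> ('k \<Rightarrow> bool) rel. (\<forall>X. F X \<in> borel_equivs) \<and>
    (\<forall>X Y. subset_NS X Y \<longleftrightarrow> borel_reducible (F X) (F Y))"
proof -
  have "\<forall>\<beta> :: 'k. \<exists>j. inj_on j {..<\<beta>} \<and> j ` {..<\<beta>} \<subseteq> {..<b'}"
    using le card_of_ordLeq by blast
  then obtain j where j: "\<And>\<beta> :: 'k. inj_on (j \<beta>) {..<\<beta>}" "\<And>\<beta> \<gamma> :: 'k. \<gamma> < \<beta> \<Longrightarrow> j \<beta> \<gamma> < b'"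
    by (metis image_subset_iff lessThan_iff)
  define R where "R t = {\<alpha>. limit_ord \<alpha> \<and> \<theta> \<alpha> = t}" for t
  have "\<exists>Z. stationary (R t) \<longrightarrow> Z \<subseteq> R t \<and> stationary Z \<and> stationary (R t - Z)" for t
    using stationary_split[of "R t" j b'] j by metis
  then obtain Z where Z: "\<And>t. stationary (R t) \<Longrightarrow> Z t \<subseteq> R t \<and> stationary (Z t) \<and> stationary (R t - Z t)"
    by metis
  define part where "part t i = (if i then Z t else R t - Z t)" for t i
  have part: "part t i \<subseteq> R t" "stationary (part t i)" if "stationary (R t)" for t i
    using Z[OF that] by (auto simp: part_def)
  define Q where "Q X c = (if stationary (R (fst c)) then (R (fst c) - X) \<union> part (fst c) (snd c)
     else Collect limit_ord)" for X c
  \<comment> \<open>The two channels of \<open>t\<close> intersect in \<open>R t - X\<close>, but each set stays stationary even if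
    \<open>R t - X\<close> is not; without this, a channel of the target would be too easy to reduce to.\<close>
  have Q_limit: "Q X c \<subseteq> Collect limit_ord" for X c
    using part(1)[of "fst c" "snd c"] unfolding Q_def R_def by auto
  have Q_stationary: "stationary (Q X c)" for X c
    using part(2)[of "fst c" "snd c"] stationary_limits[OF stationary_UNIV]
    unfolding Q_def by (auto elim: stationary_mono)
  define I where "I = {..<b} \<times> (UNIV :: bool set)"
  have I: "|I| <o |UNIV :: 'k set|"
  proof -
    have "|(\<lambda>t. (t, i)) ` {..<b}| <o |UNIV :: 'k set|" for i :: bool
      using card_of_image initial_small ordLeq_ordLess_trans by blast
    moreover have "I = (\<lambda>t. (t, True)) ` {..<b} \<union> (\<lambda>t. (t, False)) ` {..<b}"
      by (auto simp: I_def)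
    ultimately show ?thesis using card_of_Un_ordLess_infinite[OF infinite_UNIV_k] by metis
  qed
  have "|I \<times> (UNIV :: 'k set)| \<le>o |UNIV :: 'k set|"
    by (intro Times_le_k ordLess_imp_ordLeq[OF I] subset_le_k)
  from card_of_ordLeq[THEN iffD2, OF this]
  obtain f :: "_ \<Rightarrow> 'k" where "inj_on f (I \<times> (UNIV :: 'k set))" by blast
  then have enc: "inj_on (case_prod (curry f)) (I \<times> UNIV)" by simp
  define F where "F X = product_rel I (curry f) (Q X)" for X
  have "F X \<in> borel_equivs" for X
    unfolding F_def by (rule product_rel_borel_equiv[OF ordLess_imp_ordLeq[OF I] Q_limit])
  moreover have "borel_reducible (F X) (F Y)" if sub: "subset_NS X Y" for X Y
    unfolding F_def
  proof (rule product_rel_reducible[OF enc])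
    obtain K where K: "club_in UNIV K" "(X - Y) \<inter> K = {}"
      using sub unfolding subset_NS_def stationary_def by blast
    fix c assume "c \<in> I"
    \<comment> \<open>On \<open>K\<close> the set \<open>X\<close> is contained in \<open>Y\<close>,
      and passing to complements reverses the inclusion.\<close>
    have "Q Y c \<inter> (K \<inter> Collect limit_ord) \<subseteq> Q X c" using K(2) unfolding Q_def by auto
    then show "\<exists>\<phi>. local_fun \<phi> \<and> (\<forall>\<eta> \<xi>. eqv (Q X c) \<eta> \<xi> \<longleftrightarrow> eqv (Q Y c) (\<phi> \<eta>) (\<phi> \<xi>))"
      by (rule reduction[OF Q_limit Q_limit Q_stationary club_Int[OF K(1) club_limit_ord] Int_lower2])
  qed
  moreover have "\<not> borel_reducible (F X) (F Y)" if nsub: "\<not> subset_NS X Y" for X Y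
  proof -
    have "stationary ((X - Y) \<inter> Collect limit_ord)"
      using nsub stationary_limits by (simp add: subset_NS_def)
    then have "stationary (\<Union>t<b. (X - Y) \<inter> R t)"
      by (rule stationary_mono) (use \<theta> in \<open>auto simp: R_def\<close>)
    then obtain t where t: "t < b" "stationary ((X - Y) \<inter> R t)" using stationary_UN_initial by blast
    then have Rt: "stationary (R t)" by (auto elim: stationary_mono)
    \<comment> \<open>The two parts are disjoint, so each point is outside at least one of them. The
      source channel \<open>i\<close> is chosen by which part leaves a stationary remainder.\<close>
    have "stationary (((X - Y) \<inter> R t - part t True) \<union> ((X - Y) \<inter> R t - part t False))"
      using t(2) by (rule stationary_mono) (auto simp: part_def)
    then obtain i where i: "stationary ((X - Y) \<inter> R t - part t i)" using stationary_Un by blast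
    have Qt: "Q X (t, i) = (R t - X) \<union> part t i" using Rt by (simp add: Q_def)
    have QR: "Q X (t, i) \<subseteq> R t" using part(1)[OF Rt] by (auto simp: Qt)
    show ?thesis
      unfolding F_def
    proof (rule product_rel_not_reducible[OF enc I Q_limit _ _ club coherent])
      show "(t, i) \<in> I" using t(1) by (simp add: I_def)
      fix d assume "d \<in> I"
      obtain t' i' where d: "d = (t', i')" by (cases d)
      show "stationary (Q Y d - Q X (t, i))"
      \<comment> \<open>For another stationary class its own part is disjoint from
        \<open>R t\<close>. Otherwise \<open>Q Y d\<close> contains \<open>R t - Y\<close>, because
        \<open>t' = t\<close> or because it consists of all limit ordinals.\<close>
      proof (cases "stationary (R t') \<and> t' \<noteq> t")
        case True
        have "part t' i' \<subseteq> Q Y d - Q X (t, i)"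
          using True part(1)[of t' i'] QR unfolding d by (auto simp: Q_def R_def)
        then show ?thesis using part(2) True stationary_mono by blast
      next
        case False
        have "(X - Y) \<inter> R t - part t i \<subseteq> Q Y d - Q X (t, i)"
          using False unfolding Qt d by (auto simp: Q_def R_def)
        then show ?thesis using i stationary_mono by blast
      qed
    next
      fix \<alpha> \<beta> \<gamma>
      assume "limit_ord \<alpha>" "\<beta> < \<gamma>" "\<gamma> < \<alpha>" "limit_point (C \<alpha>) \<beta>" "limit_point (C \<alpha>) \<gamma>"
        "\<beta> \<in> Q X (t, i)"
      then show "\<gamma> \<notin> Q X (t, i)" using \<theta>_inj[of \<alpha> \<beta> \<gamma>] QR unfolding R_def by auto
    qed
  qed
  ultimately show ?thesis by (intro exI[of _ F]) blast
qed

end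

section \<open>The cardinal hypotheses\<close>

lemma regular_wellorderI:
  assumes card: "card_order (kappa :: 'k::wellorder rel)"
    and unc: "natLeq <o (kappa :: 'k::wellorder rel)"
    and reg: "regularCard (kappa :: 'k::wellorder rel)"
    and pow: "\<forall>\<alpha>::'k::wellorder. {..<\<alpha>} \<noteq> {} \<longrightarrow> (kappa :: 'k::wellorder rel) ^c ord_rel {..<\<alpha>} =o (kappa :: 'k::wellorder rel)"
  shows "regular_wellorder TYPE('k)"
proof
  have iso: "(kappa :: 'k rel) =o |UNIV :: 'k set|" using card by (rule card_of_unique)
  show "(kappa :: 'k rel) =o |UNIV :: 'k set|" by (rule iso)
  show unc': "natLeq <o |UNIV :: 'k set|" using unc iso ordLess_ordIso_trans by blast
  have Card: "Card_order (kappa :: 'k rel)" using card card_order_on_Card_order by blast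
  have Field: "Field (kappa :: 'k rel) = UNIV" by (simp add: kappa_def)
  have inf: "infinite (UNIV :: 'k set)"
    using unc' ordLess_imp_ordLeq infinite_iff_natLeq_ordLeq by blast
  have no_max: "\<exists>b. a < b" for a :: 'k
    using infinite_Card_order_limit[OF Card, of a] inf unfolding Field
    by (auto simp: kappa_def ord_rel_def less_le)
  show "\<exists>u. \<forall>x\<in>B. x < u" if B: "|B :: 'k set| <o |UNIV :: 'k set|" for B
  proof -
    have "\<not> cofinal B (kappa :: 'k rel)"
    proof
      assume "cofinal B (kappa :: 'k rel)"
      then have "|B| =o (kappa :: 'k rel)" using reg Field unfolding regularCard_def by blast
      then show False using B iso not_ordLess_ordIso ordIso_transitive by blast
    qed
    then obtain a where "\<forall>x\<in>B. x \<le> a"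
      unfolding cofinal_def Field by (auto simp: kappa_def ord_rel_def) (metis linear)
    then show ?thesis using no_max[of a] le_less_trans by blast
  qed
  show initial: "|{..<\<alpha> :: 'k}| <o |UNIV :: 'k set|" for \<alpha>
  proof -
    have "underS kappa \<alpha> = {..<\<alpha>}" by (auto simp: underS_def kappa_def ord_rel_def less_le)
    then show ?thesis using card_of_underS[OF Card, of \<alpha>] Field iso ordLess_ordIso_trans by auto
  qed
  define P where "P u = {p :: 'k \<Rightarrow> bool. \<forall>x\<ge>u. \<not> p x}" for u
  obtain k\<^sub>0 k\<^sub>1 :: 'k where k: "k\<^sub>0 < k\<^sub>1" using no_max by blast
  have P_le: "|P u| \<le>o |UNIV :: 'k set|" if u: "{..<u} \<noteq> {}" for u
  proof -
    \<comment> \<open>The power hypothesis counts functions into \<kappa>, so bits are coded by two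
      ordinals \<open>k\<^sub>0\<close> and \<open>k\<^sub>1\<close>.\<close>
    define f where "f p = (\<lambda>x. if x < u then (if p x then k\<^sub>1 else k\<^sub>0) else undefined)" for p
    have "inj_on f (P u)"
    proof (rule inj_onI)
      fix p q assume pq: "p \<in> P u" "q \<in> P u" "f p = f q"
      show "p = q"
      proof
        fix x
        have "f p x = f q x" using pq(3) by simp
        then show "p x = q x"
          using pq(1,2) less_imp_neq[OF k] by (cases "x < u") (auto simp: P_def f_def split: if_splits)
      qed
    qed
    moreover have "f ` P u \<subseteq> Func {..<u} UNIV" by (auto simp: f_def Func_def)
    ultimately have "|P u| \<le>o |Func {..<u} (UNIV :: 'k set)|" using card_of_ordLeq by blast
    also have "|Func {..<u} (UNIV :: 'k set)| =o (kappa :: 'k rel)"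
      using pow u unfolding cexp_def Field by simp
    also note iso
    finally show ?thesis .
  qed
  \<comment> \<open>Bounds from \<open>k\<^sub>1\<close> on suffice, and they give the nonzero
    exponents to which \<open>pow\<close> applies.\<close>
  have "{p :: 'k \<Rightarrow> bool. \<exists>u. \<forall>x\<ge>u. \<not> p x} = (\<Union>u\<in>{k\<^sub>1..}. P u)"
  proof (rule set_eqI, rule iffI)
    fix p :: "'k \<Rightarrow> bool" assume "p \<in> {p. \<exists>u. \<forall>x\<ge>u. \<not> p x}"
    then obtain u where "\<forall>x\<ge>u. \<not> p x" by blast
    then have "p \<in> P (max u k\<^sub>1)" by (simp add: P_def)
    then show "p \<in> (\<Union>u\<in>{k\<^sub>1..}. P u)" by (intro UN_I[of "max u k\<^sub>1"]) simp_all
  qed (auto simp: P_def)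
  moreover have "|\<Union>u\<in>{k\<^sub>1..}. P u| \<le>o |UNIV :: 'k set|"
  proof (rule card_of_UNION_ordLeq_infinite[OF inf])
    show "\<forall>u\<in>{k\<^sub>1..}. |P u| \<le>o |UNIV :: 'k set|"
    proof
      fix u assume "u \<in> {k\<^sub>1..}"
      then have "k\<^sub>0 \<in> {..<u}" using k by auto
      then show "|P u| \<le>o |UNIV :: 'k set|" by (intro P_le) blast
    qed
  qed (simp add: card_of_mono1)
  ultimately show "|{p :: 'k \<Rightarrow> bool. \<exists>u. \<forall>x\<ge>u. \<not> p x}| \<le>o |UNIV :: 'k set|" by simp
qed

theorem theorem12:
  assumes "card_order (kappa :: 'k::wellorder rel)"
    and "natLeq <o (kappa :: 'k::wellorder rel)"
    and "regularCard (kappa :: 'k::wellorder rel)"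
    and "\<forall>\<alpha>::'k::wellorder. {..<\<alpha>} \<noteq> {} \<longrightarrow> (kappa :: 'k::wellorder rel) ^c ord_rel {..<\<alpha>} =o (kappa :: 'k::wellorder rel)"
    and "(kappa :: 'k::wellorder rel) =o cardSuc natLeq \<or>
         (\<exists>l::'k::wellorder. kappa_succ_of l \<and> regularCard (ord_rel {..<l}) \<and> natLeq <o ord_rel {..<l} \<and>
                  cardSuc natLeq <o (kappa :: 'k::wellorder rel) \<and> square l)"
  shows "\<exists>F :: 'k::wellorder set \<Rightarrow> ('k \<Rightarrow> bool) rel.
           (\<forall>X. F X \<in> borel_equivs) \<and>
           (\<forall>X Y. subset_NS X Y \<longleftrightarrow> borel_reducible (F X) (F Y))"
proof -
  interpret regular_wellorder "TYPE('k)" using assms(1-4) by (rule regular_wellorderI)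
  have initial_le: "|{..<\<beta> :: 'k}| \<le>o r"
    if "(kappa :: 'k rel) =o cardSuc r" "Card_order r" for \<beta> and r :: "'b rel"
  proof -
    have "|{..<\<beta>}| <o (kappa :: 'k rel)"
      using initial_small kappa_card ordIso_symmetric ordLess_ordIso_trans by blast
    then have "|{..<\<beta>}| <o cardSuc r" using that(1) ordLess_ordIso_trans by blast
    then show ?thesis using cardSuc_ordLeq_ordLess[OF that(2) card_of_Card_order] by blast
  qed
  from assms(5) show ?thesis
  proof (elim disjE exE conjE)
    assume "(kappa :: 'k rel) =o cardSuc natLeq"
    then have le: "|{..<\<beta> :: 'k}| \<le>o natLeq" for \<beta> using natLeq_Card_order by (rule initial_le)
    obtain w :: 'k where "infinite {..<w}" using infinite_initial by blast
    then have w: "natLeq \<le>o |{..<w}|" using infinite_iff_natLeq_ordLeq by blast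
    have "countable {..<\<beta> :: 'k}" for \<beta>
    proof -
      have "|{..<\<beta>}| \<le>o |UNIV :: nat set|"
        using le card_of_nat ordLeq_ordIso_trans ordIso_symmetric by blast
      then show ?thesis using card_of_ordLeq[of "{..<\<beta>}" "UNIV :: nat set"] unfolding countable_def by blast
    qed
    then have "\<forall>\<alpha> :: 'k. \<exists>A. limit_ord \<alpha> \<longrightarrow> club_in {..<\<alpha>} A \<and> (\<forall>\<beta><\<alpha>. \<not> limit_point A \<beta>)"
      using countable_ladder by blast
    then obtain C where C: "\<And>\<alpha> :: 'k. limit_ord \<alpha> \<Longrightarrow> club_in {..<\<alpha>} (C \<alpha>)"
      "\<And>\<alpha> \<beta> :: 'k. limit_ord \<alpha> \<Longrightarrow> \<beta> < \<alpha> \<Longrightarrow> \<not> limit_point (C \<alpha>) \<beta>" by metis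
    obtain b where "w < b" using no_max by blast
    show ?thesis
    \<comment> \<open>Clubs of type \<omega> have no limit points below \<open>\<alpha>\<close>, so
      coherence and injectivity are vacuous and one class is enough.\<close>
    proof (rule embedding[of C "\<lambda>_. w" b w])
      show "|{..<\<beta> :: 'k}| \<le>o |{..<w}|" for \<beta> using le w ordLeq_transitive by blast
    qed (use C \<open>w < b\<close> in blast)+
  next
    fix l :: 'k
    assume l: "kappa_succ_of l" "natLeq <o ord_rel {..<l}" "square l"
    have card: "card_order_on {..<l} (ord_rel {..<l})" and suc: "(kappa :: 'k rel) =o cardSuc (ord_rel {..<l})"
      using l(1) by (auto simp: kappa_succ_of_def)
    have iso: "ord_rel {..<l} =o |{..<l}|" using card by (rule card_of_unique)
    have unc: "natLeq <o |{..<l}|" using l(2) iso ordLess_ordIso_trans by blast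
    have le: "|{..<\<beta> :: 'k}| \<le>o |{..<l}|" for \<beta>
      using initial_le[OF suc] card card_order_on_Card_order iso ordLeq_ordIso_trans by blast
    obtain C where C: "\<And>\<alpha>. limit_ord \<alpha> \<Longrightarrow> club_in {..<\<alpha>} (C \<alpha>)"
      "\<And>\<alpha> \<beta>. limit_ord \<alpha> \<Longrightarrow> \<beta> < \<alpha> \<Longrightarrow> limit_point (C \<alpha>) \<beta> \<Longrightarrow> C \<beta> = {..<\<beta>} \<inter> C \<alpha>"
      "\<And>\<alpha>. limit_ord \<alpha> \<Longrightarrow> cofinality \<alpha> < l \<Longrightarrow> |C \<alpha>| <o ord_rel {..<l}"
      using l(3) unfolding square_def by blast
    obtain b where "l < b" using no_max by blast
    show ?thesis
    proof (rule embedding[of C "\<lambda>\<alpha>. rk (C \<alpha>) \<alpha>" b l, OF C(1,2) _ _ le])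
      show "rk (C \<alpha>) \<alpha> < b" if "limit_ord \<alpha>" for \<alpha>
        using square_rk_le[OF iso unc C that] \<open>l < b\<close> by simp
      fix \<alpha> \<beta> \<gamma>
      assume \<alpha>: "limit_ord \<alpha>" "\<beta> < \<gamma>" "\<gamma> < \<alpha>" "limit_point (C \<alpha>) \<beta>" "limit_point (C \<alpha>) \<gamma>"
      \<comment> \<open>By coherence, the order type of \<open>C \<delta>\<close> is the rank of
        \<open>\<delta>\<close> in \<open>C \<alpha>\<close>, which increases strictly along
        \<open>C \<alpha>\<close>.\<close>
      have eq: "rk (C \<delta>) \<delta> = rk (C \<alpha>) \<delta>" if "\<delta> < \<alpha>" "limit_point (C \<alpha>) \<delta>" for \<delta>
        using C(2)[OF \<alpha>(1) that] by (intro rk_cong) auto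
      have "\<beta> < \<alpha>" using \<alpha>(2,3) by simp
      then have "\<beta> \<in> C \<alpha>" using C(1)[OF \<alpha>(1)] \<alpha>(4) unfolding club_in_initial_iff by blast
      then have "rk (C \<alpha>) \<beta> < rk (C \<alpha>) \<gamma>" using \<alpha>(2) by (rule rk_strict)
      then show "rk (C \<beta>) \<beta> \<noteq> rk (C \<gamma>) \<gamma>" using eq \<alpha> \<open>\<beta> < \<alpha>\<close> by simp
    qed
  qed
qed

end
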